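(* Let $p$ be a prime and let $k$ be a field of characteristic $p$. Let $J=\{\mathbf a\in\mathbf W_{\mathbf Z_p^2}(k): a_T=0 \text{ for every cyclic } T\}$ and $R=\mathbf W_{\mathbf Z_p^2}(k)/J$. Let $\Phi:R\to \mathrm{Lip}_{p^{-1}}(\mathbf P^1(\mathbf Q_p),\mathbf W(k))$ be the ring isomorphism $\Phi(\mathbf a)=f_{\mathbf a}$, where for $x\in\mathbf P^1(\mathbf Q_p)$ corresponding to the infinite rooted path $T_0,T_1,T_2,\dots$ one sets $f_{\mathbf a}(x)=(a_{T_0},a_{T_1},a_{T_2},\dots)\in\mathbf W(k)$. Then $\Phi:(R,\|\cdot\|_{\mathrm{IV}})\to(\mathrm{Lip}_{p^{-1}}(\mathbf P^1(\mathbf Q_p),\mathbf W(k)),\|\cdot\|_{\sup})$ is an isometry.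
   Context: Witt–Burnside rings. For a profinite group $G$, let $\mathcal F(G)$ be the set of isomorphism classes of finite discrete transitive $G$-sets (each is $G/H$, $H$ open). Write $U\le T$ if there is a $G$-map $T\to U$, and let $\varphi_T(U)$ be the number of $G$-maps $T\to U$. The $T$-th Witt polynomial is $W_T(\underline X)=\sum_{U\le T}\varphi_T(U)X_U^{\#T/\#U}$. By Dress–Siebeneicher there are unique polynomials $S_T,M_T\in\mathbf Z[\underline X,\underline Y]$ with $W_T(\underline X)+W_T(\underline Y)=W_T(\underline S)$ and $W_T(\underline X)W_T(\underline Y)=W_T(\underline M)$ for all $T$. For a commutative ring $A$, $\mathbf W_G(A)$ is the set $\prod_{T\in\mathcal F(G)}A$ with $\mathbf a+\mathbf b=(S_T(\mathbf a,\mathbf b))_T$ and $\mathbf a\mathbf b=(M_T(\mathbf a,\mathbf b))_T$; it is a commutative ring. $\mathbf W(k)=\mathbf W_{\mathbf Z_p}(k)$ is the ring of $p$-typical Witt vectors. Cyclic sets and the tree. A $\mathbf Z_p^2$-set $\mathbf Z_p^2/H$ is cyclic if the group $\mathbf Z_p^2/H$ is cyclic. The cyclic elements of $\mathcal F(\mathbf Z_p^2)$ are the vertices of a tree $\mathcal T$ rooted at $T_0=\mathbf Z_p^2/\mathbf Z_p^2$, with an edge between $U$ and $T$ when $U\le T$ and $\#T=p\,\#U$; this is the tree of $\mathbf Z_p$-lattices in $\mathbf Q_p^2$ up to $\mathbf Q_p^\times$-scaling. Elements of $R$ are identified with families $(a_T)_{T\in\mathcal T}$, $a_T\in k$. Boundary.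 $\mathbf P^1(\mathbf Q_p)$ is identified with the set of infinite non-backtracking paths $T_0,T_1,T_2,\dots$ in $\mathcal T$ starting at the root, with metric $d(x,y)=p^{-n}$ for $x\ne y$, where $n$ is the number of edges the paths $x,y$ have in common (and $d(x,x)=0$). Norms. For nonzero $\mathbf a\in R$, $\|\mathbf a\|_{\mathrm{IV}}=p^{-n}$ where $p^n$ is the least size $\#T$ of a vertex $T\in\mathcal T$ with $a_T\neq0$; $\|\mathbf 0\|_{\mathrm{IV}}=0$. For nonzero $w=(w_0,w_1,\dots)\in\mathbf W(k)$, $\|w\|_{\mathbf W(k)}=p^{-n}$ with $n$ the least index such that $w_n\ne0$; $\|0\|_{\mathbf W(k)}=0$. $\mathrm{Lip}_{\alpha}(\mathbf P^1(\mathbf Q_p),\mathbf W(k))$ is the ring (pointwise operations) of $f:\mathbf P^1(\mathbf Q_p)\to\mathbf W(k)$ with $\|f(x)-f(y)\|_{\mathbf W(k)}\le\alpha\, d(x,y)$ for all $x,y$, and $\|f\|_{\sup}=\sup_x\|f(x)\|_{\mathbf W(k)}$. *)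

theory Defs
  imports
    "HOL-Analysis.Product_Topology"
    "HOL-Analysis.Function_Topology"
    "HOL-Library.Poly_Mapping"
    "HOL-Library.FuncSet"
    "HOL-Algebra.Left_Coset"
    "HOL-Algebra.Elementary_Groups"
    "HOL-Algebra.QuotRing"
    "HOL-Computational_Algebra.Primes"
begin

section \<open>Finite discrete transitive G-sets\<close>

text \<open>
  A profinite group is a group \<open>G\<close> together with a topology \<open>X\<close> on its carrier. Every finite
  discrete transitive \<open>G\<close>-set is isomorphic to a left coset space \<open>G/H\<close> with \<open>H\<close> an open subgroup
  (of finite index, by compactness). An isomorphism class of such \<open>G\<close>-sets is therefore encoded as
  the set of all open subgroups \<open>H\<close> such that \<open>G/H\<close> belongs to the class.
\<close>

definition open_subgroups :: "('g, 'm) monoid_scheme \<Rightarrow> 'g topology \<Rightarrow> 'g set set" where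
  "open_subgroups G X = {H. subgroup H G \<and> openin X H}"

definition gmaps :: "('g, 'm) monoid_scheme \<Rightarrow> 'g set \<Rightarrow> 'g set \<Rightarrow> ('g set \<Rightarrow> 'g set) set" where
  "gmaps G H K = {f \<in> LCOSETS G H \<rightarrow>\<^sub>E LCOSETS G K.
     \<forall>g\<in>carrier G. \<forall>C\<in>LCOSETS G H. f (g <#\<^bsub>G\<^esub> C) = g <#\<^bsub>G\<^esub> f C}"

definition gset_iso :: "('g, 'm) monoid_scheme \<Rightarrow> 'g topology \<Rightarrow> ('g set \<times> 'g set) set" where
  "gset_iso G X = {(H, K). H \<in> open_subgroups G X \<and> K \<in> open_subgroups G X \<and>
     (\<exists>f\<in>gmaps G H K. bij_betw f (LCOSETS G H) (LCOSETS G K))}"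

definition gset_class :: "('g, 'm) monoid_scheme \<Rightarrow> 'g topology \<Rightarrow> 'g set \<Rightarrow> 'g set set" where
  "gset_class G X H = gset_iso G X `` {H}"

definition gset_classes :: "('g, 'm) monoid_scheme \<Rightarrow> 'g topology \<Rightarrow> 'g set set set" where
  "gset_classes G X = open_subgroups G X // gset_iso G X"

text \<open>The following notions do not depend on the chosen representatives.\<close>

definition gset_size :: "('g, 'm) monoid_scheme \<Rightarrow> 'g set set \<Rightarrow> nat" where
  "gset_size G T = card (LCOSETS G (SOME H. H \<in> T))"

definition gset_phi :: "('g, 'm) monoid_scheme \<Rightarrow> 'g set set \<Rightarrow> 'g set set \<Rightarrow> nat" where
  "gset_phi G T U = card (gmaps G (SOME H. H \<in> T) (SOME K. K \<in> U))"

definition gset_le :: "('g, 'm) monoid_scheme \<Rightarrow> 'g set set \<Rightarrow> 'g set set \<Rightarrow> bool" where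
  "gset_le G U T \<longleftrightarrow> gmaps G (SOME H. H \<in> T) (SOME K. K \<in> U) \<noteq> {}"


section \<open>Witt--Burnside rings\<close>

text \<open>
  \<open>witt_poly G X T c\<close> is the value of the \<open>T\<close>-th Witt polynomial at a family \<open>c\<close> of elements
  of a commutative ring; taking for \<open>c\<close> a family of variables gives the polynomial itself.
\<close>

definition witt_poly ::
  "('g, 'm) monoid_scheme \<Rightarrow> 'g topology \<Rightarrow> 'g set set \<Rightarrow> ('g set set \<Rightarrow> 'a) \<Rightarrow> 'a::comm_ring_1" where
  "witt_poly G X T c =
     (\<Sum>U | U \<in> gset_classes G X \<and> gset_le G U T.
        of_nat (gset_phi G T U) * c U ^ (gset_size G T div gset_size G U))"

text \<open>Polynomials with integer coefficients in the variables \<open>v\<close> of type \<open>'v\<close>.\<close>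

type_synonym 'v int_mpoly = "('v \<Rightarrow>\<^sub>0 nat) \<Rightarrow>\<^sub>0 int"

definition mpoly_var :: "'v \<Rightarrow> 'v int_mpoly" where
  "mpoly_var v = Poly_Mapping.single (Poly_Mapping.single v 1) 1"

definition mpoly_eval :: "'v int_mpoly \<Rightarrow> ('v \<Rightarrow> 'a) \<Rightarrow> 'a::comm_ring_1" where
  "mpoly_eval P c =
     (\<Sum>m\<in>Poly_Mapping.keys P. of_int (Poly_Mapping.lookup P m) *
        (\<Prod>v\<in>Poly_Mapping.keys m. c v ^ Poly_Mapping.lookup m v))"

text \<open>
  The unique families of integer polynomials \<open>S\<close> and \<open>M\<close> of Dress and Siebeneicher; the variables
  \<open>X\<^sub>U\<close> and \<open>Y\<^sub>U\<close> are \<open>Inl U\<close> and \<open>Inr U\<close>.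
\<close>

definition witt_S ::
  "('g, 'm) monoid_scheme \<Rightarrow> 'g topology \<Rightarrow> 'g set set \<Rightarrow> ('g set set + 'g set set) int_mpoly" where
  "witt_S G X = (THE S. S \<in> extensional (gset_classes G X) \<and>
     (\<forall>T\<in>gset_classes G X.
        witt_poly G X T (\<lambda>U. mpoly_var (Inl U)) + witt_poly G X T (\<lambda>U. mpoly_var (Inr U))
          = witt_poly G X T S))"

definition witt_M ::
  "('g, 'm) monoid_scheme \<Rightarrow> 'g topology \<Rightarrow> 'g set set \<Rightarrow> ('g set set + 'g set set) int_mpoly" where
  "witt_M G X = (THE M. M \<in> extensional (gset_classes G X) \<and>
     (\<forall>T\<in>gset_classes G X.
        witt_poly G X T (\<lambda>U. mpoly_var (Inl U)) * witt_poly G X T (\<lambda>U. mpoly_var (Inr U))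
          = witt_poly G X T M))"

text \<open>
  The zero and unit elements are the families with ghost components constantly \<open>0\<close> and \<open>1\<close>;
  the latter is \<open>1\<close> at the one-point \<open>G\<close>-set and \<open>0\<close> elsewhere.
\<close>

definition witt_ring ::
  "('g, 'm) monoid_scheme \<Rightarrow> 'g topology \<Rightarrow> ('g set set \<Rightarrow> 'a::comm_ring_1) ring" where
  "witt_ring G X =
     \<lparr>carrier = gset_classes G X \<rightarrow>\<^sub>E UNIV,
      monoid.mult = (\<lambda>a b. \<lambda>T\<in>gset_classes G X. mpoly_eval (witt_M G X T) (case_sum a b)),
      one = (\<lambda>T\<in>gset_classes G X. if T = gset_class G X (carrier G) then 1 else 0),
      zero = (\<lambda>T\<in>gset_classes G X. 0),
      add = (\<lambda>a b. \<lambda>T\<in>gset_classes G X. mpoly_eval (witt_S G X T) (case_sum a b))\<rparr>"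


section \<open>The profinite groups $\mathbf{Z}_p$ and $\mathbf{Z}_p^2$\<close>

text \<open>A $p$-adic integer is the sequence of its residues modulo \<open>p^n\<close>.\<close>

type_synonym padic = "nat \<Rightarrow> int"

definition Zp :: "nat \<Rightarrow> padic monoid" where
  "Zp p =
     \<lparr>carrier = {x. \<forall>n. x n \<in> {0..<int p ^ n} \<and> x (Suc n) mod int p ^ n = x n},
      monoid.mult = (\<lambda>x y n. (x n + y n) mod int p ^ n),
      one = (\<lambda>n. 0)\<rparr>"

definition Zp_top :: "nat \<Rightarrow> padic topology" where
  "Zp_top p = subtopology (product_topology (\<lambda>n. discrete_topology UNIV) UNIV) (carrier (Zp p))"

definition Zp2 :: "nat \<Rightarrow> (padic \<times> padic) monoid" where
  "Zp2 p = Zp p \<times>\<times> Zp p"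

definition Zp2_top :: "nat \<Rightarrow> (padic \<times> padic) topology" where
  "Zp2_top p = prod_topology (Zp_top p) (Zp_top p)"

type_synonym vertex = "(padic \<times> padic) set set"


section \<open>$p$-typical Witt vectors\<close>

definition W_Zp :: "nat \<Rightarrow> (padic set set \<Rightarrow> 'a::comm_ring_1) ring" where
  "W_Zp p = witt_ring (Zp p) (Zp_top p)"

text \<open>The \<open>n\<close>-th index is the class of $\mathbf{Z}_p/p^n\mathbf{Z}_p$; the group is written
  multiplicatively, so multiplication by \<open>p^n\<close> is a power.\<close>

definition W_index :: "nat \<Rightarrow> nat \<Rightarrow> padic set set" where
  "W_index p n = gset_class (Zp p) (Zp_top p) ((\<lambda>x. x [^]\<^bsub>Zp p\<^esub> (p ^ n)) ` carrier (Zp p))"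

text \<open>The Witt vector $(w_0,w_1,w_2,\ldots)$.\<close>

definition W_vec :: "nat \<Rightarrow> (nat \<Rightarrow> 'a) \<Rightarrow> padic set set \<Rightarrow> 'a" where
  "W_vec p w = (\<lambda>V\<in>gset_classes (Zp p) (Zp_top p). w (inv_into UNIV (W_index p) V))"

definition W_norm :: "nat \<Rightarrow> (padic set set \<Rightarrow> 'a::comm_ring_1) \<Rightarrow> real" where
  "W_norm p w =
     (if w = \<zero>\<^bsub>W_Zp p\<^esub> then 0 else 1 / real p ^ (LEAST n. w (W_index p n) \<noteq> 0))"


section \<open>The tree of cyclic $\mathbf{Z}_p^2$-sets and its boundary\<close>

abbreviation FZp2 :: "nat \<Rightarrow> vertex set" where
  "FZp2 p \<equiv> gset_classes (Zp2 p) (Zp2_top p)"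

definition cyc_tree :: "nat \<Rightarrow> vertex set" where
  "cyc_tree p = {T \<in> FZp2 p. \<exists>H\<in>T. cyclic_group (Zp2 p Mod H)}"

definition tree_root :: "nat \<Rightarrow> vertex" where
  "tree_root p = gset_class (Zp2 p) (Zp2_top p) (carrier (Zp2 p))"

definition tree_edges :: "nat \<Rightarrow> vertex set set" where
  "tree_edges p = {{U, T} | U T. U \<in> cyc_tree p \<and> T \<in> cyc_tree p \<and>
     gset_le (Zp2 p) U T \<and> gset_size (Zp2 p) T = p * gset_size (Zp2 p) U}"

text \<open>$\mathbf{P}^1(\mathbf{Q}_p)$ as the set of infinite non-backtracking paths from the root.\<close>

definition P1 :: "nat \<Rightarrow> (nat \<Rightarrow> vertex) set" where
  "P1 p = {x. x 0 = tree_root p \<and> (\<forall>n. {x n, x (Suc n)} \<in> tree_edges p) \<and>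
     (\<forall>n. x (Suc (Suc n)) \<noteq> x n)}"

definition P1_dist :: "nat \<Rightarrow> (nat \<Rightarrow> vertex) \<Rightarrow> (nat \<Rightarrow> vertex) \<Rightarrow> real" where
  "P1_dist p x y =
     (if x = y then 0
      else 1 / real p ^ card (range (\<lambda>n. {x n, x (Suc n)}) \<inter> range (\<lambda>n. {y n, y (Suc n)})))"


section \<open>The ring of Lipschitz functions\<close>

definition Lip :: "nat \<Rightarrow> real \<Rightarrow> ((nat \<Rightarrow> vertex) \<Rightarrow> padic set set \<Rightarrow> 'k::field) ring" where
  "Lip p \<alpha> =
     \<lparr>carrier = {f \<in> P1 p \<rightarrow>\<^sub>E carrier (W_Zp p).
        \<forall>x\<in>P1 p. \<forall>y\<in>P1 p. W_norm p (f x \<ominus>\<^bsub>W_Zp p\<^esub> f y) \<le> \<alpha> * P1_dist p x y},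
      monoid.mult = (\<lambda>f g. \<lambda>x\<in>P1 p. f x \<otimes>\<^bsub>W_Zp p\<^esub> g x),
      one = (\<lambda>x\<in>P1 p. \<one>\<^bsub>W_Zp p\<^esub>),
      zero = (\<lambda>x\<in>P1 p. \<zero>\<^bsub>W_Zp p\<^esub>),
      add = (\<lambda>f g. \<lambda>x\<in>P1 p. f x \<oplus>\<^bsub>W_Zp p\<^esub> g x)\<rparr>"

definition sup_norm :: "nat \<Rightarrow> ((nat \<Rightarrow> vertex) \<Rightarrow> padic set set \<Rightarrow> 'k::field) \<Rightarrow> real" where
  "sup_norm p f = (SUP x\<in>P1 p. W_norm p (f x))"


section \<open>The quotient ring and the map to Lipschitz functions\<close>

definition J_ideal :: "nat \<Rightarrow> (vertex \<Rightarrow> 'k::field) set" where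
  "J_ideal p = {a \<in> carrier (witt_ring (Zp2 p) (Zp2_top p)). \<forall>T\<in>cyc_tree p. a T = 0}"

definition R_ring :: "nat \<Rightarrow> (vertex \<Rightarrow> 'k::field) set ring" where
  "R_ring p = witt_ring (Zp2 p) (Zp2_top p) Quot J_ideal p"

text \<open>
  All members of a coset \<open>C\<close> of \<open>J\<close> have the same component at a cyclic \<open>T\<close>; this identifies \<open>C\<close>
  with a family indexed by the tree.
\<close>

definition coord :: "(vertex \<Rightarrow> 'k::field) set \<Rightarrow> vertex \<Rightarrow> 'k" where
  "coord C T = the_elem ((\<lambda>a. a T) ` C)"

definition IV_norm :: "nat \<Rightarrow> (vertex \<Rightarrow> 'k::field) set \<Rightarrow> real" where
  "IV_norm p C =
     (if C = \<zero>\<^bsub>R_ring p\<^esub> then 0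
      else 1 / real p ^ (LEAST n. \<exists>T\<in>cyc_tree p. gset_size (Zp2 p) T = p ^ n \<and> coord C T \<noteq> 0))"

definition Phi ::
  "nat \<Rightarrow> (vertex \<Rightarrow> 'k::field) set \<Rightarrow> (nat \<Rightarrow> vertex) \<Rightarrow> padic set set \<Rightarrow> 'k" where
  "Phi p C = (\<lambda>x\<in>P1 p. W_vec p (\<lambda>n. coord C (x n)))"

end

theory Submission
  imports
    Defs
    "HOL-Algebra.Multiplicative_Group"
    "HOL-Number_Theory.Cong"
begin

text \<open>
  Let \<open>x = (T\<^sub>0, T\<^sub>1, \<dots>)\<close> be a path from the root and \<open>T\<^sub>n = G/H\<^sub>n\<close>, where \<open>G\<close> is the square of the group
  of p-adic integers. The quotient by \<open>H\<^sub>n\<close> is cyclic of order \<open>p^n\<close>, so \<open>H\<^sub>0, \<dots>, H\<^sub>n\<close> are all the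
  open subgroups that contain \<open>H\<^sub>n\<close>. Hence the Witt polynomial of \<open>T\<^sub>n\<close> is the \<open>n\<close>-th p-typical Witt
  polynomial with renamed variables (\<open>witt_poly_path\<close>, \<open>witt_poly_W_index\<close>). Sums and products of
  Witt vectors are determined by the Witt polynomials, so reading off the components along \<open>x\<close> is
  a ring homomorphism to the p-typical Witt vectors (\<open>W_vec_path_add\<close>, \<open>W_vec_path_mult\<close>).
  Doing this for all paths at once gives the ring homomorphism \<open>path_map\<close>.

  The open subgroups with cyclic quotient are the reductions of the lines \<open>a x + b y = 0\<close>
  (\<open>ex_line_eq\<close>). Such a line has a reduction modulo every power of \<open>p\<close>, so every vertex of the tree
  lies on a path, and the kernel of \<open>path_map\<close> is \<open>J\<close>. In the p-typical Witt vectors a sum depends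
  in each degree only on the components up to that degree; therefore \<open>v - w\<close> has norm at most
  \<open>p^-m\<close> exactly if \<open>v\<close> and \<open>w\<close> have the same first \<open>m\<close> components (\<open>W_norm_diff_le_iff\<close>). Two
  distinct paths with \<open>n\<close> common edges share the vertices of the levels \<open>0, \<dots>, n\<close>, so the Lipschitz
  condition with constant \<open>1/p\<close> says that the \<open>n\<close>-th component of \<open>f x\<close> depends on the vertex \<open>x n\<close>
  alone (\<open>carrier_Lip\<close>). This is surjectivity, and the first isomorphism theorem gives the
  isomorphism (\<open>Phi_ring_iso\<close>). The supremum of the norms is attained on a path through a vertex
  of least size with a nonzero component (\<open>sup_norm_Phi\<close>).

  All this rests on the existence of the integral polynomials \<open>S\<close> and \<open>M\<close>. It is proved for every
  abelian pro-p-group by a criterion in the style of Dwork: a family \<open>y\<close> of integer polynomials,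
  indexed by the open subgroups, consists of the values of the Witt polynomials at some family if
  and only if, for every open \<open>H\<close>, the sum of \<open>\<psi>\<^sub>C (y\<^bsub>\<langle>C\<rangle>\<^esub>)\<close> over the cosets \<open>C\<close> of \<open>H\<close> is
  divisible by the index of \<open>H\<close>. Here \<open>\<langle>C\<rangle>\<close> is the subgroup generated by \<open>C\<close>, and \<open>\<psi>\<^sub>C\<close> raises
  every variable to the power of the order of \<open>C\<close> (\<open>burnside_congruent_ghost\<close>,
  \<open>burnside_congruent_imp_ghost\<close>). Every summand of a Witt polynomial satisfies the criterion
  (\<open>burnside_sum_ghost_term\<close>), and a product of two summands is an integral multiple of a third
  (\<open>ghost_term_mult\<close>), so sums, differences and products of values of Witt polynomials satisfy it
  as well. Identities over a ring \<open>A\<close> are then proved by lifting the components to variables of an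
  integer polynomial ring, where the Witt polynomials determine the components (\<open>witt_identity\<close>).
\<close>

section \<open>Integer polynomials\<close>

definition mono_eval :: "('v \<Rightarrow>\<^sub>0 nat) \<Rightarrow> ('v \<Rightarrow> 'a) \<Rightarrow> 'a::comm_ring_1" where
  "mono_eval m c = (\<Prod>v\<in>Poly_Mapping.keys m. c v ^ Poly_Mapping.lookup m v)"

lemma mpoly_eval_mono:
  "mpoly_eval P c = (\<Sum>m\<in>Poly_Mapping.keys P. of_int (Poly_Mapping.lookup P m) * mono_eval m c)"
  by (simp add: mpoly_eval_def mono_eval_def)

lemma mono_eval_superset:
  assumes "finite S" "Poly_Mapping.keys m \<subseteq> S"
  shows "mono_eval m c = (\<Prod>v\<in>S. c v ^ Poly_Mapping.lookup m v)"
  unfolding mono_eval_def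
  by (intro prod.mono_neutral_left) (use assms in \<open>auto simp: in_keys_iff\<close>)

lemma mono_eval_add: "mono_eval (m + n) c = mono_eval m c * mono_eval n c"
proof -
  let ?S = "Poly_Mapping.keys m \<union> Poly_Mapping.keys n"
  have "mono_eval (m + n) c = (\<Prod>v\<in>?S. c v ^ Poly_Mapping.lookup (m + n) v)"
    by (rule mono_eval_superset) (simp_all add: Poly_Mapping.keys_add)
  also have "\<dots> = (\<Prod>v\<in>?S. c v ^ Poly_Mapping.lookup m v) * (\<Prod>v\<in>?S. c v ^ Poly_Mapping.lookup n v)"
    by (simp add: lookup_add power_add prod.distrib)
  also have "\<dots> = mono_eval m c * mono_eval n c"
    by (simp add: mono_eval_superset[of ?S])
  finally show ?thesis .
qed

lemma mpoly_eval_single [simp]: "mpoly_eval (Poly_Mapping.single m a) c = of_int a * mono_eval m c"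
  by (cases "a = 0") (auto simp: mpoly_eval_mono)

lemma mpoly_eval_add: "mpoly_eval (P + Q) c = mpoly_eval P c + mpoly_eval Q c"
  unfolding mpoly_eval_mono
  by (rule setsum_keys_plus_distrib[where f = "\<lambda>m a. of_int a * mono_eval m c"])
     (simp_all add: distrib_right)

lemma mpoly_eval_0 [simp]: "mpoly_eval 0 c = 0"
  by (simp add: mpoly_eval_def)

lemma mpoly_eval_minus: "mpoly_eval (- P) c = - mpoly_eval P c"
  using mpoly_eval_add[of P "- P" c] by (simp add: eq_neg_iff_add_eq_0 add.commute)

lemma mpoly_eval_diff: "mpoly_eval (P - Q) c = mpoly_eval P c - mpoly_eval Q c"
  using mpoly_eval_add[of P "- Q" c] by (simp add: mpoly_eval_minus)

lemma int_mpoly_induct [case_names zero monomial diff]: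
  assumes "R 0" "\<And>m. R (Poly_Mapping.single m 1)" "\<And>P Q. R P \<Longrightarrow> R Q \<Longrightarrow> R (P - Q)"
  shows "R (P :: 'v int_mpoly)"
  by (rule frag_induction[where S = UNIV]) (use assms in \<open>auto\<close>)

lemma mpoly_eval_mult: "mpoly_eval (P * Q) c = mpoly_eval P c * mpoly_eval Q c"
proof (induction P rule: int_mpoly_induct)
  case (monomial m)
  show ?case
  proof (induction Q rule: int_mpoly_induct)
    case (monomial n)
    show ?case by (simp add: mult_single mono_eval_add)
  qed (simp_all add: right_diff_distrib mpoly_eval_diff)
qed (simp_all add: left_diff_distrib mpoly_eval_diff)

lemma mpoly_eval_1 [simp]: "mpoly_eval 1 c = 1"
  by (simp add: mpoly_eval_mono mono_eval_def)

lemma mpoly_eval_of_nat [simp]: "mpoly_eval (of_nat n) c = of_nat n"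
  by (induction n) (simp_all add: mpoly_eval_add)

lemma mpoly_eval_of_int [simp]: "mpoly_eval (of_int n) c = of_int n"
  by (cases n) (simp_all add: mpoly_eval_minus mpoly_eval_diff)

lemma mpoly_eval_power: "mpoly_eval (P ^ n) c = mpoly_eval P c ^ n"
  by (induction n) (simp_all add: mpoly_eval_mult)

lemma mpoly_eval_sum: "mpoly_eval (sum P S) c = (\<Sum>i\<in>S. mpoly_eval (P i) c)"
  by (induction S rule: infinite_finite_induct) (simp_all add: mpoly_eval_add)

lemma mpoly_eval_prod: "mpoly_eval (prod P S) c = (\<Prod>i\<in>S. mpoly_eval (P i) c)"
  by (induction S rule: infinite_finite_induct) (simp_all add: mpoly_eval_mult)

lemma mpoly_eval_var [simp]: "mpoly_eval (mpoly_var v) c = c v"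
  by (simp add: mpoly_var_def mono_eval_def)

lemmas mpoly_eval_hom = mpoly_eval_add mpoly_eval_minus mpoly_eval_diff mpoly_eval_mult
  mpoly_eval_power mpoly_eval_sum mpoly_eval_prod

lemma mpoly_eval_eval:
  "mpoly_eval (mpoly_eval P c) d = mpoly_eval P (\<lambda>v. mpoly_eval (c v) d)"
  unfolding mpoly_eval_def[of P] by (simp add: mpoly_eval_hom)

lemma mono_eval_power_eq:
  "mono_eval m (\<lambda>v. mpoly_var v ^ q) = (mono_eval m mpoly_var) ^ q"
  by (simp add: mono_eval_def prod_power_distrib power_mult mult.commute flip: power_mult)

lemma mono_eval_var: "mono_eval m mpoly_var = Poly_Mapping.single m 1"
proof (induction m rule: update_induct)
  case const
  show ?case by (simp add: mono_eval_def)
next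
  case (update m v e)
  have var: "mpoly_var v ^ e = Poly_Mapping.single (Poly_Mapping.single v e) 1" for e
  proof (induction e)
    case (Suc e)
    then show ?case by (simp add: mpoly_var_def mult_single flip: single_add)
  qed simp
  have up: "Poly_Mapping.update v e m = Poly_Mapping.single v e + m"
    using update(1) by (intro poly_mapping_eqI) (auto simp: lookup_update lookup_add lookup_single in_keys_iff when_def)
  have "mono_eval (Poly_Mapping.single v e) mpoly_var = mpoly_var v ^ e"
    using update(2) by (simp add: mono_eval_def)
  then show ?case
    by (simp add: up mono_eval_add var update(3) mult_single)
qed

lemma mpoly_eval_vars [simp]: "mpoly_eval P mpoly_var = P"
proof (induction P rule: int_mpoly_induct)
  case (monomial m)
  then show ?case by (simp add: mono_eval_var)
qed (simp_all add: mpoly_eval_diff)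

lemma int_mpoly_torsion_free:
  fixes P Q :: "'v int_mpoly"
  assumes "n > 0" "of_nat n * P = of_nat n * Q"
  shows "P = Q"
proof -
  have lk: "Poly_Mapping.lookup (of_nat n * P) m = int n * Poly_Mapping.lookup P m" for P :: "'v int_mpoly" and m n
    by (induction n) (simp_all add: lookup_add distrib_right)
  show ?thesis
    using assms by (intro poly_mapping_eqI) (metis lk mult_cancel_left of_nat_0_less_iff less_irrefl)
qed

lemma prime_dvd_binomial_power:
  fixes a b :: "'a::comm_ring_1"
  assumes "prime p"
  shows "of_nat p dvd (a + b) ^ p - (a ^ p + b ^ p)"
proof -
  have p: "p > 1" using assms by (rule prime_gt_1_nat)
  have split: "{..p} = insert 0 (insert p {0<..<p})" using p by auto
  have "(a + b) ^ p = a ^ p + b ^ p + (\<Sum>k\<in>{0<..<p}. of_nat (p choose k) * a ^ k * b ^ (p - k))"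
    using p by (simp add: binomial_ring split add_ac)
  moreover have "of_nat p dvd (\<Sum>k\<in>{0<..<p}. of_nat (p choose k) * a ^ k * b ^ (p - k))"
  proof (intro dvd_sum dvd_mult2)
    fix k assume "k \<in> {0<..<p}"
    then have "p dvd (p choose k)" using assms by (intro dvd_choose_prime) auto
    then show "(of_nat p :: 'a) dvd of_nat (p choose k)" by (auto elim!: dvdE)
  qed
  ultimately show ?thesis by simp
qed

text \<open>
  A congruence modulo a positive power of \<open>p\<close> improves by a factor \<open>p\<close> when both sides are raised to the
  power \<open>p\<close>: the cofactor of \<open>a - b\<close> in \<open>a ^ p - b ^ p\<close> is congruent to \<open>p * b ^ (p - 1)\<close>.
\<close>

lemma dvd_power_prime_step:
  fixes a b :: "'a::comm_ring_1"
  assumes "of_nat (p ^ Suc m) dvd a - b"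
  shows "of_nat (p ^ Suc (Suc m)) dvd a ^ p - b ^ p"
proof -
  obtain d where d: "a - b = of_nat (p ^ Suc m) * d" using assms by (elim dvdE)
  have ap: "a ^ p - b ^ p = (a - b) * (\<Sum>i<p. a ^ i * b ^ (p - Suc i))"
    by (simp add: power_diff_sumr2 mult.commute)
  have "of_nat p dvd (\<Sum>i<p. a ^ i * b ^ (p - Suc i))"
  proof -
    have "of_nat p dvd (\<Sum>i<p. a ^ i * b ^ (p - Suc i)) - (\<Sum>i<p. b ^ i * b ^ (p - Suc i))"
      unfolding sum_subtractf[symmetric] left_diff_distrib[symmetric]
    proof (intro dvd_sum dvd_mult2)
      fix i
      have "of_nat p dvd a - b" using d by (simp add: mult.assoc)
      moreover have "a - b dvd a ^ i - b ^ i" by (simp add: power_diff_sumr2)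
      ultimately show "of_nat p dvd a ^ i - b ^ i" by (rule dvd_trans)
    qed
    moreover have "(\<Sum>i<p. b ^ i * b ^ (p - Suc i)) = of_nat p * b ^ (p - 1)"
      by (simp flip: power_add)
    ultimately show ?thesis by (metis dvd_diff_commute dvd_triv_left diff_add_cancel dvd_add)
  qed
  then obtain e where "(\<Sum>i<p. a ^ i * b ^ (p - Suc i)) = of_nat p * e" by (elim dvdE)
  then show ?thesis unfolding ap d by (simp add: mult_ac)
qed

lemma dvd_power_prime_power:
  fixes a b :: "'a::comm_ring_1"
  assumes "of_nat p dvd a - b"
  shows "of_nat (p ^ Suc m) dvd a ^ (p ^ m) - b ^ (p ^ m)"
proof (induction m)
  case 0
  then show ?case using assms by simp
next
  case (Suc m)
  from dvd_power_prime_step[OF this] show ?case by (simp add: power_mult[symmetric] mult.commute)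
qed

text \<open>
  For prime \<open>q\<close> this endomorphism lifts the Frobenius. Indexing it by \<open>q\<close>, rather than iterating the
  map of the prime \<open>p\<close>, allows the order of a group element in place of \<open>q\<close>.
\<close>

definition frob :: "nat \<Rightarrow> 'v int_mpoly \<Rightarrow> 'v int_mpoly" where
  "frob q P = mpoly_eval P (\<lambda>v. mpoly_var v ^ q)"

lemma frob_hom:
  "frob q (P + Q) = frob q P + frob q Q" "frob q (P - Q) = frob q P - frob q Q"
  "frob q (P * Q) = frob q P * frob q Q" "frob q (P ^ n) = frob q P ^ n"
  "frob q (of_nat n) = of_nat n" "frob q 0 = 0" "frob q (sum R S) = (\<Sum>i\<in>S. frob q (R i))"
  by (simp_all add: frob_def mpoly_eval_hom)

lemma frob_1 [simp]: "frob (Suc 0) P = P"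
  by (simp add: frob_def)

lemma frob_frob: "frob q (frob r P) = frob (q * r) P"
  by (simp add: frob_def mpoly_eval_eval mpoly_eval_power power_mult)

text \<open>
  Both sides are additive modulo \<open>p\<close>, and they coincide on monomials.
\<close>

lemma frob_congruent_power:
  assumes "prime p"
  shows "of_nat p dvd frob p P - P ^ p"
proof (induction P rule: int_mpoly_induct)
  case zero
  then show ?case using prime_gt_0_nat[OF assms] by (simp add: frob_hom power_0_left)
next
  case (monomial m)
  show ?case by (simp add: frob_def mono_eval_power_eq mono_eval_var)
next
  case (diff P Q)
  have "of_nat p dvd (P - Q + Q) ^ p - ((P - Q) ^ p + Q ^ p)"
    by (rule prime_dvd_binomial_power[OF assms])
  then have *: "of_nat p dvd P ^ p - (P - Q) ^ p - Q ^ p" by (simp add: algebra_simps)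
  from dvd_add[OF dvd_diff[OF diff] *]
  have "of_nat p dvd (frob p P - P ^ p) - (frob p Q - Q ^ p) + (P ^ p - (P - Q) ^ p - Q ^ p)" .
  then show ?case by (simp add: frob_hom algebra_simps)
qed


section \<open>A congruence for finite abelian p-groups\<close>

lemma (in comm_group) subgroup_torsion: "subgroup {g \<in> carrier G. g [^] (n::nat) = \<one>} G"
  by (rule subgroupI) (auto simp: nat_pow_distrib nat_pow_inv intro: exI[of _ \<one>])

text \<open>
  The elements of order at most \<open>p ^ i\<close> form a subgroup. As soon as some element has a larger order,
  this subgroup contains a cyclic group of order \<open>p ^ i\<close>, so its order is divisible by \<open>p ^ i\<close>; the
  order of the whole group is so too.
\<close>

lemma (in comm_group) prime_power_dvd_card_high_order:
  assumes "prime p" "order G = p ^ n"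
  shows "p ^ i dvd card {g \<in> carrier G. p ^ Suc i dvd ord g}"
proof (cases "\<exists>h\<in>carrier G. p ^ Suc i dvd ord h")
  case False
  then show ?thesis by (metis (no_types, lifting) Collect_empty_eq card.empty dvd_0_right)
next
  case True
  then obtain h where h: "h \<in> carrier G" "p ^ Suc i dvd ord h" by blast
  have p: "p > 0" using assms by (simp add: prime_gt_0_nat)
  have "order G > 0" using assms p by simp
  then have fin: "finite (carrier G)" by (simp add: order_gt_0_iff_finite)
  have ord_pow_p: "\<exists>j. ord g = p ^ j" if "g \<in> carrier G" for g
    using ord_dvd_group_order[OF that] assms by (auto simp: divides_primepow_nat)
  let ?T = "{g \<in> carrier G. g [^] (p ^ i) = \<one>}"
  have T: "subgroup ?T G" by (rule subgroup_torsion)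
  have hi: "p ^ Suc i dvd ord g \<longleftrightarrow> g [^] (p ^ i) \<noteq> \<one>" if "g \<in> carrier G" for g
  proof -
    obtain j where "ord g = p ^ j" using ord_pow_p \<open>g \<in> carrier G\<close> by blast
    moreover have "p > 1" using assms(1) by (rule prime_gt_1_nat)
    ultimately show ?thesis
      using that by (simp add: pow_eq_id dvd_power_iff_le Suc_le_eq not_le del: power_Suc)
  qed
  \<comment> \<open>a power of \<open>h\<close> of order exactly \<open>p ^ i\<close>\<close>
  define k where "k = h [^] (ord h div p ^ i)"
  have "p ^ i dvd ord h" using h(2) by (metis dvd_mult_right power_Suc)
  moreover have "ord h \<noteq> 0" using ord_dvd_group_order[OF h(1)] assms p by (metis dvd_0_left_iff power_not_zero less_irrefl)
  ultimately have "ord k = p ^ i" "k \<in> carrier G"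
    unfolding k_def using h(1) p by (auto simp: ord_pow[OF h(1)] elim!: dvdE)
  then have "generate G {k} \<subseteq> ?T" "card (generate G {k}) = p ^ i"
    using generate_subgroup_incl[of "{k}" ?T] T by (auto simp: generate_pow_card pow_eq_id)
  moreover have "card (generate G {k}) dvd card ?T"
  proof -
    interpret T: group "G\<lparr>carrier := ?T\<rparr>" using T by (rule subgroup_imp_group)
    have gT: "subgroup (generate G {k}) (G\<lparr>carrier := ?T\<rparr>)"
      using \<open>generate G {k} \<subseteq> ?T\<close> \<open>k \<in> carrier G\<close> T
      by (intro subgroup_incl generate_is_subgroup) auto
    have "card ?T = card (rcosets\<^bsub>G\<lparr>carrier := ?T\<rparr>\<^esub> generate G {k}) * card (generate G {k})"
      using T.lagrange[OF gT] by (simp add: order_def)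
    then show ?thesis by (rule dvdI[OF trans[OF _ mult.commute]])
  qed
  ultimately have T_dvd: "p ^ i dvd card ?T" by simp
  have "ord h dvd order G" by (rule ord_dvd_group_order[OF h(1)])
  then have "p ^ i dvd order G" using \<open>p ^ i dvd ord h\<close> by (rule dvd_trans[rotated])
  moreover have "{g \<in> carrier G. p ^ Suc i dvd ord g} = carrier G - ?T" using hi by auto
  then have "card {g \<in> carrier G. p ^ Suc i dvd ord g} = order G - card ?T"
    using fin by (simp add: card_Diff_subset order_def)
  ultimately show ?thesis using T_dvd by simp
qed

text \<open>
  For an integer \<open>c\<close> the summand of \<open>g\<close> counts the colourings of \<open>G\<close> with \<open>c\<close> colours that are fixed by
  \<open>g\<close>, and the claim is the orbit-counting theorem. In general the summand depends only on the order
  \<open>p ^ i\<close> of \<open>g\<close>. Summation by parts over \<open>i\<close> splits the sum into products of an increment, divisible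
  by \<open>p ^ (n - i)\<close> because \<open>frob\<close> lifts the Frobenius, and a number of elements of large order,
  divisible by \<open>p ^ i\<close>.
\<close>

lemma (in comm_group) frob_sum_congruence:
  fixes c :: "'v int_mpoly"
  assumes p: "prime p" and n: "order G = p ^ n"
  shows "of_nat (p ^ n) dvd (\<Sum>g\<in>carrier G. frob (ord g) c ^ (p ^ n div ord g))"
proof -
  have p1: "p > 1" using p by (rule prime_gt_1_nat)
  have "order G > 0" using n p1 by simp
  then have fin: "finite (carrier G)" by (simp add: order_gt_0_iff_finite)
  \<comment> \<open>the summand of an element of order \<open>p ^ i\<close>\<close>
  define u where "u i = frob (p ^ i) c ^ (p ^ (n - i))" for i
  have ord_pow_p: "\<exists>j\<le>n. ord g = p ^ j" if "g \<in> carrier G" for g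
    using ord_dvd_group_order[OF that] n p by (simp add: divides_primepow_nat)
  have step: "of_nat (p ^ (n - i)) dvd u (Suc i) - u i" if "i < n" for i
  proof -
    have "of_nat p dvd frob p (frob (p ^ i) c) - frob (p ^ i) c ^ p"
      by (rule frob_congruent_power[OF p])
    from dvd_power_prime_power[OF this, of "n - Suc i"] that
    show ?thesis by (simp add: u_def frob_frob Suc_diff_Suc flip: power_mult power_Suc)
  qed
  have summand: "frob (ord g) c ^ (p ^ n div ord g)
      = u 0 + (\<Sum>i<n. if p ^ Suc i dvd ord g then u (Suc i) - u i else 0)" if g: "g \<in> carrier G" for g
  proof -
    obtain j where j: "j \<le> n" "ord g = p ^ j" using ord_pow_p[OF g] by blast
    have "(\<Sum>i<n. if p ^ Suc i dvd ord g then u (Suc i) - u i else 0) = (\<Sum>i<n. if i < j then u (Suc i) - u i else 0)"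
      using p1 by (intro sum.cong) (auto simp: j(2) dvd_power_iff_le Suc_le_eq simp del: power_Suc)
    also have "\<dots> = (\<Sum>i<j. u (Suc i) - u i)"
      using j(1) by (intro sum.mono_neutral_cong_right) auto
    also have "\<dots> = u j - u 0" by (rule sum_lessThan_telescope)
    finally show ?thesis using j p1 by (simp add: u_def power_diff)
  qed
  have "(\<Sum>g\<in>carrier G. frob (ord g) c ^ (p ^ n div ord g))
      = of_nat (p ^ n) * u 0 + (\<Sum>i<n. \<Sum>g\<in>carrier G. if p ^ Suc i dvd ord g then u (Suc i) - u i else 0)"
    using n by (simp add: summand sum.distrib order_def sum.swap[of _ "carrier G"])
  also have "(\<Sum>i<n. \<Sum>g\<in>carrier G. if p ^ Suc i dvd ord g then u (Suc i) - u i else 0)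
      = (\<Sum>i<n. of_nat (card {g \<in> carrier G. p ^ Suc i dvd ord g}) * (u (Suc i) - u i))"
    using fin by (simp add: sum.If_cases Int_def del: power_Suc)
  also have "of_nat (p ^ n) dvd of_nat (p ^ n) * u 0 + \<dots>"
  proof (intro dvd_add dvd_sum)
    fix i assume "i \<in> {..<n}"
    then have pn: "p ^ n = p ^ i * p ^ (n - i)" by (simp flip: power_add)
    obtain e where "card {g \<in> carrier G. p ^ Suc i dvd ord g} = p ^ i * e"
      using prime_power_dvd_card_high_order[OF p n, of i] by (elim dvdE)
    then have "(of_nat (p ^ i) :: 'v int_mpoly) dvd of_nat (card {g \<in> carrier G. p ^ Suc i dvd ord g})"
      by (simp del: power_Suc)
    then show "of_nat (p ^ n) dvd of_nat (card {g \<in> carrier G. p ^ Suc i dvd ord g}) * (u (Suc i) - u i)"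
      unfolding pn of_nat_mult using step \<open>i \<in> {..<n}\<close> by (intro mult_dvd_mono) auto
  qed simp
  finally show ?thesis .
qed

lemma (in comm_group) frob_sum_congruence_subgroup:
  fixes c :: "'v int_mpoly"
  assumes p: "prime p" and P: "subgroup P G" "card P = p ^ n"
  shows "of_nat (p ^ n) dvd (\<Sum>g\<in>P. frob (ord g) c ^ (p ^ n div ord g))"
proof -
  interpret P: comm_group "G\<lparr>carrier := P\<rparr>" 
    using P(1) subgroup.subset[OF P(1)]
    by (intro group.group_comm_groupI) (auto simp: subgroup_imp_group m_comm subset_iff)
  have "P.ord g = ord g" for g
    by (simp add: P.ord_def ord_def flip: nat_pow_consistent)
  then show ?thesis
    using P.frob_sum_congruence[OF p, of n c] P(2) by (simp add: order_def)
qed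


section \<open>Indices of subgroups\<close>

lemma card_image_eq_kernel:
  assumes "\<And>x y. x \<in> A \<Longrightarrow> y \<in> A \<Longrightarrow> f x = f y \<longleftrightarrow> g x = g y"
  shows "card (f ` A) = card (g ` A)"
proof -
  have "bij_betw (\<lambda>z. g (inv_into A f z)) (f ` A) (g ` A)"
    unfolding bij_betw_def inj_on_def using assms
    by (auto simp: image_def) (metis f_inv_into_f image_eqI inv_into_into)+
  then show ?thesis by (rule bij_betw_same_card)
qed

lemma (in group) rcoset_eq_iff:
  assumes "subgroup H G" "x \<in> carrier G" "y \<in> carrier G"
  shows "H #> x = H #> y \<longleftrightarrow> x \<otimes> inv y \<in> H"
proof
  assume "H #> x = H #> y"
  then have "x \<in> H #> y" using rcos_self[OF assms(2,1)] by simp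
  then show "x \<otimes> inv y \<in> H" using subgroup.rcos_module_imp[OF assms(1)] assms is_group by blast
next
  assume "x \<otimes> inv y \<in> H"
  then have "x \<in> H #> y" using subgroup.rcos_module_rev[OF assms(1)] assms is_group by blast
  then show "H #> x = H #> y" using repr_independence assms by metis
qed

lemma (in group) card_rcosets_eq_card_image:
  assumes "subgroup H G"
    and "\<And>x y. x \<in> carrier G \<Longrightarrow> y \<in> carrier G \<Longrightarrow> f x = f y \<longleftrightarrow> x \<otimes> inv y \<in> H"
  shows "card (rcosets H) = card (f ` carrier G)"
proof -
  have "rcosets H = (#>) H ` carrier G" by (auto simp: RCOSETS_def)
  then show ?thesis by (simp, intro card_image_eq_kernel) (simp add: assms rcoset_eq_iff)
qed

text \<open>
  The subgroup \<open>K/H\<close> of \<open>G/H\<close>; the description by inclusion of cosets does not require \<open>H \<subseteq> K\<close>.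
\<close>

definition coset_image :: "('g, 'm) monoid_scheme \<Rightarrow> 'g set \<Rightarrow> 'g set \<Rightarrow> 'g set set" where
  "coset_image G H K = {C \<in> rcosets\<^bsub>G\<^esub> H. C \<subseteq> K}"

context comm_group
begin

lemma group_Mod: "subgroup H G \<Longrightarrow> comm_group (G Mod H)"
  by (rule abelian_FactGroup)

lemma rcoset_subset_iff:
  assumes "subgroup H G" "subgroup K G" "H \<subseteq> K" "x \<in> carrier G"
  shows "H #> x \<subseteq> K \<longleftrightarrow> x \<in> K"
  using rcos_self[OF assms(4,1)] assms(3) subgroup.m_closed[OF assms(2)] by (auto simp: r_coset_def)

lemma coset_image_alt:
  assumes "subgroup H G" "subgroup K G" "H \<subseteq> K"
  shows "coset_image G H K = (#>) H ` K"
proof -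
  have K: "K \<subseteq> carrier G" using subgroup.subset[OF assms(2)] .
  then have "C \<in> coset_image G H K \<longleftrightarrow> (\<exists>x\<in>carrier G. C = H #> x \<and> H #> x \<subseteq> K)" for C
    by (auto simp: coset_image_def RCOSETS_def)
  then show ?thesis using K by (auto simp: rcoset_subset_iff[OF assms])
qed

lemma subgroup_coset_image:
  assumes "subgroup H G" "subgroup K G" "H \<subseteq> K"
  shows "subgroup (coset_image G H K) (G Mod H)"
proof -
  interpret N: normal H G using assms by (simp add: normal_iff_subgroup)
  interpret Q: comm_group "G Mod H" using assms(1) by (rule group_Mod)
  have K: "K \<subseteq> carrier G" using subgroup.subset[OF assms(2)] .
  show ?thesis unfolding coset_image_alt[OF assms]
  proof (rule Q.subgroupI)
    show "(#>) H ` K \<subseteq> carrier (G Mod H)" using K by (auto simp: carrier_FactGroup)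
    show "(#>) H ` K \<noteq> {}" using subgroup.one_closed[OF assms(2)] by auto
  next
    fix C assume "C \<in> (#>) H ` K"
    then obtain x where x: "x \<in> K" "C = H #> x" by auto
    have "inv\<^bsub>G Mod H\<^esub> C = H #> inv x"
      using x K by (subst N.inv_FactGroup) (auto simp: carrier_FactGroup N.rcos_inv)
    then show "inv\<^bsub>G Mod H\<^esub> C \<in> (#>) H ` K" using subgroup.m_inv_closed[OF assms(2) x(1)] by auto
  next
    fix C D assume "C \<in> (#>) H ` K" "D \<in> (#>) H ` K"
    then obtain x y where "x \<in> K" "C = H #> x" "y \<in> K" "D = H #> y" by auto
    then show "C \<otimes>\<^bsub>G Mod H\<^esub> D \<in> (#>) H ` K"
      using K subgroup.m_closed[OF assms(2)] by (auto simp: N.rcos_sum subset_iff)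
  qed
qed

text \<open>
  Lagrange's theorem in \<open>G/H\<close>: the cosets of \<open>K/H\<close> in \<open>G/H\<close> correspond to those of \<open>K\<close> in \<open>G\<close>. The
  group \<open>G\<close> itself may be infinite.
\<close>

lemma card_coset_image:
  assumes H: "subgroup H G" and K: "subgroup K G" "H \<subseteq> K" and fin: "finite (rcosets H)"
  shows "card (rcosets K) * card (coset_image G H K) = card (rcosets H)"
proof -
  interpret N: normal H G using H by (simp add: normal_iff_subgroup)
  interpret Q: comm_group "G Mod H" using H by (rule group_Mod)
  let ?P = "coset_image G H K"
  have P: "subgroup ?P (G Mod H)" using H K by (rule subgroup_coset_image)
  have carr: "carrier (G Mod H) = rcosets H" by (simp add: FactGroup_def)
  have "card (rcosets K) = card ((\<lambda>x. ?P #>\<^bsub>G Mod H\<^esub> (H #> x)) ` carrier G)"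
  proof (rule card_rcosets_eq_card_image[OF K(1)])
    fix x y assume xy: "x \<in> carrier G" "y \<in> carrier G"
    then have "(?P #>\<^bsub>G Mod H\<^esub> (H #> x) = ?P #>\<^bsub>G Mod H\<^esub> (H #> y))
        \<longleftrightarrow> (H #> x) \<otimes>\<^bsub>G Mod H\<^esub> inv\<^bsub>G Mod H\<^esub> (H #> y) \<in> ?P"
      by (intro Q.rcoset_eq_iff P) (auto simp: carrier_FactGroup)
    also have "(H #> x) \<otimes>\<^bsub>G Mod H\<^esub> inv\<^bsub>G Mod H\<^esub> (H #> y) = H #> (x \<otimes> inv y)"
      using xy by (subst N.inv_FactGroup) (auto simp: carrier_FactGroup N.rcos_inv N.rcos_sum)
    also have "\<dots> \<in> ?P \<longleftrightarrow> x \<otimes> inv y \<in> K"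
      using xy H K subgroup.subset[OF H] by (auto simp: coset_image_def rcoset_subset_iff rcosetsI)
    finally show "(?P #>\<^bsub>G Mod H\<^esub> (H #> x) = ?P #>\<^bsub>G Mod H\<^esub> (H #> y)) \<longleftrightarrow> x \<otimes> inv y \<in> K" .
  qed
  also have "(\<lambda>x. ?P #>\<^bsub>G Mod H\<^esub> (H #> x)) ` carrier G = rcosets\<^bsub>G Mod H\<^esub> ?P"
    by (auto simp: RCOSETS_def[of "G Mod H"] carrier_FactGroup)
  finally show ?thesis
    using Q.lagrange[OF P] by (simp add: order_def carr)
qed

text \<open>
  If \<open>C = H g\<close>, this is the subgroup of \<open>G\<close> generated by \<open>H\<close> and \<open>g\<close>.
\<close>

definition cyclic_hull :: "'a set \<Rightarrow> 'a set \<Rightarrow> 'a set" where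
  "cyclic_hull H C = \<Union> (generate (G Mod H) {C})"

lemma
  assumes H: "subgroup H G" and C: "C \<in> rcosets H"
  shows subgroup_cyclic_hull: "subgroup (cyclic_hull H C) G"
    and cyclic_hull_superset: "H \<subseteq> cyclic_hull H C"
    and coset_image_cyclic_hull: "coset_image G H (cyclic_hull H C) = generate (G Mod H) {C}"
    and cyclic_hull_subset_iff: "\<And>K. subgroup K G \<Longrightarrow> H \<subseteq> K \<Longrightarrow> cyclic_hull H C \<subseteq> K \<longleftrightarrow> C \<subseteq> K"
proof -
  interpret N: normal H G using H by (simp add: normal_iff_subgroup)
  interpret Q: comm_group "G Mod H" using H by (rule group_Mod)
  have carr: "carrier (G Mod H) = rcosets H" by (simp add: FactGroup_def)
  let ?A = "generate (G Mod H) {C}"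
  have A: "subgroup ?A (G Mod H)" using C by (intro Q.generate_is_subgroup) (simp add: carr)
  show sub: "subgroup (cyclic_hull H C) G"
    unfolding cyclic_hull_def using N.factgroup_subgroup_union_subgroup[OF A] .
  show sup: "H \<subseteq> cyclic_hull H C"
    unfolding cyclic_hull_def using subgroup.one_closed[OF A] by auto
  have char: "cyclic_hull H C = {x \<in> carrier G. H #> x \<in> ?A}"
    unfolding cyclic_hull_def by (rule N.factgroup_subgroup_union_char[OF A])
  show im: "coset_image G H (cyclic_hull H C) = ?A"
    unfolding coset_image_alt[OF H sub sup] unfolding char
    using subgroup.subset[OF A] by (auto simp: carrier_FactGroup)
  show "cyclic_hull H C \<subseteq> K \<longleftrightarrow> C \<subseteq> K" if K: "subgroup K G" "H \<subseteq> K" for K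
  proof
    assume "cyclic_hull H C \<subseteq> K"
    then show "C \<subseteq> K" using generate.incl[of C "{C}" "G Mod H"] by (auto simp: cyclic_hull_def)
  next
    assume "C \<subseteq> K"
    then have "?A \<subseteq> coset_image G H K"
      using C by (intro Q.generate_subgroup_incl subgroup_coset_image H K) (auto simp: coset_image_def)
    then show "cyclic_hull H C \<subseteq> K" by (auto simp: cyclic_hull_def coset_image_def)
  qed
qed

lemma index_cyclic_hull:
  assumes H: "subgroup H G" "finite (rcosets H)" and C: "C \<in> rcosets H"
  shows "card (rcosets (cyclic_hull H C)) * group.ord (G Mod H) C = card (rcosets H)"
proof -
  interpret Q: comm_group "G Mod H" using H(1) by (rule group_Mod)
  have "Q.ord C = card (generate (G Mod H) {C})"
    using C by (intro Q.generate_pow_card) (simp add: FactGroup_def)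
  then show ?thesis
    using card_coset_image[OF H(1) subgroup_cyclic_hull cyclic_hull_superset H(2)] H(1) C
    by (simp add: coset_image_cyclic_hull)
qed

end


section \<open>Ghost vectors of abelian pro-p-groups\<close>

text \<open>
  The topology enters only through its open subgroups: they are closed under passing to larger
  subgroups, and their indices are powers of \<open>p\<close>, in particular finite.
\<close>

locale abelian_pro_p_group = comm_group G for G :: "('g, 'm) monoid_scheme" (structure) +
  fixes X :: "'g topology" and p :: nat
  assumes prime_p: "prime p"
    and open_carrier: "carrier G \<in> open_subgroups G X"
    and open_superset: "\<And>H K. H \<in> open_subgroups G X \<Longrightarrow> subgroup K G \<Longrightarrow> H \<subseteq> K \<Longrightarrow> K \<in> open_subgroups G X"
    and index_prime_power: "\<And>H. H \<in> open_subgroups G X \<Longrightarrow> \<exists>n. card (rcosets H) = p ^ n"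
begin

abbreviation opens :: "'g set set" where "opens \<equiv> open_subgroups G X"

definition index :: "'g set \<Rightarrow> nat" where "index H = card (rcosets H)"

lemma opensD: "H \<in> opens \<Longrightarrow> subgroup H G"
  by (simp add: open_subgroups_def)

lemma open_Int: "H \<in> opens \<Longrightarrow> K \<in> opens \<Longrightarrow> H \<inter> K \<in> opens"
  by (auto simp: open_subgroups_def subgroups_Inter_pair openin_Int)

lemma index_power: "H \<in> opens \<Longrightarrow> \<exists>n. index H = p ^ n"
  unfolding index_def by (rule index_prime_power)

lemma index_pos: "H \<in> opens \<Longrightarrow> index H > 0"
  using index_power[of H] prime_gt_0_nat[OF prime_p] by auto

lemma finite_rcosets: "H \<in> opens \<Longrightarrow> finite (rcosets H)"
  using index_pos[of H] by (simp add: index_def card_gt_0_iff)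

lemma index_coset_image:
  "H \<in> opens \<Longrightarrow> K \<in> opens \<Longrightarrow> H \<subseteq> K \<Longrightarrow> index K * card (coset_image G H K) = index H"
  unfolding index_def by (intro card_coset_image opensD finite_rcosets)

lemma index_dvd: "H \<in> opens \<Longrightarrow> K \<in> opens \<Longrightarrow> H \<subseteq> K \<Longrightarrow> index K dvd index H"
  using index_coset_image by (metis dvd_triv_left)

lemma index_less:
  assumes "H \<in> opens" "K \<in> opens" "H \<subset> K"
  shows "index K < index H"
proof -
  obtain x where x: "x \<in> K" "x \<notin> H" using assms(3) by blast
  have H: "subgroup H G" and K: "subgroup K G" using assms by (auto dest: opensD)
  have xG: "x \<in> carrier G" using subgroup.subset[OF K] x(1) by blast
  have im: "coset_image G H K = (#>) H ` K"
    using H K assms(3) by (intro coset_image_alt) auto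
  have "H #> \<one> \<noteq> H #> x"
    using x(2) xG subgroup.m_inv_closed[OF H, of "inv x"] rcoset_eq_iff[OF H _ xG, of \<one>] by auto
  moreover have "{H #> \<one>, H #> x} \<subseteq> coset_image G H K"
    unfolding im using x(1) subgroup.one_closed[OF K] by auto
  moreover have "finite (coset_image G H K)"
    using finite_rcosets[OF assms(1)] by (simp add: coset_image_def)
  ultimately have "2 \<le> card (coset_image G H K)"
    by (metis card_2_iff card_mono)
  moreover have "index K * card (coset_image G H K) = index H"
    using assms by (intro index_coset_image) auto
  ultimately show ?thesis using index_pos[OF assms(2)]
    by (metis Suc_1 Suc_le_lessD mult.right_neutral mult_less_cancel1 less_le_trans)
qed

lemma index_eq_imp_eq:
  "H \<in> opens \<Longrightarrow> K \<in> opens \<Longrightarrow> H \<subseteq> K \<Longrightarrow> index K = index H \<Longrightarrow> H = K"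
  using index_less[of H K] by auto

text \<open>
  A subgroup above \<open>H\<close> is determined by the cosets of \<open>H\<close> that it contains.
\<close>

lemma finite_open_supersets:
  assumes "H \<in> opens"
  shows "finite {K \<in> opens. H \<subseteq> K}"
proof (rule inj_on_finite)
  show "inj_on (coset_image G H) {K \<in> opens. H \<subseteq> K}"
  proof (rule inj_onI)
    fix K L assume KL: "K \<in> {K \<in> opens. H \<subseteq> K}" "L \<in> {K \<in> opens. H \<subseteq> K}"
      and eq: "coset_image G H K = coset_image G H L"
    have "x \<in> K \<longleftrightarrow> x \<in> L" if "x \<in> carrier G" for x
    proof -
      have "H #> x \<in> rcosets H" using that subgroup.subset[OF opensD[OF assms]] by (rule rcosetsI[rotated])
      then have "H #> x \<subseteq> K \<longleftrightarrow> H #> x \<subseteq> L" using eq by (auto simp: coset_image_def)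
      then show ?thesis using KL assms that by (simp add: rcoset_subset_iff opensD)
    qed
    moreover have "K \<subseteq> carrier G" "L \<subseteq> carrier G" using KL by (auto dest!: opensD subgroup.subset)
    ultimately show "K = L" by blast
  qed
  show "coset_image G H ` {K \<in> opens. H \<subseteq> K} \<subseteq> Pow (rcosets H)" by (auto simp: coset_image_def)
  show "finite (Pow (rcosets H))" using finite_rcosets[OF assms] by simp
qed

text \<open>
  The Witt polynomial of the \<open>G\<close>-set \<open>G/H\<close>, with components indexed by subgroups in place of
  isomorphism classes of \<open>G\<close>-sets.
\<close>

definition ghost :: "('g set \<Rightarrow> 'a::comm_ring_1) \<Rightarrow> 'g set \<Rightarrow> 'a" where
  "ghost c H = (\<Sum>K | K \<in> opens \<and> H \<subseteq> K. of_nat (index K) * c K ^ (index H div index K))"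

text \<open>
  If \<open>y\<close> consists of the numbers of fixed points of the open subgroups on a finite \<open>G\<close>-set, the sum
  without \<open>frob\<close> is the one of the orbit-counting theorem for the action of \<open>G/H\<close> on the points fixed
  by \<open>H\<close>.
\<close>

definition burnside_sum :: "('g set \<Rightarrow> 'v int_mpoly) \<Rightarrow> 'g set \<Rightarrow> 'v int_mpoly" where
  "burnside_sum y H = (\<Sum>C\<in>rcosets H. frob (group.ord (G Mod H) C) (y (cyclic_hull H C)))"

definition burnside_congruent :: "('g set \<Rightarrow> 'v int_mpoly) \<Rightarrow> bool" where
  "burnside_congruent y \<longleftrightarrow> (\<forall>H\<in>opens. of_nat (index H) dvd burnside_sum y H)"

text \<open>
  The contribution of the single component \<open>c\<close> at \<open>M\<close> to the Witt polynomials.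
\<close>

definition ghost_term :: "'g set \<Rightarrow> 'a::comm_ring_1 \<Rightarrow> 'g set \<Rightarrow> 'a" where
  "ghost_term M c L = (if L \<subseteq> M then of_nat (index M) * c ^ (index L div index M) else 0)"

lemma open_cyclic_hull:
  assumes "H \<in> opens" "C \<in> rcosets H"
  shows "cyclic_hull H C \<in> opens" "H \<subseteq> cyclic_hull H C"
  using assms open_superset[OF assms(1)] by (simp_all add: subgroup_cyclic_hull cyclic_hull_superset opensD)

lemma burnside_sum_cong:
  assumes "H \<in> opens" "\<And>L. L \<in> opens \<Longrightarrow> H \<subseteq> L \<Longrightarrow> y L = z L"
  shows "burnside_sum y H = burnside_sum z H"
  unfolding burnside_sum_def using assms by (intro sum.cong) (auto simp: open_cyclic_hull)

lemma burnside_sum_add: "burnside_sum (\<lambda>L. y L + z L) H = burnside_sum y H + burnside_sum z H"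
  by (simp add: burnside_sum_def frob_hom sum.distrib)

lemma burnside_sum_diff: "burnside_sum (\<lambda>L. y L - z L) H = burnside_sum y H - burnside_sum z H"
  by (simp add: burnside_sum_def frob_hom sum_subtractf)

lemma burnside_sum_scale: "burnside_sum (\<lambda>L. of_nat n * y L) H = of_nat n * burnside_sum y H"
  by (simp add: burnside_sum_def frob_hom sum_distrib_left)

lemma burnside_sum_sum: "burnside_sum (\<lambda>L. \<Sum>i\<in>I. y i L) H = (\<Sum>i\<in>I. burnside_sum (y i) H)"
  by (simp add: burnside_sum_def frob_hom sum.swap[of _ I])

text \<open>
  Only the cosets inside \<open>M\<close> contribute, and their sum is the index of \<open>M\<close> times the sum of
  \<open>frob_sum_congruence\<close> for the group \<open>M/H\<close>.
\<close>

lemma burnside_sum_ghost_term: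
  assumes H: "H \<in> opens" and M: "M \<in> opens"
  shows "of_nat (index H) dvd burnside_sum (ghost_term M c) H"
proof (cases "H \<subseteq> M")
  case False
  then have "ghost_term M c (cyclic_hull H C) = 0" if "C \<in> rcosets H" for C
    using open_cyclic_hull(2)[OF H that] by (auto simp: ghost_term_def)
  then show ?thesis by (simp add: burnside_sum_def frob_hom)
next
  case True
  interpret Q: comm_group "G Mod H" using opensD[OF H] by (rule group_Mod)
  let ?P = "coset_image G H M"
  have tower: "index M * card ?P = index H" using H M True by (rule index_coset_image)
  moreover obtain k where "index H = p ^ k" using index_power[OF H] by blast
  ultimately obtain n where n: "card ?P = p ^ n"
    using prime_p by (metis divides_primepow_nat dvd_triv_right)
  have summand: "frob (Q.ord C) (ghost_term M c (cyclic_hull H C))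
      = (if C \<in> ?P then of_nat (index M) * frob (Q.ord C) c ^ (p ^ n div Q.ord C) else 0)"
    if C: "C \<in> rcosets H" for C
  proof -
    have sub: "cyclic_hull H C \<subseteq> M \<longleftrightarrow> C \<in> ?P"
      using C H M True by (simp add: cyclic_hull_subset_iff opensD coset_image_def)
    have "index (cyclic_hull H C) div index M = p ^ n div Q.ord C" if "C \<in> ?P"
    proof -
      have "index M dvd index (cyclic_hull H C)"
        using open_cyclic_hull[OF H C] M sub that by (intro index_dvd) auto
      then obtain t where t: "index (cyclic_hull H C) = index M * t" by (elim dvdE)
      have "index (cyclic_hull H C) * Q.ord C = index H"
        unfolding index_def using opensD[OF H] finite_rcosets[OF H] C by (rule index_cyclic_hull)
      then have "index M * (t * Q.ord C) = index M * p ^ n" using tower t n by (simp add: mult.assoc)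
      then have "t * Q.ord C = p ^ n" using index_pos[OF M] by simp
      then have "t = p ^ n div Q.ord C"
        using prime_gt_0_nat[OF prime_p] by (metis nonzero_mult_div_cancel_right mult_0_right power_not_zero less_irrefl)
      then show ?thesis using t index_pos[OF M] by simp
    qed
    then show ?thesis using sub by (simp add: ghost_term_def frob_hom)
  qed
  have "burnside_sum (ghost_term M c) H
      = of_nat (index M) * (\<Sum>C\<in>?P. frob (Q.ord C) c ^ (p ^ n div Q.ord C))"
    unfolding burnside_sum_def sum_distrib_left
    using finite_rcosets[OF H]
    by (intro sum.mono_neutral_cong_right) (auto simp: summand coset_image_def)
  moreover have "of_nat (p ^ n) dvd (\<Sum>C\<in>?P. frob (Q.ord C) c ^ (p ^ n div Q.ord C))"
    using H M True n by (intro Q.frob_sum_congruence_subgroup prime_p subgroup_coset_image opensD)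
  ultimately show ?thesis
    using tower n by (simp add: mult_dvd_mono flip: tower)
qed

lemma ghost_as_terms:
  assumes "H \<in> opens" "L \<in> opens" "H \<subseteq> L"
  shows "ghost c L = (\<Sum>M | M \<in> opens \<and> H \<subseteq> M. ghost_term M (c M) L)"
  unfolding ghost_def
  using finite_open_supersets[OF assms(1)] assms
  by (intro sum.mono_neutral_cong_left) (auto simp: ghost_term_def)

lemma burnside_congruent_ghost: "burnside_congruent (ghost c)"
  unfolding burnside_congruent_def
proof
  fix H assume H: "H \<in> opens"
  have "burnside_sum (ghost c) H
      = burnside_sum (\<lambda>L. \<Sum>M | M \<in> opens \<and> H \<subseteq> M. ghost_term M (c M) L) H"
    using H by (intro burnside_sum_cong ghost_as_terms)
  then show "of_nat (index H) dvd burnside_sum (ghost c) H"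
    using H by (auto simp: burnside_sum_sum intro!: dvd_sum burnside_sum_ghost_term)
qed

lemma burnside_congruent_add:
  "burnside_congruent y \<Longrightarrow> burnside_congruent z \<Longrightarrow> burnside_congruent (\<lambda>L. y L + z L)"
  by (simp add: burnside_congruent_def burnside_sum_add)

lemma burnside_congruent_diff:
  "burnside_congruent y \<Longrightarrow> burnside_congruent z \<Longrightarrow> burnside_congruent (\<lambda>L. y L - z L)"
  by (simp add: burnside_congruent_def burnside_sum_diff)

text \<open>
  The exponents match because indices are multiplicative in towers. The coefficient \<open>e\<close> is integral
  since the index of \<open>M \<inter> N\<close> is at most the product of the indices of \<open>M\<close> and \<open>N\<close>, and between powers
  of \<open>p\<close> an inequality is a divisibility.
\<close>

lemma ghost_term_mult:
  fixes a b :: "'a::comm_ring_1"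
  assumes M: "M \<in> opens" and N: "N \<in> opens"
  obtains e d where "\<And>L. L \<in> opens \<Longrightarrow>
    ghost_term M a L * ghost_term N b L = of_nat e * ghost_term (M \<inter> N) d L"
proof -
  let ?I = "M \<inter> N"
  have I: "?I \<in> opens" using M N by (rule open_Int)
  have dvd: "index M dvd index ?I" "index N dvd index ?I" using I M N by (auto intro: index_dvd)
  obtain i j k where pw: "index M = p ^ i" "index N = p ^ j" "index ?I = p ^ k"
    using index_power I M N by meson
  have sub: "subgroup M G" "subgroup N G" "subgroup ?I G" using M N I by (auto dest: opensD)
  have "index ?I = card ((\<lambda>x. (M #> x, N #> x)) ` carrier G)"
    unfolding index_def by (rule card_rcosets_eq_card_image) (auto simp: sub rcoset_eq_iff)
  also have "\<dots> \<le> card ((rcosets M) \<times> (rcosets N))"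
    using M N by (intro card_mono finite_cartesian_product finite_rcosets) (auto simp: RCOSETS_def)
  finally have "p ^ k \<le> p ^ (i + j)"
    using pw by (simp add: card_cartesian_product index_def power_add)
  then have "k \<le> i + j" using prime_gt_1_nat[OF prime_p] by simp
  then obtain e where e: "index M * index N = e * index ?I"
    unfolding pw by (metis le_add_diff_inverse2 power_add)
  show thesis
  proof (rule that)
    fix L assume L: "L \<in> opens"
    show "ghost_term M a L * ghost_term N b L
        = of_nat e * ghost_term ?I (a ^ (index ?I div index M) * b ^ (index ?I div index N)) L"
    proof (cases "L \<subseteq> ?I")
      case True
      then have "index ?I dvd index L" using L I by (intro index_dvd)
      then have "index ?I div index M * (index L div index ?I) = index L div index M"
        "index ?I div index N * (index L div index ?I) = index L div index N"
        using dvd by (simp_all add: dvd_div_mult)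
      moreover have "(of_nat (index M) * of_nat (index N) :: 'a) = of_nat e * of_nat (index ?I)"
        by (simp flip: of_nat_mult add: e)
      ultimately show ?thesis using True
        by (simp add: ghost_term_def power_mult_distrib mult_ac flip: power_mult)
           (simp add: mult.assoc[symmetric])
    qed (auto simp: ghost_term_def)
  qed
qed

lemma burnside_congruent_ghost_mult: "burnside_congruent (\<lambda>L. ghost a L * ghost b L)"
  unfolding burnside_congruent_def
proof
  fix H assume H: "H \<in> opens"
  let ?S = "{M. M \<in> opens \<and> H \<subseteq> M}"
  have "burnside_sum (\<lambda>L. ghost a L * ghost b L) H
      = burnside_sum (\<lambda>L. \<Sum>M\<in>?S. \<Sum>N\<in>?S. ghost_term M (a M) L * ghost_term N (b N) L) H"
    using H by (intro burnside_sum_cong) (simp_all add: ghost_as_terms[of H] sum_product)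
  also have "\<dots> = (\<Sum>M\<in>?S. \<Sum>N\<in>?S. burnside_sum (\<lambda>L. ghost_term M (a M) L * ghost_term N (b N) L) H)"
    by (simp add: burnside_sum_sum)
  also have "of_nat (index H) dvd \<dots>"
  proof (intro dvd_sum)
    fix M N assume "M \<in> ?S" "N \<in> ?S"
    then have M: "M \<in> opens" and N: "N \<in> opens" by auto
    obtain e d where ed: "\<And>L. L \<in> opens \<Longrightarrow>
        ghost_term M (a M) L * ghost_term N (b N) L = of_nat e * ghost_term (M \<inter> N) d L"
      using ghost_term_mult[OF M N] by blast
    have "burnside_sum (\<lambda>L. ghost_term M (a M) L * ghost_term N (b N) L) H
        = of_nat e * burnside_sum (ghost_term (M \<inter> N) d) H"
      unfolding burnside_sum_scale[symmetric] using H by (intro burnside_sum_cong ed)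
    then show "of_nat (index H) dvd burnside_sum (\<lambda>L. ghost_term M (a M) L * ghost_term N (b N) L) H"
      using burnside_sum_ghost_term[OF H open_Int[OF M N], of d] by (simp add: dvd_mult)
  qed
  finally show "of_nat (index H) dvd burnside_sum (\<lambda>L. ghost a L * ghost b L) H" .
qed

lemma ghost_split:
  assumes H: "H \<in> opens"
  shows "ghost c H = of_nat (index H) * c H
    + (\<Sum>K | K \<in> opens \<and> H \<subset> K. of_nat (index K) * c K ^ (index H div index K))"
proof -
  have "{K. K \<in> opens \<and> H \<subseteq> K} = insert H {K. K \<in> opens \<and> H \<subset> K}" using H by auto
  moreover have "finite {K. K \<in> opens \<and> H \<subset> K}"
    using finite_open_supersets[OF H] by (rule rev_finite_subset) auto
  ultimately show ?thesis using index_pos[OF H] by (simp add: ghost_def)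
qed

lemma ghost_cong: "(\<And>K. K \<in> opens \<Longrightarrow> H \<subseteq> K \<Longrightarrow> a K = b K) \<Longrightarrow> ghost a H = ghost b H"
  unfolding ghost_def by (intro sum.cong) auto

text \<open>
  The trivial coset is the only one whose cyclic hull is \<open>H\<close>, so all other summands of the Burnside
  sum of \<open>y - z\<close> at \<open>H\<close> vanish.
\<close>

lemma burnside_congruent_difference:
  assumes y: "burnside_congruent y" and z: "burnside_congruent z" and H: "H \<in> opens"
    and eq: "\<And>L. L \<in> opens \<Longrightarrow> H \<subset> L \<Longrightarrow> y L = z L"
  shows "of_nat (index H) dvd y H - z H"
proof -
  interpret Q: comm_group "G Mod H" using opensD[OF H] by (rule group_Mod)
  interpret HG: subgroup H G using opensD[OF H] .
  have HC: "H \<in> rcosets H" by (rule HG.subgroup_in_rcosets[OF is_group])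
  let ?f = "\<lambda>C. frob (Q.ord C) (y (cyclic_hull H C) - z (cyclic_hull H C))"
  have "?f C = 0" if C: "C \<in> rcosets H - {H}" for C
  proof -
    have "C \<subseteq> cyclic_hull H C"
      using C H cyclic_hull_subset_iff[of H C "cyclic_hull H C"]
      by (simp add: opensD subgroup_cyclic_hull cyclic_hull_superset)
    moreover have "\<not> C \<subseteq> H"
      using C HC rcos_disjoint[OF opensD[OF H]] HG.rcosets_non_empty[of C]
      by (auto simp: pairwise_def disjnt_def)
    ultimately have "H \<subset> cyclic_hull H C" using open_cyclic_hull[OF H] C by blast
    then show ?thesis using open_cyclic_hull[OF H] C eq by (simp add: frob_hom)
  qed
  then have "burnside_sum (\<lambda>L. y L - z L) H = ?f H"
    unfolding burnside_sum_def using HC finite_rcosets[OF H]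
    by (subst sum.remove[of _ H]) auto
  also have "\<dots> = y H - z H"
  proof -
    have "Q.ord H = 1" using Q.ord_id by simp
    moreover have "cyclic_hull H H = H"
      using cyclic_hull_subset_iff[OF opensD[OF H] HC opensD[OF H]] open_cyclic_hull[OF H HC] by auto
    ultimately show ?thesis by simp
  qed
  finally show ?thesis
    using burnside_congruent_diff[OF y z] H unfolding burnside_congruent_def by metis
qed

lemma wf_open_superset: "wf {(K, H). K \<in> opens \<and> H \<in> opens \<and> H \<subset> K}"
  by (rule wf_subset[OF wf_measure[of index]]) (auto intro!: index_less)

text \<open>
  The components are found by recursion along descending open subgroups. If the components above \<open>H\<close>
  are correct, the Witt polynomials of the current family and \<open>y\<close> agree above \<open>H\<close>, so they differ at
  \<open>H\<close> by a multiple of the index, which a change of the component at \<open>H\<close> absorbs.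
\<close>

theorem burnside_congruent_imp_ghost:
  fixes y :: "'g set \<Rightarrow> 'v int_mpoly"
  assumes y: "burnside_congruent y"
  shows "\<exists>c. \<forall>H\<in>opens. ghost c H = y H"
proof -
  have "\<exists>c. \<forall>H. H \<in> opens \<longrightarrow> y H = of_nat (index H) * c H
      + (\<Sum>K | K \<in> opens \<and> H \<subset> K. of_nat (index K) * c K ^ (index H div index K))"
  proof (rule dependent_wf_choice[OF wf_open_superset, where P = "\<lambda>c H r. H \<in> opens \<longrightarrow>
      y H = of_nat (index H) * r
        + (\<Sum>K | K \<in> opens \<and> H \<subset> K. of_nat (index K) * c K ^ (index H div index K))"])
    fix f g :: "'g set \<Rightarrow> 'v int_mpoly" and H r
    assume fg: "\<And>z. (z, H) \<in> {(K, H). K \<in> opens \<and> H \<in> opens \<and> H \<subset> K} \<Longrightarrow> f z = g z"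
    have "(\<Sum>K | K \<in> opens \<and> H \<subset> K. of_nat (index K) * f K ^ (index H div index K))
        = (\<Sum>K | K \<in> opens \<and> H \<subset> K. of_nat (index K) * g K ^ (index H div index K))" if "H \<in> opens"
      using that fg by (intro sum.cong) auto
    then show "(H \<in> opens \<longrightarrow> y H = of_nat (index H) * r
        + (\<Sum>K | K \<in> opens \<and> H \<subset> K. of_nat (index K) * f K ^ (index H div index K)))
      \<longleftrightarrow> (H \<in> opens \<longrightarrow> y H = of_nat (index H) * r
        + (\<Sum>K | K \<in> opens \<and> H \<subset> K. of_nat (index K) * g K ^ (index H div index K)))" by auto
  next
    fix H and f :: "'g set \<Rightarrow> 'v int_mpoly"
    assume IH: "\<And>L. (L, H) \<in> {(K, H). K \<in> opens \<and> H \<in> opens \<and> H \<subset> K} \<Longrightarrow> L \<in> opens \<longrightarrow>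
      y L = of_nat (index L) * f L
        + (\<Sum>K | K \<in> opens \<and> L \<subset> K. of_nat (index K) * f K ^ (index L div index K))"
    show "\<exists>r. H \<in> opens \<longrightarrow> y H = of_nat (index H) * r
        + (\<Sum>K | K \<in> opens \<and> H \<subset> K. of_nat (index K) * f K ^ (index H div index K))"
    proof (cases "H \<in> opens")
      case H: True
      have "y L = ghost f L" if "L \<in> opens" "H \<subset> L" for L
        using IH[of L] that H by (simp add: ghost_split)
      then have "of_nat (index H) dvd y H - ghost f H"
        using y H by (intro burnside_congruent_difference burnside_congruent_ghost)
      then obtain d where "y H - ghost f H = of_nat (index H) * d" by (elim dvdE)
      then have "y H = of_nat (index H) * (f H + d)
          + (\<Sum>K | K \<in> opens \<and> H \<subset> K. of_nat (index K) * f K ^ (index H div index K))"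
        by (simp add: ghost_split[OF H] algebra_simps)
      then show ?thesis by blast
    qed auto
  qed
  then show ?thesis by (auto simp: ghost_split)
qed

text \<open>
  The component at \<open>H\<close> enters the Witt polynomial of \<open>H\<close> linearly, and its coefficient can be cancelled
  over a torsion-free ring. Only the Witt polynomials above \<open>H\<close> are needed, which is what makes sums
  and products of Witt vectors local.
\<close>

lemma ghost_inj:
  fixes a b :: "'g set \<Rightarrow> 'v int_mpoly"
  assumes "\<And>K. K \<in> opens \<Longrightarrow> H \<subseteq> K \<Longrightarrow> ghost a K = ghost b K" and "H \<in> opens"
  shows "a H = b H"
  using wf_open_superset assms
proof (induction H rule: wf_induct_rule)
  case (less H)
  have "a K = b K" if "K \<in> opens" "H \<subset> K" for K
    using less.IH[of K] less.prems that by auto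
  then have "(\<Sum>K | K \<in> opens \<and> H \<subset> K. of_nat (index K) * a K ^ (index H div index K))
      = (\<Sum>K | K \<in> opens \<and> H \<subset> K. of_nat (index K) * b K ^ (index H div index K))"
    by (intro sum.cong) auto
  then have "of_nat (index H) * a H = of_nat (index H) * b H"
    using less.prems(1)[OF less.prems(2)] less.prems(2) by (simp add: ghost_split)
  then show ?case using index_pos[OF less.prems(2)] by (rule int_mpoly_torsion_free[rotated])
qed

end


section \<open>Witt--Burnside rings of abelian pro-p-groups\<close>

lemma mpoly_eval_witt_poly:
  "mpoly_eval (witt_poly G X T c) d = witt_poly G X T (\<lambda>U. mpoly_eval (c U) d)"
  by (simp add: witt_poly_def mpoly_eval_hom)

text \<open>
  Sum and product before restriction to the index set of the ring. As total functions they commute with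
  evaluations of polynomials without any side condition on indices.
\<close>

definition witt_add where
  "witt_add G X a b T = mpoly_eval (witt_S G X T) (case_sum a b)"

definition witt_mult where
  "witt_mult G X a b T = mpoly_eval (witt_M G X T) (case_sum a b)"

lemma mpoly_eval_case_sum:
  "mpoly_eval (mpoly_eval P (case_sum a b)) d
    = mpoly_eval P (case_sum (\<lambda>U. mpoly_eval (a U) d) (\<lambda>U. mpoly_eval (b U) d))"
  unfolding mpoly_eval_eval by (rule arg_cong[where f = "mpoly_eval P"]) (auto split: sum.split)

lemma mpoly_eval_witt_add:
  "mpoly_eval (witt_add G X a b T) d
    = witt_add G X (\<lambda>U. mpoly_eval (a U) d) (\<lambda>U. mpoly_eval (b U) d) T"
  unfolding witt_add_def by (rule mpoly_eval_case_sum)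

lemma mpoly_eval_witt_mult:
  "mpoly_eval (witt_mult G X a b T) d
    = witt_mult G X (\<lambda>U. mpoly_eval (a U) d) (\<lambda>U. mpoly_eval (b U) d) T"
  unfolding witt_mult_def by (rule mpoly_eval_case_sum)

text \<open>
  Evaluating the variable \<open>x\<^sub>a\<close> to \<open>a\<close> maps the integer polynomials with variables indexed by a ring onto
  that ring; this is the obvious section of that map, applied to each component.
\<close>

definition lift :: "('i \<Rightarrow> 'a) \<Rightarrow> 'i \<Rightarrow> 'a int_mpoly" where
  "lift a = (\<lambda>T. mpoly_var (a T))"

lemma mpoly_eval_lift: "(\<lambda>T. mpoly_eval (lift a T) (\<lambda>x. x)) = a"
  by (simp add: lift_def)

lemma witt_add_lift:
  "witt_add G X a b T = mpoly_eval (witt_add G X (lift a) (lift b) T) (\<lambda>x. x)"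
  by (simp add: mpoly_eval_witt_add mpoly_eval_lift)

lemma witt_mult_lift:
  "witt_mult G X a b T = mpoly_eval (witt_mult G X (lift a) (lift b) T) (\<lambda>x. x)"
  by (simp add: mpoly_eval_witt_mult mpoly_eval_lift)

context abelian_pro_p_group
begin

lemma l_coset_eq_r_coset: "H \<subseteq> carrier G \<Longrightarrow> x \<in> carrier G \<Longrightarrow> x <# H = H #> x"
  by (auto simp: l_coset_def r_coset_def m_comm subset_iff)

lemma lcosets_eq_rcosets: "H \<subseteq> carrier G \<Longrightarrow> lcosets H = rcosets H"
  by (auto simp: LCOSETS_def RCOSETS_def l_coset_eq_r_coset)

lemma translate_rcoset:
  assumes "H \<subseteq> carrier G" "x \<in> carrier G" "g \<in> carrier G"
  shows "g <# (H #> x) = H #> (g \<otimes> x)"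
proof -
  have "g <# (H #> x) = (H #> x) #> g" using assms by (intro l_coset_eq_r_coset r_coset_subset_G)
  then show ?thesis using assms by (simp add: coset_mult_assoc m_comm)
qed

text \<open>
  A \<open>G\<close>-map out of \<open>G/H\<close> is determined by the image of \<open>H\<close>. As \<open>G\<close> is abelian, every point of \<open>G/K\<close> has
  the stabiliser \<open>K\<close>, so the stabiliser \<open>H\<close> must be contained in \<open>K\<close>.
\<close>

lemma gmap_subset:
  assumes H: "subgroup H G" and K: "subgroup K G" and f: "f \<in> gmaps G H K"
  shows "H \<subseteq> K" "f H \<in> rcosets K" "\<And>x. x \<in> carrier G \<Longrightarrow> f (H #> x) = x <# f H"
proof -
  have sub: "H \<subseteq> carrier G" "K \<subseteq> carrier G" using H K by (auto dest: subgroup.subset)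
  have HH: "H \<in> rcosets H" using H is_group by (rule subgroup.subgroup_in_rcosets)
  show fH: "f H \<in> rcosets K" using f HH sub by (auto simp: gmaps_def lcosets_eq_rcosets)
  show eq: "f (H #> x) = x <# f H" if "x \<in> carrier G" for x
  proof -
    have "f (x <# H) = x <# f H" using f HH sub that by (auto simp: gmaps_def lcosets_eq_rcosets)
    then show ?thesis using sub that by (simp add: l_coset_eq_r_coset)
  qed
  obtain a where a: "a \<in> carrier G" "f H = K #> a" using fH by (auto simp: RCOSETS_def)
  show "H \<subseteq> K"
  proof
    fix h assume h: "h \<in> H"
    then have hG: "h \<in> carrier G" using sub by auto
    have "H #> h = H" using H h hG by (simp add: coset_join2)
    then have "K #> a = K #> (h \<otimes> a)" using eq[OF hG] a hG sub by (simp add: translate_rcoset)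
    then have "a \<otimes> inv (h \<otimes> a) \<in> K" using K a hG by (simp add: rcoset_eq_iff)
    moreover have "a \<otimes> inv (h \<otimes> a) = inv h" using a hG by (simp add: inv_mult_group flip: m_assoc)
    ultimately have "inv h \<in> K" by simp
    then show "h \<in> K" using subgroup.m_inv_closed[OF K] hG by (metis inv_inv)
  qed
qed

text \<open>
  Conversely, if \<open>H \<subseteq> K\<close>, every point of \<open>G/K\<close> is the image of \<open>H\<close> under a \<open>G\<close>-map.
\<close>

lemma bij_betw_gmaps:
  assumes H: "subgroup H G" and K: "subgroup K G" and HK: "H \<subseteq> K"
  shows "bij_betw (\<lambda>f. f H) (gmaps G H K) (rcosets K)"
proof -
  have sub: "H \<subseteq> carrier G" "K \<subseteq> carrier G" using H K by (auto dest: subgroup.subset)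
  show ?thesis
  proof (rule bij_betw_imageI)
    show "inj_on (\<lambda>f. f H) (gmaps G H K)"
    proof (rule inj_onI)
      fix f g assume f: "f \<in> gmaps G H K" and g: "g \<in> gmaps G H K" and eq: "f H = g H"
      have "f C = g C" if "C \<in> rcosets H" for C
        using that gmap_subset(3)[OF H K f] gmap_subset(3)[OF H K g] eq by (auto simp: RCOSETS_def)
      moreover have "f \<in> extensional (rcosets H)" "g \<in> extensional (rcosets H)"
        using f g sub by (auto simp: gmaps_def lcosets_eq_rcosets PiE_def)
      ultimately show "f = g" by (intro extensionalityI) auto
    qed
    show "(\<lambda>f. f H) ` gmaps G H K = rcosets K"
    proof
      show "(\<lambda>f. f H) ` gmaps G H K \<subseteq> rcosets K" using gmap_subset(2)[OF H K] by blast
      show "rcosets K \<subseteq> (\<lambda>f. f H) ` gmaps G H K"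
      proof
        fix D assume "D \<in> rcosets K"
        then obtain a where a: "a \<in> carrier G" "D = K #> a" by (auto simp: RCOSETS_def)
        \<comment> \<open>the map \<open>H x \<mapsto> K x a\<close>; the choice of \<open>x\<close> in its coset does not matter\<close>
        define f where "f = (\<lambda>C\<in>rcosets H. K #> ((SOME x. x \<in> carrier G \<and> C = H #> x) \<otimes> a))"
        have f: "f (H #> x) = K #> (x \<otimes> a)" if x: "x \<in> carrier G" for x
        proof -
          define y where "y = (SOME y. y \<in> carrier G \<and> H #> x = H #> y)"
          have y: "y \<in> carrier G \<and> H #> x = H #> y" unfolding y_def by (rule someI[of _ x]) (simp add: x)
          then have "x \<otimes> inv y \<in> H" using rcoset_eq_iff[OF H x] by blast
          then have "K #> x = K #> y" using HK K x y by (auto simp: rcoset_eq_iff)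
          then have "K #> (x \<otimes> a) = K #> (y \<otimes> a)"
            using x y a sub by (metis coset_mult_assoc)
          then show ?thesis using x sub by (simp add: f_def y_def[symmetric] rcosetsI)
        qed
        have "f \<in> gmaps G H K"
          unfolding gmaps_def lcosets_eq_rcosets[OF sub(1)] lcosets_eq_rcosets[OF sub(2)]
        proof (intro CollectI conjI ballI PiE_I)
          fix C assume "C \<in> rcosets H"
          then show "f C \<in> rcosets K" using f a sub by (auto simp: RCOSETS_def)
        next
          fix C assume "C \<notin> rcosets H"
          then show "f C = undefined" by (simp add: f_def)
        next
          fix g C assume g: "g \<in> carrier G" and "C \<in> rcosets H"
          then obtain x where x: "x \<in> carrier G" "C = H #> x" by (auto simp: RCOSETS_def)
          then show "f (g <# C) = g <# f C"
            using g a sub by (simp add: translate_rcoset f m_assoc)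
        qed
        moreover have "f H = D" using f[OF one_closed] a sub by simp
        ultimately show "D \<in> (\<lambda>f. f H) ` gmaps G H K" by blast
      qed
    qed
  qed
qed

text \<open>
  All points of \<open>G/H\<close> have the stabiliser \<open>H\<close>, so isomorphic \<open>G\<close>-sets come from the same subgroup.
\<close>

lemma gset_iso_eq: "gset_iso G X = Id_on opens"
proof (intro equalityI subrelI)
  fix H K assume "(H, K) \<in> gset_iso G X"
  then obtain f where H: "H \<in> opens" and K: "K \<in> opens" and f: "f \<in> gmaps G H K"
    and bij: "bij_betw f (lcosets H) (lcosets K)" by (auto simp: gset_iso_def)
  have sub: "subgroup H G" "subgroup K G" using H K by (auto dest: opensD)
  then have subs: "H \<subseteq> carrier G" "K \<subseteq> carrier G" by (auto dest: subgroup.subset)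
  note map = gmap_subset[OF sub f]
  have "K \<subseteq> H"
  proof
    fix k assume k: "k \<in> K"
    then have kG: "k \<in> carrier G" using subs by auto
    obtain a where a: "a \<in> carrier G" "f H = K #> a" using map(2) by (auto simp: RCOSETS_def)
    have "K #> k = K" using sub k kG by (simp add: coset_join2)
    then have "k <# f H = f H" using a kG subs by (simp add: translate_rcoset flip: coset_mult_assoc)
    then have "f (H #> k) = f (H #> \<one>)" using map(3)[OF kG] subs by simp
    then have "H #> k = H #> \<one>"
      using bij kG subs unfolding bij_betw_def inj_on_def by (metis lcosets_eq_rcosets one_closed rcosetsI)
    then show "k \<in> H" using sub kG by (simp add: rcoset_eq_iff)
  qed
  then show "(H, K) \<in> Id_on opens" using map(1) H by auto
next
  fix H K assume "(H, K) \<in> Id_on opens"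
  then have H: "H \<in> opens" "K = H" by auto
  then have sub: "subgroup H G" by (auto dest: opensD)
  then have subs: "H \<subseteq> carrier G" by (auto dest: subgroup.subset)
  have "g <# C \<in> lcosets H" if "g \<in> carrier G" "C \<in> lcosets H" for g C
    using that subs by (auto simp: lcosets_eq_rcosets RCOSETS_def translate_rcoset)
  then have "(\<lambda>C\<in>lcosets H. C) \<in> gmaps G H H" by (auto simp: gmaps_def)
  moreover have "bij_betw (\<lambda>C\<in>lcosets H. C) (lcosets H) (lcosets H)"
    by (auto simp: bij_betw_def inj_on_def)
  ultimately show "(H, K) \<in> gset_iso G X" unfolding gset_iso_def using H by blast
qed

lemma gset_class_eq: "H \<in> opens \<Longrightarrow> gset_class G X H = {H}"
  by (auto simp: gset_class_def gset_iso_eq)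

lemma gset_classes_eq: "gset_classes G X = (\<lambda>H. {H}) ` opens"
  by (auto simp: gset_classes_def quotient_def gset_iso_eq)

lemma gset_size_eq: "H \<in> opens \<Longrightarrow> gset_size G {H} = index H"
  by (simp add: gset_size_def index_def lcosets_eq_rcosets subgroup.subset opensD)

lemma gset_le_iff: "H \<in> opens \<Longrightarrow> K \<in> opens \<Longrightarrow> gset_le G {K} {H} \<longleftrightarrow> H \<subseteq> K"
proof -
  assume H: "H \<in> opens" and K: "K \<in> opens"
  have "gmaps G H K \<noteq> {}" if "H \<subseteq> K"
  proof -
    have "K \<in> rcosets K" using opensD[OF K] is_group by (rule subgroup.subgroup_in_rcosets)
    then show ?thesis using bij_betw_gmaps[OF opensD[OF H] opensD[OF K] that] by (auto simp: bij_betw_def)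
  qed
  then show ?thesis using gmap_subset(1)[OF opensD[OF H] opensD[OF K]] by (auto simp: gset_le_def)
qed

lemma gset_phi_eq: "H \<in> opens \<Longrightarrow> K \<in> opens \<Longrightarrow> H \<subseteq> K \<Longrightarrow> gset_phi G {H} {K} = index K"
  using bij_betw_same_card[OF bij_betw_gmaps[of H K]] by (simp add: gset_phi_def index_def opensD)

lemma witt_poly_eq_ghost:
  assumes H: "H \<in> opens"
  shows "witt_poly G X {H} c = ghost (\<lambda>K. c {K}) H"
proof -
  have "{U. U \<in> gset_classes G X \<and> gset_le G U {H}} = (\<lambda>K. {K}) ` {K. K \<in> opens \<and> H \<subseteq> K}"
    using H by (auto simp: gset_classes_eq gset_le_iff)
  then have "witt_poly G X {H} c = (\<Sum>U\<in>(\<lambda>K. {K}) ` {K. K \<in> opens \<and> H \<subseteq> K}.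
      of_nat (gset_phi G {H} U) * c U ^ (gset_size G {H} div gset_size G U))"
    by (simp add: witt_poly_def)
  also have "\<dots> = ghost (\<lambda>K. c {K}) H"
    unfolding ghost_def using H
    by (subst sum.reindex) (auto simp: gset_phi_eq gset_size_eq intro!: sum.cong)
  finally show ?thesis .
qed

lemma witt_poly_inj_local:
  fixes a b :: "'g set set \<Rightarrow> 'v int_mpoly"
  assumes "H \<in> opens"
    and "\<And>K. K \<in> opens \<Longrightarrow> H \<subseteq> K \<Longrightarrow> witt_poly G X {K} a = witt_poly G X {K} b"
  shows "a {H} = b {H}"
  by (rule ghost_inj[where a = "\<lambda>K. a {K}" and b = "\<lambda>K. b {K}"])
     (use assms in \<open>simp_all add: witt_poly_eq_ghost\<close>)

lemma witt_poly_inj: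
  fixes a b :: "'g set set \<Rightarrow> 'v int_mpoly"
  assumes "\<And>T. T \<in> gset_classes G X \<Longrightarrow> witt_poly G X T a = witt_poly G X T b" "T \<in> gset_classes G X"
  shows "a T = b T"
proof -
  obtain H where H: "H \<in> opens" "T = {H}" using assms(2) by (auto simp: gset_classes_eq)
  show ?thesis unfolding H(2) using H(1)
    by (rule witt_poly_inj_local) (auto intro!: assms(1) simp: gset_classes_eq)
qed

lemma ex_witt_poly_eq:
  fixes y :: "'g set \<Rightarrow> 'v int_mpoly"
  assumes "burnside_congruent y"
  shows "\<exists>c. \<forall>H\<in>opens. witt_poly G X {H} c = y H"
proof -
  obtain c where "\<forall>H\<in>opens. ghost c H = y H" using burnside_congruent_imp_ghost[OF assms] by blast
  then have "\<forall>H\<in>opens. witt_poly G X {H} (\<lambda>U. c (the_elem U)) = y H"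
    by (simp add: witt_poly_eq_ghost)
  then show ?thesis by blast
qed

text \<open>
  This justifies the descriptions by unique existence of the polynomials for sum and product: existence
  is the criterion \<open>burnside_congruent_imp_ghost\<close>, uniqueness is \<open>witt_poly_inj\<close>.
\<close>

lemma the_witt_poly_eq:
  fixes y :: "'g set set \<Rightarrow> 'v int_mpoly"
  assumes "burnside_congruent (\<lambda>H. y {H})" "T \<in> gset_classes G X"
  shows "y T = witt_poly G X T
    (THE S. S \<in> extensional (gset_classes G X) \<and> (\<forall>T\<in>gset_classes G X. y T = witt_poly G X T S))"
proof -
  obtain c where c: "\<forall>H\<in>opens. witt_poly G X {H} c = y {H}"
    using ex_witt_poly_eq[OF assms(1)] by blast
  have cong: "witt_poly G X T (restrict c (gset_classes G X)) = witt_poly G X T c" for T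
    unfolding witt_poly_def by (intro sum.cong) auto
  have y: "witt_poly G X T c = y T" if "T \<in> gset_classes G X" for T
    using c that by (auto simp: gset_classes_eq)
  have "\<exists>!S. S \<in> extensional (gset_classes G X) \<and> (\<forall>T\<in>gset_classes G X. y T = witt_poly G X T S)"
  proof (rule ex1I)
    show "restrict c (gset_classes G X) \<in> extensional (gset_classes G X) \<and>
        (\<forall>T\<in>gset_classes G X. y T = witt_poly G X T (restrict c (gset_classes G X)))"
      by (simp add: cong y)
  next
    fix S assume S: "S \<in> extensional (gset_classes G X) \<and> (\<forall>T\<in>gset_classes G X. y T = witt_poly G X T S)"
    show "S = restrict c (gset_classes G X)"
    proof (rule extensionalityI[of _ "gset_classes G X"])
      fix T assume "T \<in> gset_classes G X"
      then show "S T = restrict c (gset_classes G X) T"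
        using S by (intro witt_poly_inj[of S "restrict c (gset_classes G X)"]) (simp_all add: cong y)
    qed (use S in auto)
  qed
  from theI'[OF this] show ?thesis using assms(2) by blast
qed

lemma burnside_congruent_witt_poly: "burnside_congruent (\<lambda>H. witt_poly G X {H} c)"
  using burnside_congruent_ghost[of "\<lambda>K. c {K}"]
  by (simp add: burnside_congruent_def witt_poly_eq_ghost cong: burnside_sum_cong)

lemma witt_poly_witt_add:
  assumes "T \<in> gset_classes G X"
  shows "witt_poly G X T (witt_add G X a b) = witt_poly G X T a + witt_poly G X T b"
proof -
  let ?y = "\<lambda>T. witt_poly G X T (\<lambda>U. mpoly_var (Inl U)) + witt_poly G X T (\<lambda>U. mpoly_var (Inr U))
    :: ('g set set + 'g set set) int_mpoly"
  have "?y T = witt_poly G X T (witt_S G X)"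
    unfolding witt_S_def
    by (rule the_witt_poly_eq[where y = ?y])
       (intro burnside_congruent_add burnside_congruent_witt_poly assms)+
  from arg_cong[OF this, of "\<lambda>P. mpoly_eval P (case_sum a b)"]
  show ?thesis by (simp add: mpoly_eval_hom mpoly_eval_witt_poly witt_add_def[abs_def])
qed

lemma witt_poly_witt_mult:
  assumes "T \<in> gset_classes G X"
  shows "witt_poly G X T (witt_mult G X a b) = witt_poly G X T a * witt_poly G X T b"
proof -
  let ?y = "\<lambda>T. witt_poly G X T (\<lambda>U. mpoly_var (Inl U)) * witt_poly G X T (\<lambda>U. mpoly_var (Inr U))
    :: ('g set set + 'g set set) int_mpoly"
  have "burnside_congruent (\<lambda>H. ?y {H})"
    using burnside_congruent_ghost_mult[of "\<lambda>K. mpoly_var (Inl {K})" "\<lambda>K. mpoly_var (Inr {K})"]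
    by (simp add: burnside_congruent_def witt_poly_eq_ghost cong: burnside_sum_cong)
  then have "?y T = witt_poly G X T (witt_M G X)"
    unfolding witt_M_def using assms by (rule the_witt_poly_eq[where y = ?y])
  from arg_cong[OF this, of "\<lambda>P. mpoly_eval P (case_sum a b)"]
  show ?thesis by (simp add: mpoly_eval_hom mpoly_eval_witt_poly witt_mult_def[abs_def])
qed

lemma witt_poly_cong_local:
  "H \<in> opens \<Longrightarrow> (\<And>K. K \<in> opens \<Longrightarrow> H \<subseteq> K \<Longrightarrow> a {K} = b {K}) \<Longrightarrow> witt_poly G X {H} a = witt_poly G X {H} b"
  by (auto simp: witt_poly_eq_ghost intro: ghost_cong)

text \<open>
  The component of a sum at \<open>H\<close> depends only on the components above \<open>H\<close>. After lifting, this holds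
  because the Witt polynomials above \<open>H\<close> involve no other components. The lifts of families that agree
  somewhere agree there as well, since \<open>lift\<close> acts on each component separately.
\<close>

lemma witt_add_cong_local:
  fixes a b a' b' :: "'g set set \<Rightarrow> 'a::comm_ring_1"
  assumes H: "H \<in> opens"
    and "\<And>K. K \<in> opens \<Longrightarrow> H \<subseteq> K \<Longrightarrow> a {K} = a' {K}" "\<And>K. K \<in> opens \<Longrightarrow> H \<subseteq> K \<Longrightarrow> b {K} = b' {K}"
  shows "witt_add G X a b {H} = witt_add G X a' b' {H}"
proof -
  have "witt_add G X (lift a) (lift b) {H} = witt_add G X (lift a') (lift b') {H}"
  proof (rule witt_poly_inj_local[OF H])
    fix K assume K: "K \<in> opens" "H \<subseteq> K"
    have "witt_poly G X {K} (lift a) = witt_poly G X {K} (lift a')"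
      "witt_poly G X {K} (lift b) = witt_poly G X {K} (lift b')"
      using K assms by (auto intro!: witt_poly_cong_local simp: lift_def)
    then show "witt_poly G X {K} (witt_add G X (lift a) (lift b))
        = witt_poly G X {K} (witt_add G X (lift a') (lift b'))"
      using K by (simp add: witt_poly_witt_add gset_classes_eq)
  qed
  then show ?thesis by (simp only: witt_add_lift[of G X a] witt_add_lift[of G X a'])
qed

lemma witt_mult_cong_local:
  fixes a b a' b' :: "'g set set \<Rightarrow> 'a::comm_ring_1"
  assumes H: "H \<in> opens"
    and "\<And>K. K \<in> opens \<Longrightarrow> H \<subseteq> K \<Longrightarrow> a {K} = a' {K}" "\<And>K. K \<in> opens \<Longrightarrow> H \<subseteq> K \<Longrightarrow> b {K} = b' {K}"
  shows "witt_mult G X a b {H} = witt_mult G X a' b' {H}"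
proof -
  have "witt_mult G X (lift a) (lift b) {H} = witt_mult G X (lift a') (lift b') {H}"
  proof (rule witt_poly_inj_local[OF H])
    fix K assume K: "K \<in> opens" "H \<subseteq> K"
    have "witt_poly G X {K} (lift a) = witt_poly G X {K} (lift a')"
      "witt_poly G X {K} (lift b) = witt_poly G X {K} (lift b')"
      using K assms by (auto intro!: witt_poly_cong_local simp: lift_def)
    then show "witt_poly G X {K} (witt_mult G X (lift a) (lift b))
        = witt_poly G X {K} (witt_mult G X (lift a') (lift b'))"
      using K by (simp add: witt_poly_witt_mult gset_classes_eq)
  qed
  then show ?thesis by (simp only: witt_mult_lift[of G X a] witt_mult_lift[of G X a'])
qed

lemma witt_add_cong:
  assumes "T \<in> gset_classes G X" "\<And>U. U \<in> gset_classes G X \<Longrightarrow> a U = a' U" "\<And>U. U \<in> gset_classes G X \<Longrightarrow> b U = b' U"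
  shows "witt_add G X a b T = witt_add G X a' b' T"
  using assms by (auto simp: gset_classes_eq intro!: witt_add_cong_local)

lemma witt_mult_cong:
  assumes "T \<in> gset_classes G X" "\<And>U. U \<in> gset_classes G X \<Longrightarrow> a U = a' U" "\<And>U. U \<in> gset_classes G X \<Longrightarrow> b U = b' U"
  shows "witt_mult G X a b T = witt_mult G X a' b' T"
  using assms by (auto simp: gset_classes_eq intro!: witt_mult_cong_local)

definition witt_one :: "'g set set \<Rightarrow> 'a::comm_ring_1" where
  "witt_one T = (if T = {carrier G} then 1 else 0)"

lemma index_carrier: "index (carrier G) = 1"
proof -
  have "rcosets (carrier G) = {carrier G}"
    using one_closed by (auto simp: RCOSETS_def coset_join2[OF _ subgroup_self])
  then show ?thesis by (simp add: index_def)
qed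

lemma zero_power_index_div:
  "H \<in> opens \<Longrightarrow> K \<in> opens \<Longrightarrow> H \<subseteq> K \<Longrightarrow> (0::'a::semiring_1) ^ (index H div index K) = 0"
  using index_dvd[of H K] index_pos[of H] by (intro zero_power) (auto elim: dvdE)

lemma witt_poly_zero: "T \<in> gset_classes G X \<Longrightarrow> witt_poly G X T (\<lambda>_. 0) = 0"
  by (auto simp: gset_classes_eq witt_poly_eq_ghost ghost_def zero_power_index_div intro!: sum.neutral)

lemma witt_poly_one:
  assumes "T \<in> gset_classes G X"
  shows "witt_poly G X T witt_one = 1"
proof -
  obtain H where H: "H \<in> opens" "T = {H}" using assms by (auto simp: gset_classes_eq)
  have "H \<subseteq> carrier G" using opensD[OF H(1)] by (rule subgroup.subset)
  then have "(\<Sum>K | K \<in> opens \<and> H \<subseteq> K. of_nat (index K) * (witt_one {K} :: 'a) ^ (index H div index K))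
      = (\<Sum>K\<in>{carrier G}. of_nat (index K) * witt_one {K} ^ (index H div index K))"
    using H open_carrier finite_open_supersets[OF H(1)]
    by (intro sum.mono_neutral_right) (auto simp: witt_one_def zero_power_index_div)
  then show ?thesis using H by (simp add: witt_poly_eq_ghost ghost_def witt_one_def index_carrier)
qed

lemma mpoly_eval_witt_one: "(\<lambda>T. mpoly_eval (witt_one T) d) = witt_one"
  by (auto simp: witt_one_def)

lemmas witt_poly_ops = witt_poly_witt_add witt_poly_witt_mult witt_poly_zero witt_poly_one
lemmas mpoly_eval_ops = mpoly_eval_witt_add mpoly_eval_witt_mult mpoly_eval_witt_one mpoly_eval_lift

text \<open>
  The Witt polynomials need not determine the components over \<open>'a\<close> itself, where indices may vanish, so
  identities are verified for families of integer polynomials and then evaluated.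
\<close>

lemma witt_identity:
  fixes P Q :: "'g set set \<Rightarrow> 'a::comm_ring_1 int_mpoly"
  assumes "\<And>T. T \<in> gset_classes G X \<Longrightarrow> witt_poly G X T P = witt_poly G X T Q" "T \<in> gset_classes G X"
  shows "mpoly_eval (P T) (\<lambda>x. x) = mpoly_eval (Q T) (\<lambda>x. x)"
  using witt_poly_inj[OF assms] by simp

lemma
  fixes a b c :: "'g set set \<Rightarrow> 'a::comm_ring_1"
  assumes T: "T \<in> gset_classes G X"
  shows witt_add_assoc: "witt_add G X (witt_add G X a b) c T = witt_add G X a (witt_add G X b c) T"
    and witt_add_comm: "witt_add G X a b T = witt_add G X b a T"
    and witt_add_zero: "witt_add G X (\<lambda>_. 0) a T = a T"
    and witt_mult_assoc: "witt_mult G X (witt_mult G X a b) c T = witt_mult G X a (witt_mult G X b c) T"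
    and witt_mult_comm: "witt_mult G X a b T = witt_mult G X b a T"
    and witt_mult_one: "witt_mult G X witt_one a T = a T"
    and witt_distrib: "witt_mult G X (witt_add G X a b) c T
      = witt_add G X (witt_mult G X a c) (witt_mult G X b c) T"
proof -
  let ?A = "lift a" and ?B = "lift b" and ?C = "lift c"
  show "witt_add G X (witt_add G X a b) c T = witt_add G X a (witt_add G X b c) T"
    using witt_identity[OF _ T, of "witt_add G X (witt_add G X ?A ?B) ?C" "witt_add G X ?A (witt_add G X ?B ?C)"]
    by (simp add: witt_poly_ops mpoly_eval_ops add.assoc)
  show "witt_add G X a b T = witt_add G X b a T"
    using witt_identity[OF _ T, of "witt_add G X ?A ?B" "witt_add G X ?B ?A"]
    by (simp add: witt_poly_ops mpoly_eval_ops add.commute)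
  show "witt_add G X (\<lambda>_. 0) a T = a T"
    using witt_identity[OF _ T, of "witt_add G X (\<lambda>_. 0) ?A" ?A]
    by (simp add: witt_poly_ops mpoly_eval_ops) (simp add: lift_def)
  show "witt_mult G X (witt_mult G X a b) c T = witt_mult G X a (witt_mult G X b c) T"
    using witt_identity[OF _ T, of "witt_mult G X (witt_mult G X ?A ?B) ?C" "witt_mult G X ?A (witt_mult G X ?B ?C)"]
    by (simp add: witt_poly_ops mpoly_eval_ops mult.assoc)
  show "witt_mult G X a b T = witt_mult G X b a T"
    using witt_identity[OF _ T, of "witt_mult G X ?A ?B" "witt_mult G X ?B ?A"]
    by (simp add: witt_poly_ops mpoly_eval_ops mult.commute)
  show "witt_mult G X witt_one a T = a T"
    using witt_identity[OF _ T, of "witt_mult G X witt_one ?A" ?A]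
    by (simp add: witt_poly_ops mpoly_eval_ops) (simp add: lift_def)
  show "witt_mult G X (witt_add G X a b) c T = witt_add G X (witt_mult G X a c) (witt_mult G X b c) T"
    using witt_identity[OF _ T, of "witt_mult G X (witt_add G X ?A ?B) ?C"
      "witt_add G X (witt_mult G X ?A ?C) (witt_mult G X ?B ?C)"]
    by (simp add: witt_poly_ops mpoly_eval_ops distrib_right)
qed

text \<open>
  The negatives of the Witt polynomials of the lift of \<open>a\<close> satisfy the criterion of
  \<open>burnside_congruent_imp_ghost\<close>, hence they are the Witt polynomials of some family.
\<close>

lemma ex_witt_neg:
  fixes a :: "'g set set \<Rightarrow> 'a::comm_ring_1"
  shows "\<exists>b. \<forall>T\<in>gset_classes G X. witt_add G X b a T = 0"
proof -
  let ?A = "lift a"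
  have "burnside_congruent (\<lambda>H. witt_poly G X {H} (\<lambda>_. 0) - witt_poly G X {H} ?A)"
    by (intro burnside_congruent_diff burnside_congruent_witt_poly)
  then obtain N where "\<forall>H\<in>opens. witt_poly G X {H} N = witt_poly G X {H} (\<lambda>_. 0) - witt_poly G X {H} ?A"
    using ex_witt_poly_eq by meson
  then have N: "witt_poly G X T N = - witt_poly G X T ?A" if "T \<in> gset_classes G X" for T
    using that by (auto simp: witt_poly_zero gset_classes_eq)
  have "witt_add G X (\<lambda>U. mpoly_eval (N U) (\<lambda>x. x)) a T = 0" if T: "T \<in> gset_classes G X" for T
    using witt_identity[OF _ T, of "witt_add G X N ?A" "\<lambda>_. 0"]
    by (simp add: witt_poly_ops mpoly_eval_ops N)
  then show ?thesis by blast
qed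

lemma witt_ring_simps:
  "carrier (witt_ring G X) = gset_classes G X \<rightarrow>\<^sub>E UNIV"
  "a \<oplus>\<^bsub>witt_ring G X\<^esub> b = restrict (witt_add G X a b) (gset_classes G X)"
  "a \<otimes>\<^bsub>witt_ring G X\<^esub> b = restrict (witt_mult G X a b) (gset_classes G X)"
  "\<zero>\<^bsub>witt_ring G X\<^esub> = restrict (\<lambda>_. 0) (gset_classes G X)"
  "\<one>\<^bsub>witt_ring G X\<^esub> = restrict witt_one (gset_classes G X)"
  by (auto simp: witt_ring_def witt_add_def witt_mult_def witt_one_def gset_class_eq open_carrier restrict_def)

theorem cring_witt_ring: "cring (witt_ring G X :: ('g set set \<Rightarrow> 'a::comm_ring_1) ring)"
proof -
  let ?W = "witt_ring G X :: ('g set set \<Rightarrow> 'a) ring" and ?I = "gset_classes G X"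
  have ext: "x = y" if "x \<in> carrier ?W" "y \<in> carrier ?W" "\<And>T. T \<in> ?I \<Longrightarrow> x T = y T" for x y
    using that by (intro PiE_ext[of x ?I _ y]) (auto simp: witt_ring_simps)
  have restr: "witt_add G X (restrict a ?I) b T = witt_add G X a b T"
    "witt_add G X a (restrict b ?I) T = witt_add G X a b T"
    "witt_mult G X (restrict a ?I) b T = witt_mult G X a b T"
    "witt_mult G X a (restrict b ?I) T = witt_mult G X a b T"
    if "T \<in> ?I" for a b :: "'g set set \<Rightarrow> 'a" and T
    using that by (auto intro!: witt_add_cong witt_mult_cong)
  have closed: "restrict f ?I \<in> carrier ?W" for f by (simp add: witt_ring_simps)
  show ?thesis
  proof (rule cringI)
    show "abelian_group ?W"
    proof (rule abelian_groupI)
      fix x assume "x \<in> carrier ?W"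
      obtain b where "\<forall>T\<in>?I. witt_add G X b x T = 0" using ex_witt_neg by blast
      then have "restrict b ?I \<oplus>\<^bsub>?W\<^esub> x = \<zero>\<^bsub>?W\<^esub>" by (intro ext) (simp_all add: witt_ring_simps restr)
      then show "\<exists>y\<in>carrier ?W. y \<oplus>\<^bsub>?W\<^esub> x = \<zero>\<^bsub>?W\<^esub>" using closed by blast
    qed (auto intro!: ext simp: witt_ring_simps restr witt_add_assoc witt_add_zero intro: witt_add_comm)
    show "comm_monoid ?W"
      by (rule comm_monoidI) (auto intro!: ext simp: witt_ring_simps restr witt_mult_assoc witt_mult_one intro: witt_mult_comm)
  qed (auto intro!: ext simp: witt_ring_simps restr witt_distrib)
qed

lemma witt_ring_add_cong_local:
  assumes "H \<in> opens"
    and "\<And>K. K \<in> opens \<Longrightarrow> H \<subseteq> K \<Longrightarrow> a {K} = a' {K}" "\<And>K. K \<in> opens \<Longrightarrow> H \<subseteq> K \<Longrightarrow> b {K} = b' {K}"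
  shows "(a \<oplus>\<^bsub>witt_ring G X\<^esub> b) {H} = (a' \<oplus>\<^bsub>witt_ring G X\<^esub> b') {H}"
  using assms by (auto simp: witt_ring_simps gset_classes_eq intro!: witt_add_cong_local)

end

text \<open>
  Sums and products are determined by the Witt polynomials. Hence a map of index sets that is compatible
  with the Witt polynomials is compatible with sums and products.
\<close>

lemma witt_ring_restrict:
  fixes a b :: "'g set set \<Rightarrow> 'a::comm_ring_1"
  assumes G: "abelian_pro_p_group G X p" and G': "abelian_pro_p_group G' X' p'"
    and \<theta>: "\<And>V. V \<in> gset_classes G' X' \<Longrightarrow> \<theta> V \<in> gset_classes G X"
    and wp: "\<And>V (c :: 'g set set \<Rightarrow> 'a int_mpoly). V \<in> gset_classes G' X' \<Longrightarrow>
      witt_poly G' X' V (\<lambda>V. c (\<theta> V)) = witt_poly G X (\<theta> V) c"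
    and V: "V \<in> gset_classes G' X'"
  shows "witt_add G X a b (\<theta> V) = witt_add G' X' (\<lambda>V. a (\<theta> V)) (\<lambda>V. b (\<theta> V)) V" (is ?add)
    and "witt_mult G X a b (\<theta> V) = witt_mult G' X' (\<lambda>V. a (\<theta> V)) (\<lambda>V. b (\<theta> V)) V" (is ?mult)
proof -
  interpret G: abelian_pro_p_group G X p by (rule G)
  interpret G': abelian_pro_p_group G' X' p' by (rule G')
  let ?A = "lift a" and ?B = "lift b"
  let ?A' = "\<lambda>V. lift a (\<theta> V)" and ?B' = "\<lambda>V. lift b (\<theta> V)"
  have lifts: "mpoly_eval (lift f (\<theta> U)) (\<lambda>x. x) = f (\<theta> U)" for f :: "'g set set \<Rightarrow> 'a" and U
    by (simp add: lift_def)
  show ?add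
    using G'.witt_identity[OF _ V, of "\<lambda>V. witt_add G X ?A ?B (\<theta> V)" "witt_add G' X' ?A' ?B'"]
    by (simp add: G.witt_poly_ops G'.witt_poly_ops wp \<theta> mpoly_eval_witt_add mpoly_eval_lift lifts)
  show ?mult
    using G'.witt_identity[OF _ V, of "\<lambda>V. witt_mult G X ?A ?B (\<theta> V)" "witt_mult G' X' ?A' ?B'"]
    by (simp add: G.witt_poly_ops G'.witt_poly_ops wp \<theta> mpoly_eval_witt_mult mpoly_eval_lift lifts)
qed


section \<open>Open subgroups with cyclic quotient\<close>

text \<open>The groups at hand are given by residue maps \<open>r n\<close>; their topology is the one for which
  the fibres of the residue maps are a basis.\<close>

lemma abelian_pro_p_group_residues:
  fixes G (structure) and r :: "nat \<Rightarrow> 'a \<Rightarrow> 'r"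
  assumes "comm_group G" and p: "prime p"
    and openin: "\<And>S. openin X S \<longleftrightarrow> S \<subseteq> carrier G \<and> (\<forall>x\<in>S. \<exists>n. \<forall>y\<in>carrier G. r n y = r n x \<longrightarrow> y \<in> S)"
    and r: "\<And>n x y. x \<in> carrier G \<Longrightarrow> y \<in> carrier G \<Longrightarrow> r n x = r n y \<longleftrightarrow> r n (x \<otimes>\<^bsub>G\<^esub> inv\<^bsub>G\<^esub> y) = r n \<one>\<^bsub>G\<^esub>"
    and card: "\<And>n. card (r n ` carrier G) = p ^ e n"
  shows "abelian_pro_p_group G X p"
    and "\<And>H. H \<in> open_subgroups G X \<longleftrightarrow> subgroup H G \<and> (\<exists>n. {x \<in> carrier G. r n x = r n \<one>\<^bsub>G\<^esub>} \<subseteq> H)"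
proof -
  interpret comm_group G by fact
  let ?N = "\<lambda>n. {x \<in> carrier G. r n x = r n \<one>}"
  have N: "subgroup (?N n) G" for n
  proof (rule subgroupI)
    show inv: "inv x \<in> ?N n" if "x \<in> ?N n" for x
      using that r[of \<one> x n] by auto
    show "x \<otimes> y \<in> ?N n" if "x \<in> ?N n" "y \<in> ?N n" for x y
      using that inv[of y] r[of x "inv y" n] by auto
  qed auto
  show iff: "H \<in> open_subgroups G X \<longleftrightarrow> subgroup H G \<and> (\<exists>n. ?N n \<subseteq> H)" for H
  proof
    assume "H \<in> open_subgroups G X"
    then have H: "subgroup H G" "openin X H" by (auto simp: open_subgroups_def)
    then obtain n where "\<forall>y\<in>carrier G. r n y = r n \<one> \<longrightarrow> y \<in> H"
      using subgroup.one_closed[OF H(1)] unfolding openin by blast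
    then show "subgroup H G \<and> (\<exists>n. ?N n \<subseteq> H)" using H(1) by blast
  next
    assume "subgroup H G \<and> (\<exists>n. ?N n \<subseteq> H)"
    then obtain n where H: "subgroup H G" and n: "?N n \<subseteq> H" by blast
    have "y \<in> H" if "x \<in> H" "y \<in> carrier G" "r n y = r n x" for x y
    proof -
      have x: "x \<in> carrier G" using that(1) subgroup.subset[OF H] by auto
      then have "y \<otimes> inv x \<in> ?N n" using r[of y x n] that by simp
      then have "y \<otimes> inv x \<otimes> x \<in> H" using n that(1) subgroup.m_closed[OF H] by blast
      then show ?thesis using that(2) x by (simp add: m_assoc)
    qed
    then show "H \<in> open_subgroups G X"
      using H subgroup.subset[OF H] by (auto simp: open_subgroups_def openin)
  qed
  show "abelian_pro_p_group G X p"
  proof unfold_locales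
    show "prime p" by fact
    show "carrier G \<in> open_subgroups G X" by (auto simp: iff subgroup_self)
    show "K \<in> open_subgroups G X" if "H \<in> open_subgroups G X" "subgroup K G" "H \<subseteq> K" for H K
      using that by (auto simp: iff)
    show "\<exists>n. card (rcosets H) = p ^ n" if HX: "H \<in> open_subgroups G X" for H
    proof -
      obtain n where H: "subgroup H G" and n: "?N n \<subseteq> H" using HX by (auto simp: iff)
      have "card (rcosets (?N n)) = p ^ e n"
        unfolding card[of n, symmetric]
      proof (rule card_rcosets_eq_card_image[OF N])
        fix x y assume "x \<in> carrier G" "y \<in> carrier G"
        then show "r n x = r n y \<longleftrightarrow> x \<otimes> inv y \<in> ?N n" using r[of x y n] by simp
      qed
      moreover from this have "finite (rcosets (?N n))"
        using prime_gt_0_nat[OF p] by (metis card_ge_0_finite zero_less_power)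
      ultimately have "card (rcosets H) dvd p ^ e n"
        using card_coset_image[OF N H n] by (metis dvd_triv_left)
      then show ?thesis using p by (auto simp: divides_primepow_nat)
    qed
  qed
qed

context abelian_pro_p_group
begin

text \<open>
  The coset of \<open>g\<close> generates \<open>G/H\<close>. Keeping \<open>g\<close> in \<open>G\<close> makes it a common generator for all larger
  subgroups.
\<close>

definition cyclic_mod :: "'g \<Rightarrow> 'g set \<Rightarrow> bool" where
  "cyclic_mod g H \<longleftrightarrow> g \<in> carrier G \<and> (\<forall>x\<in>carrier G. \<exists>i::int. H #> x = H #> (g [^] i))"

lemma cyclic_group_Mod_iff:
  assumes "H \<in> opens"
  shows "cyclic_group (G Mod H) \<longleftrightarrow> (\<exists>g. cyclic_mod g H)"
proof -
  interpret N: normal H G using assms by (simp add: normal_iff_subgroup opensD)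
  interpret Q: comm_group "G Mod H" using opensD[OF assms] by (rule group_Mod)
  have "carrier (G Mod H) = range (\<lambda>n::int. (H #> g) [^]\<^bsub>G Mod H\<^esub> n)
      \<longleftrightarrow> (\<forall>x\<in>carrier G. \<exists>i::int. H #> x = H #> (g [^] i))" if "g \<in> carrier G" for g
    using that by (auto simp: carrier_FactGroup N.FactGroup_int_pow image_def)
  then show ?thesis by (auto simp: Q.cyclic_group carrier_FactGroup cyclic_mod_def)
qed

lemma cyclic_mod_mono:
  assumes "cyclic_mod g H" "H \<in> opens" "K \<in> opens" "H \<subseteq> K"
  shows "cyclic_mod g K"
  unfolding cyclic_mod_def
proof (intro conjI ballI)
  show g: "g \<in> carrier G" using assms by (simp add: cyclic_mod_def)
  fix x assume x: "x \<in> carrier G"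
  then obtain i :: int where "H #> x = H #> (g [^] i)" using assms by (auto simp: cyclic_mod_def)
  then have "x \<otimes> inv (g [^] i) \<in> H" using assms(2) g x by (simp add: rcoset_eq_iff opensD)
  then show "\<exists>i::int. K #> x = K #> (g [^] i)"
    using assms g x by (intro exI[of _ i]) (auto simp: rcoset_eq_iff opensD)
qed

lemma cyclic_mod_pow_mem_iff:
  assumes cyc: "cyclic_mod g K" and K: "K \<in> opens"
  shows "g [^] (i::int) \<in> K \<longleftrightarrow> int (index K) dvd i"
proof -
  interpret N: normal K G using K by (simp add: normal_iff_subgroup opensD)
  interpret Q: comm_group "G Mod K" using opensD[OF K] by (rule group_Mod)
  have g: "g \<in> carrier G" using cyc by (simp add: cyclic_mod_def)
  then have gQ: "K #> g \<in> carrier (G Mod K)" by (auto simp: carrier_FactGroup)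
  have "generate (G Mod K) {K #> g} = carrier (G Mod K)"
  proof
    show "generate (G Mod K) {K #> g} \<subseteq> carrier (G Mod K)" using gQ by (intro Q.generate_incl) auto
    show "carrier (G Mod K) \<subseteq> generate (G Mod K) {K #> g}"
      using cyc g by (auto simp: cyclic_mod_def carrier_FactGroup Q.generate_pow[OF gQ] N.FactGroup_int_pow)
  qed
  then have "Q.ord (K #> g) = index K"
    using Q.generate_pow_card[OF gQ] by (simp add: index_def FactGroup_def)
  then have "(K #> g) [^]\<^bsub>G Mod K\<^esub> i = K \<longleftrightarrow> int (index K) dvd i"
    using Q.int_pow_eq_id[OF gQ, of i] by simp
  moreover have "(K #> g) [^]\<^bsub>G Mod K\<^esub> i = K #> (g [^] i)" using g by (simp add: N.FactGroup_int_pow)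
  moreover have "K #> (g [^] i) = K \<longleftrightarrow> g [^] i \<in> K"
    using g opensD[OF K] by (metis coset_join1 coset_join2 int_pow_closed subgroup.subset)
  ultimately show ?thesis by simp
qed

text \<open>
  Membership in an open subgroup \<open>K\<close> above \<open>H\<close> is read off from the exponent \<open>i\<close> of an element \<open>h g^i\<close>: it
  means that the index of \<open>K\<close> divides \<open>i\<close>.
\<close>

lemma cyclic_mod_subset:
  assumes cyc: "cyclic_mod g H" and H: "H \<in> opens"
    and K: "K \<in> opens" "H \<subseteq> K" and L: "L \<in> opens" "H \<subseteq> L" and dvd: "index K dvd index L"
  shows "L \<subseteq> K"
proof
  fix x assume x: "x \<in> L"
  then have xG: "x \<in> carrier G" using subgroup.subset[OF opensD[OF L(1)]] by auto
  have g: "g \<in> carrier G" using cyc by (simp add: cyclic_mod_def)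
  obtain i :: int where i: "H #> x = H #> (g [^] i)" using cyc xG by (auto simp: cyclic_mod_def)
  then have xi: "x \<otimes> inv (g [^] i) \<in> H" using H g xG by (simp add: rcoset_eq_iff opensD)
  have iff: "x \<in> M \<longleftrightarrow> g [^] i \<in> M" if M: "M \<in> opens" "H \<subseteq> M" for M
  proof -
    have "M #> x = M #> (g [^] i)" using xi M g xG by (auto simp: rcoset_eq_iff opensD)
    then show ?thesis using opensD[OF M(1)] g xG
      by (metis coset_join1 coset_join2 int_pow_closed subgroup.subset)
  qed
  have "int (index L) dvd i"
    using x iff[OF L] cyclic_mod_pow_mem_iff[OF cyclic_mod_mono[OF cyc H L] L(1)] by simp
  then have "int (index K) dvd i" using dvd by (meson dvd_trans of_nat_dvd_iff)
  then show "x \<in> K" using iff[OF K] cyclic_mod_pow_mem_iff[OF cyclic_mod_mono[OF cyc H K] K(1)] by simp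
qed

lemma cyclic_mod_unique:
  assumes "cyclic_mod g H" "H \<in> opens" "K \<in> opens" "H \<subseteq> K" "L \<in> opens" "H \<subseteq> L" "index K = index L"
  shows "K = L"
  using assms cyclic_mod_subset[of g H K L] cyclic_mod_subset[of g H L K] by auto

text \<open>
  An open subgroup above \<open>H n\<close> has index \<open>p ^ i\<close> with \<open>i \<le> n\<close>, and in the presence of a cyclic quotient
  the index determines it.
\<close>

lemma open_supersets_of_cyclic_chain:
  assumes "cyclic_mod g (H n)" and "\<And>i. H i \<in> opens" and "\<And>i. index (H i) = p ^ i"
    and "\<And>i. H (Suc i) \<subseteq> H i"
  shows "{K \<in> opens. H n \<subseteq> K} = H ` {..n}"
proof -
  have "H n \<subseteq> H i" if "i \<le> n" for i using that assms(4) by (rule lift_Suc_antimono_le[rotated])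
  moreover have "K \<in> H ` {..n}" if K: "K \<in> opens" "H n \<subseteq> K" for K
  proof -
    have "index K dvd p ^ n" using index_dvd[OF assms(2) K(1,2)] assms(3) by simp
    then obtain i where i: "i \<le> n" "index K = p ^ i" using prime_p by (auto simp: divides_primepow_nat)
    then have "K = H i" using calculation[OF i(1)] assms K by (intro cyclic_mod_unique[of g "H n"]) auto
    then show ?thesis using i by auto
  qed
  ultimately show ?thesis using assms(2) by auto
qed

lemma ghost_chain:
  assumes "{K \<in> opens. H n \<subseteq> K} = H ` {..n}" and "\<And>i. index (H i) = p ^ i"
  shows "ghost c (H n) = (\<Sum>i\<le>n. of_nat (p ^ i) * c (H i) ^ (p ^ n div p ^ i))"
proof -
  have "inj_on H {..n}"
    using assms(2) prime_gt_1_nat[OF prime_p] by (intro inj_onI) (metis power_inject_exp)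
  then show ?thesis unfolding ghost_def using assms by (simp add: sum.reindex)
qed

end


section \<open>The p-adic integers\<close>

locale padic_group =
  fixes p :: nat
  assumes p: "prime p"
begin

lemma p_pos [simp]: "p > 0" using p by (rule prime_gt_0_nat)
lemma p_gt_1: "p > 1" using p by (rule prime_gt_1_nat)

lemma Zp_bounds: "x \<in> carrier (Zp p) \<Longrightarrow> 0 \<le> x n \<and> x n < int p ^ n"
  by (simp add: Zp_def)

lemma Zp_residue: "x \<in> carrier (Zp p) \<Longrightarrow> m \<le> n \<Longrightarrow> x n mod int p ^ m = x m"
proof (induction n)
  case (Suc n)
  show ?case
  proof (cases "m = Suc n")
    case True
    then show ?thesis using Zp_bounds[OF Suc.prems(1), of "Suc n"] by (simp add: mod_pos_pos_trivial)
  next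
    case False
    then have "m \<le> n" using Suc.prems by simp
    then have "x (Suc n) mod int p ^ m = x (Suc n) mod int p ^ n mod int p ^ m"
      by (simp add: mod_mod_cancel le_imp_power_dvd)
    also have "\<dots> = x n mod int p ^ m" using Suc.prems(1) by (simp add: Zp_def)
    finally show ?thesis using Suc \<open>m \<le> n\<close> by simp
  qed
next
  case 0
  then show ?case using Zp_bounds[of x 0] by simp
qed

lemma Zp_mod [simp]: "x \<in> carrier (Zp p) \<Longrightarrow> x n mod int p ^ n = x n"
  by (simp add: Zp_residue)

lemma Zp_carrierI:
  assumes "\<And>n. f (Suc n) mod int p ^ n = f n mod int p ^ n"
  shows "(\<lambda>n. f n mod int p ^ n) \<in> carrier (Zp p)"
  using assms by (simp add: Zp_def mod_mod_cancel le_imp_power_dvd)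

lemma Zp_Suc_mod: "x \<in> carrier (Zp p) \<Longrightarrow> x (Suc n) mod int p ^ n = x n"
  by (simp add: Zp_def)

definition of_int_Zp :: "int \<Rightarrow> padic" where
  "of_int_Zp t = (\<lambda>n. t mod int p ^ n)"

lemma of_int_Zp_closed [simp]: "of_int_Zp t \<in> carrier (Zp p)"
  unfolding of_int_Zp_def by (rule Zp_carrierI) simp

lemma comm_group_Zp: "comm_group (Zp p)"
proof (rule comm_groupI)
  have mult: "x \<otimes>\<^bsub>Zp p\<^esub> y = (\<lambda>n. (x n + y n) mod int p ^ n)" for x y by (simp add: Zp_def)
  have one: "\<one>\<^bsub>Zp p\<^esub> = (\<lambda>n. 0)" by (simp add: Zp_def)
  show "x \<otimes>\<^bsub>Zp p\<^esub> y \<in> carrier (Zp p)" if "x \<in> carrier (Zp p)" "y \<in> carrier (Zp p)" for x y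
    unfolding mult using that
    by (intro Zp_carrierI) (metis Zp_Suc_mod mod_add_eq)
  show "\<one>\<^bsub>Zp p\<^esub> \<in> carrier (Zp p)" by (simp add: Zp_def)
  show "\<exists>y\<in>carrier (Zp p). y \<otimes>\<^bsub>Zp p\<^esub> x = \<one>\<^bsub>Zp p\<^esub>" if "x \<in> carrier (Zp p)" for x
  proof
    show "(\<lambda>n. (- x n) mod int p ^ n) \<in> carrier (Zp p)"
      using that by (intro Zp_carrierI) (metis Zp_Suc_mod mod_minus_eq)
    show "(\<lambda>n. (- x n) mod int p ^ n) \<otimes>\<^bsub>Zp p\<^esub> x = \<one>\<^bsub>Zp p\<^esub>"
      by (simp add: mult one mod_add_left_eq)
  qed
  show "x \<otimes>\<^bsub>Zp p\<^esub> y \<otimes>\<^bsub>Zp p\<^esub> z = x \<otimes>\<^bsub>Zp p\<^esub> (y \<otimes>\<^bsub>Zp p\<^esub> z)" for x y z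
    by (simp add: mult mod_add_left_eq mod_add_right_eq add.assoc)
  show "x \<otimes>\<^bsub>Zp p\<^esub> y = y \<otimes>\<^bsub>Zp p\<^esub> x" for x y by (simp add: mult add.commute)
  show "\<one>\<^bsub>Zp p\<^esub> \<otimes>\<^bsub>Zp p\<^esub> x = x" if "x \<in> carrier (Zp p)" for x
    using that by (simp add: mult one)
qed

sublocale Z: comm_group "Zp p" by (rule comm_group_Zp)

lemma Zp_mult: "(x \<otimes>\<^bsub>Zp p\<^esub> y) n = (x n + y n) mod int p ^ n" by (simp add: Zp_def)

lemma Zp_one: "\<one>\<^bsub>Zp p\<^esub> n = 0" by (simp add: Zp_def)

lemma Zp_inv:
  assumes x: "x \<in> carrier (Zp p)"
  shows "(inv\<^bsub>Zp p\<^esub> x) n = (- x n) mod int p ^ n"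
proof -
  have "(inv\<^bsub>Zp p\<^esub> x \<otimes>\<^bsub>Zp p\<^esub> x) n = 0" using x by (simp add: Zp_one)
  then have "((inv\<^bsub>Zp p\<^esub> x) n + x n) mod int p ^ n = 0 mod int p ^ n" by (simp add: Zp_mult)
  then have "((inv\<^bsub>Zp p\<^esub> x) n + x n - x n) mod int p ^ n = (0 - x n) mod int p ^ n"
    by (rule mod_diff_cong) simp
  then show ?thesis using x by simp
qed

lemma Zp_nat_pow: "x \<in> carrier (Zp p) \<Longrightarrow> (x [^]\<^bsub>Zp p\<^esub> (k::nat)) n = (int k * x n) mod int p ^ n"
  by (induction k) (simp_all add: Zp_one Zp_mult mod_simps algebra_simps)

lemma Zp_int_pow: "x \<in> carrier (Zp p) \<Longrightarrow> (x [^]\<^bsub>Zp p\<^esub> (i::int)) n = (i * x n) mod int p ^ n"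
  by (cases i rule: int_cases2)
     (simp_all add: Z.int_pow_neg int_pow_int Zp_inv Zp_nat_pow mod_minus_eq)

lemma Zp_diff_eq_iff:
  assumes "x \<in> carrier (Zp p)" "y \<in> carrier (Zp p)"
  shows "x n = y n \<longleftrightarrow> (x \<otimes>\<^bsub>Zp p\<^esub> inv\<^bsub>Zp p\<^esub> y) n = 0"
proof -
  have "(x \<otimes>\<^bsub>Zp p\<^esub> inv\<^bsub>Zp p\<^esub> y) n = (x n - y n) mod int p ^ n"
    using assms by (simp add: Zp_mult Zp_inv mod_simps)
  moreover have "(x n - y n) mod int p ^ n = 0 \<longleftrightarrow> x n mod int p ^ n = y n mod int p ^ n"
    by (simp add: mod_eq_dvd_iff mod_eq_0_iff_dvd)
  ultimately show ?thesis using assms by simp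
qed

definition Zp_filt :: "nat \<Rightarrow> padic set" where
  "Zp_filt n = {x \<in> carrier (Zp p). x n = 0}"

text \<open>
  Division by \<open>p ^ n\<close> shifts the sequence of residues by \<open>n\<close> places.
\<close>

lemma Zp_filt_eq_powers: "Zp_filt n = (\<lambda>x. x [^]\<^bsub>Zp p\<^esub> (p ^ n)) ` carrier (Zp p)"
proof (intro equalityI subsetI)
  fix x assume "x \<in> Zp_filt n"
  then have x: "x \<in> carrier (Zp p)" "x n = 0" by (auto simp: Zp_filt_def)
  define y where "y k = x (n + k) div int p ^ n" for k
  have pos: "int p ^ n > 0" by simp
  have y: "y \<in> carrier (Zp p)"
    unfolding Zp_def
  proof (clarsimp, intro conjI)
    fix k
    show "0 \<le> y k" using Zp_bounds[OF x(1)] pos by (simp add: y_def pos_imp_zdiv_nonneg_iff)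
    show "y k < int p ^ k"
    proof -
      have "y k * int p ^ n \<le> x (n + k)"
        unfolding y_def by (simp flip: minus_mod_eq_div_mult)
      also have "\<dots> < int p ^ k * int p ^ n"
        using Zp_bounds[OF x(1), of "n + k"] by (simp add: power_add mult.commute)
      finally show ?thesis using pos by simp
    qed
    have "x (n + k) = x (n + Suc k) mod (int p ^ n * int p ^ k)"
      using Zp_Suc_mod[OF x(1), of "n + k"] by (simp add: power_add)
    then have "x (n + k) = int p ^ n * (x (n + Suc k) div int p ^ n mod int p ^ k) + x (n + Suc k) mod int p ^ n"
      by (simp add: zmod_zmult2_eq)
    then show "y (Suc k) mod int p ^ k = y k"
      using Zp_residue[OF x(1), of n "n + Suc k"] x(2) by (simp add: y_def)
  qed
  have "(y [^]\<^bsub>Zp p\<^esub> (p ^ n)) k = x k" for k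
  proof -
    have "int p ^ n dvd x (n + k)"
      using Zp_residue[OF x(1), of n "n + k"] x(2) by (simp add: mod_eq_0_iff_dvd)
    then have "(y [^]\<^bsub>Zp p\<^esub> (p ^ n)) k = x (n + k) mod int p ^ k"
      using y by (simp add: Zp_nat_pow) (simp add: y_def)
    then show ?thesis using Zp_residue[OF x(1), of k "n + k"] by simp
  qed
  then have "y [^]\<^bsub>Zp p\<^esub> (p ^ n) = x" by blast
  then show "x \<in> (\<lambda>x. x [^]\<^bsub>Zp p\<^esub> (p ^ n)) ` carrier (Zp p)" using y by blast
qed (auto simp: Zp_filt_def Zp_nat_pow)

lemma openin_Zp:
  "openin (Zp_top p) S \<longleftrightarrow> S \<subseteq> carrier (Zp p) \<and> (\<forall>x\<in>S. \<exists>n. \<forall>y\<in>carrier (Zp p). y n = x n \<longrightarrow> y \<in> S)"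
proof
  assume "openin (Zp_top p) S"
  then obtain U where U: "openin (product_topology (\<lambda>n. discrete_topology UNIV) UNIV) U"
    and S: "S = U \<inter> carrier (Zp p)" by (auto simp: Zp_top_def openin_subtopology)
  have "\<exists>n. \<forall>y\<in>carrier (Zp p). y n = x n \<longrightarrow> y \<in> S" if x: "x \<in> S" for x
  proof -
    from product_topology_open_contains_basis[OF U, of x] x S
    obtain V where V: "x \<in> Pi\<^sub>E UNIV V" "finite {i. V i \<noteq> UNIV}" "Pi\<^sub>E UNIV V \<subseteq> U" by auto
    obtain n where n: "\<forall>i\<in>{i. V i \<noteq> UNIV}. i \<le> n" using V(2) finite_nat_set_iff_bounded_le by auto
    have "y \<in> S" if y: "y \<in> carrier (Zp p)" "y n = x n" for y
    proof -
      have "y i \<in> V i" for i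
      proof (cases "V i = UNIV")
        case False
        then have "i \<le> n" using n by auto
        then have "y i = x i" using y x S Zp_residue[of y i n] Zp_residue[of x i n] by auto
        then show ?thesis using V(1) by auto
      qed auto
      then show ?thesis using V(3) y(1) S by auto
    qed
    then show ?thesis by blast
  qed
  then show "S \<subseteq> carrier (Zp p) \<and> (\<forall>x\<in>S. \<exists>n. \<forall>y\<in>carrier (Zp p). y n = x n \<longrightarrow> y \<in> S)" using S by auto
next
  assume R: "S \<subseteq> carrier (Zp p) \<and> (\<forall>x\<in>S. \<exists>n. \<forall>y\<in>carrier (Zp p). y n = x n \<longrightarrow> y \<in> S)"
  show "openin (Zp_top p) S"
  proof (subst openin_subopen, intro ballI)
    fix x assume x: "x \<in> S"
    then obtain n where n: "\<forall>y\<in>carrier (Zp p). y n = x n \<longrightarrow> y \<in> S" using R by blast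
    \<comment> \<open>the sequences with the same \<open>n\<close>-th residue as \<open>x\<close>\<close>
    let ?V = "Pi\<^sub>E UNIV (\<lambda>i. if i = n then {x n} else UNIV)"
    have "openin (product_topology (\<lambda>n. discrete_topology UNIV) UNIV) ?V"
      by (rule product_topology_basis) (auto intro: rev_finite_subset[of "{n}"])
    then have "openin (Zp_top p) (?V \<inter> carrier (Zp p))"
      by (auto simp: Zp_top_def openin_subtopology)
    moreover have "?V \<inter> carrier (Zp p) = {y \<in> carrier (Zp p). y n = x n}"
      by (auto simp: PiE_def Pi_def)
    ultimately show "\<exists>T. openin (Zp_top p) T \<and> x \<in> T \<and> T \<subseteq> S" using n x R by (intro exI[of _ "?V \<inter> carrier (Zp p)"]) auto
  qed
qed

lemma image_residue: "(\<lambda>x. x n) ` carrier (Zp p) = {0..<int p ^ n}"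
proof
  show "(\<lambda>x. x n) ` carrier (Zp p) \<subseteq> {0..<int p ^ n}" using Zp_bounds by auto
  show "{0..<int p ^ n} \<subseteq> (\<lambda>x. x n) ` carrier (Zp p)"
  proof
    fix t assume "t \<in> {0..<int p ^ n}"
    then have "t = of_int_Zp t n" by (simp add: of_int_Zp_def)
    then show "t \<in> (\<lambda>x. x n) ` carrier (Zp p)"
      using of_int_Zp_closed by (intro image_eqI[of _ _ "of_int_Zp t"])
  qed
qed

lemma
  shows pro_p_Zp: "abelian_pro_p_group (Zp p) (Zp_top p) p"
    and open_subgroups_Zp: "\<And>H. H \<in> open_subgroups (Zp p) (Zp_top p) \<longleftrightarrow> subgroup H (Zp p) \<and> (\<exists>n. Zp_filt n \<subseteq> H)"
proof -
  have diff: "x n = y n \<longleftrightarrow> (x \<otimes>\<^bsub>Zp p\<^esub> inv\<^bsub>Zp p\<^esub> y) n = \<one>\<^bsub>Zp p\<^esub> n"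
    if "x \<in> carrier (Zp p)" "y \<in> carrier (Zp p)" for x y n
    using Zp_diff_eq_iff[OF that, of n] by (simp only: Zp_one)
  have card: "card ((\<lambda>x. x n) ` carrier (Zp p)) = p ^ n" for n by (simp add: image_residue nat_power_eq)
  note residues = abelian_pro_p_group_residues[of "Zp p" p "Zp_top p" "\<lambda>n x. x n" "\<lambda>n. n",
    OF comm_group_Zp p openin_Zp _ card]
  show "abelian_pro_p_group (Zp p) (Zp_top p) p" by (rule residues(1)) (rule diff)
  fix H
  have "H \<in> open_subgroups (Zp p) (Zp_top p) \<longleftrightarrow>
      subgroup H (Zp p) \<and> (\<exists>n. {x \<in> carrier (Zp p). x n = \<one>\<^bsub>Zp p\<^esub> n} \<subseteq> H)"
    by (rule residues(2)) (rule diff)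
  then show "H \<in> open_subgroups (Zp p) (Zp_top p) \<longleftrightarrow> subgroup H (Zp p) \<and> (\<exists>n. Zp_filt n \<subseteq> H)"
    by (simp add: Zp_filt_def Zp_one)
qed

sublocale Z: abelian_pro_p_group "Zp p" "Zp_top p" p by (rule pro_p_Zp)

lemma subgroup_Zp_filt: "subgroup (Zp_filt n) (Zp p)"
proof (rule Z.subgroupI)
  show "Zp_filt n \<noteq> {}" using Z.one_closed by (auto simp: Zp_filt_def Zp_one)
qed (auto simp: Zp_filt_def Zp_mult Zp_inv)

lemma open_Zp_filt: "Zp_filt n \<in> Z.opens"
  using subgroup_Zp_filt by (auto simp: open_subgroups_Zp)

lemma index_Zp_filt: "Z.index (Zp_filt n) = p ^ n"
proof -
  have "card (rcosets\<^bsub>Zp p\<^esub> Zp_filt n) = card ((\<lambda>x. x n) ` carrier (Zp p))"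
  proof (rule Z.card_rcosets_eq_card_image[OF subgroup_Zp_filt])
    fix x y assume "x \<in> carrier (Zp p)" "y \<in> carrier (Zp p)"
    then show "x n = y n \<longleftrightarrow> x \<otimes>\<^bsub>Zp p\<^esub> inv\<^bsub>Zp p\<^esub> y \<in> Zp_filt n"
      using Zp_diff_eq_iff[of x y n] by (simp add: Zp_filt_def)
  qed
  then show ?thesis by (simp add: Z.index_def image_residue nat_power_eq)
qed

lemma of_int_Zp_pow: "(of_int_Zp t [^]\<^bsub>Zp p\<^esub> (i::int)) n = (i * t) mod int p ^ n"
proof -
  have "(of_int_Zp t [^]\<^bsub>Zp p\<^esub> i) n = (i * of_int_Zp t n) mod int p ^ n"
    by (rule Zp_int_pow) simp
  then show ?thesis by (simp add: of_int_Zp_def mod_mult_right_eq)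
qed

lemma cyclic_mod_Zp_filt: "Z.cyclic_mod (of_int_Zp 1) (Zp_filt n)"
proof -
  have "Zp_filt n #>\<^bsub>Zp p\<^esub> x = Zp_filt n #>\<^bsub>Zp p\<^esub> (of_int_Zp 1 [^]\<^bsub>Zp p\<^esub> x n)"
    if x: "x \<in> carrier (Zp p)" for x
  proof -
    let ?g = "of_int_Zp 1 [^]\<^bsub>Zp p\<^esub> x n"
    have g: "?g \<in> carrier (Zp p)" by simp
    then have "x \<otimes>\<^bsub>Zp p\<^esub> inv\<^bsub>Zp p\<^esub> ?g \<in> Zp_filt n"
      using x Zp_diff_eq_iff[OF x g, of n] by (simp add: Zp_filt_def of_int_Zp_pow)
    then show ?thesis using Z.rcoset_eq_iff[OF subgroup_Zp_filt x g] by blast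
  qed
  then show ?thesis unfolding Z.cyclic_mod_def using of_int_Zp_closed by blast
qed

lemma Zp_filt_Suc: "Zp_filt (Suc n) \<subseteq> Zp_filt n"
proof
  fix x assume "x \<in> Zp_filt (Suc n)"
  then show "x \<in> Zp_filt n" using Zp_Suc_mod[of x n] by (simp add: Zp_filt_def)
qed

lemma Zp_filt_supersets: "{K \<in> Z.opens. Zp_filt n \<subseteq> K} = Zp_filt ` {..n}"
  using Z.open_supersets_of_cyclic_chain[of "of_int_Zp 1" Zp_filt n]
    cyclic_mod_Zp_filt open_Zp_filt index_Zp_filt Zp_filt_Suc by simp

text \<open>
  An open subgroup contains some \<open>Zp_filt n\<close>, and the subgroups above that one form a finite chain because
  its quotient is cyclic.
\<close>

lemma opens_Zp: "Z.opens = range Zp_filt"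
proof
  show "Z.opens \<subseteq> range Zp_filt"
  proof
    fix H assume H: "H \<in> Z.opens"
    then obtain n where "Zp_filt n \<subseteq> H" by (auto simp: open_subgroups_Zp)
    then show "H \<in> range Zp_filt" using H Zp_filt_supersets[of n] by blast
  qed
qed (auto simp: open_Zp_filt)

lemma W_index_eq: "W_index p n = {Zp_filt n}"
  by (simp add: W_index_def Zp_filt_eq_powers[symmetric] Z.gset_class_eq open_Zp_filt)

lemma inj_W_index: "inj (W_index p)"
proof (rule injI)
  fix m n assume "W_index p m = W_index p n"
  then have "p ^ m = p ^ n" using index_Zp_filt by (metis W_index_eq singleton_inject)
  then show "m = n" using p_gt_1 by simp
qed

lemma gset_classes_Zp: "gset_classes (Zp p) (Zp_top p) = range (W_index p)"
  by (auto simp: Z.gset_classes_eq opens_Zp W_index_eq)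

lemma inv_W_index [simp]: "inv_into UNIV (W_index p) (W_index p n) = n"
  using inj_W_index by (simp add: inv_f_f)



section \<open>The group $\mathbf{Z}_p^2$ and its cyclic quotients\<close>

lemma carrier_Zp2: "carrier (Zp2 p) = carrier (Zp p) \<times> carrier (Zp p)"
  by (simp add: Zp2_def)

lemma comm_group_Zp2: "comm_group (Zp2 p)"
proof -
  interpret G: group "Zp2 p" unfolding Zp2_def by (intro DirProd_group Z.is_group)
  show ?thesis by (rule G.group_comm_groupI) (auto simp: Zp2_def Z.m_comm)
qed

sublocale Z2: comm_group "Zp2 p" by (rule comm_group_Zp2)

lemma Zp2_mult: "(x, y) \<otimes>\<^bsub>Zp2 p\<^esub> (x', y') = (x \<otimes>\<^bsub>Zp p\<^esub> x', y \<otimes>\<^bsub>Zp p\<^esub> y')"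
  by (simp add: Zp2_def)

lemma Zp2_one: "\<one>\<^bsub>Zp2 p\<^esub> = (\<one>\<^bsub>Zp p\<^esub>, \<one>\<^bsub>Zp p\<^esub>)"
  by (simp add: Zp2_def)

lemma Zp2_inv:
  "x \<in> carrier (Zp p) \<Longrightarrow> y \<in> carrier (Zp p) \<Longrightarrow> inv\<^bsub>Zp2 p\<^esub> (x, y) = (inv\<^bsub>Zp p\<^esub> x, inv\<^bsub>Zp p\<^esub> y)"
  by (simp add: Zp2_def Z.is_group)

lemma Zp2_nat_pow: "(x, y) [^]\<^bsub>Zp2 p\<^esub> (k::nat) = (x [^]\<^bsub>Zp p\<^esub> k, y [^]\<^bsub>Zp p\<^esub> k)"
  by (induction k) (simp_all add: Zp2_one Zp2_mult)

lemma Zp2_int_pow: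
  "x \<in> carrier (Zp p) \<Longrightarrow> y \<in> carrier (Zp p) \<Longrightarrow>
    (x, y) [^]\<^bsub>Zp2 p\<^esub> (i::int) = (x [^]\<^bsub>Zp p\<^esub> i, y [^]\<^bsub>Zp p\<^esub> i)"
  by (cases i rule: int_cases2)
     (simp_all add: Z.int_pow_neg Z2.int_pow_neg int_pow_int Zp2_inv Zp2_nat_pow carrier_Zp2)

lemma openin_Zp2:
  "openin (Zp2_top p) S \<longleftrightarrow> S \<subseteq> carrier (Zp2 p) \<and>
    (\<forall>z\<in>S. \<exists>n. \<forall>w\<in>carrier (Zp2 p). (fst w n, snd w n) = (fst z n, snd z n) \<longrightarrow> w \<in> S)"
proof
  assume S: "openin (Zp2_top p) S"
  have "topspace (Zp2_top p) \<subseteq> carrier (Zp2 p)"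
    by (auto simp: Zp2_top_def Zp_top_def carrier_Zp2)
  then have "S \<subseteq> carrier (Zp2 p)" using openin_subset[OF S] by blast
  moreover have "\<exists>n. \<forall>w\<in>carrier (Zp2 p). (fst w n, snd w n) = (fst z n, snd z n) \<longrightarrow> w \<in> S" if "z \<in> S" for z
  proof -
    obtain x y where z: "z = (x, y)" by (cases z)
    then have "(x, y) \<in> S" using that by simp
    from S[unfolded Zp2_top_def openin_prod_topology_alt, rule_format, OF this]
    obtain U V where UV: "openin (Zp_top p) U" "openin (Zp_top p) V" "x \<in> U" "y \<in> V" "U \<times> V \<subseteq> S"
      by (elim exE conjE)
    then obtain m n where m: "\<forall>x'\<in>carrier (Zp p). x' m = x m \<longrightarrow> x' \<in> U"
      and n: "\<forall>y'\<in>carrier (Zp p). y' n = y n \<longrightarrow> y' \<in> V" unfolding openin_Zp by blast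
    have xy: "x \<in> carrier (Zp p)" "y \<in> carrier (Zp p)" using UV unfolding openin_Zp by auto
    have "(x', y') \<in> S" if "x' \<in> carrier (Zp p)" "y' \<in> carrier (Zp p)"
      "x' (max m n) = x (max m n)" "y' (max m n) = y (max m n)" for x' y'
    proof -
      have "x' m = x m" using Zp_residue[OF that(1), of m "max m n"] Zp_residue[OF xy(1), of m "max m n"] that by simp
      moreover have "y' n = y n" using Zp_residue[OF that(2), of n "max m n"] Zp_residue[OF xy(2), of n "max m n"] that by simp
      ultimately show ?thesis using m n UV that by blast
    qed
    then show ?thesis by (intro exI[of _ "max m n"]) (auto simp: z carrier_Zp2)
  qed
  ultimately show "S \<subseteq> carrier (Zp2 p) \<and>
    (\<forall>z\<in>S. \<exists>n. \<forall>w\<in>carrier (Zp2 p). (fst w n, snd w n) = (fst z n, snd z n) \<longrightarrow> w \<in> S)" by blast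
next
  assume R: "S \<subseteq> carrier (Zp2 p) \<and>
    (\<forall>z\<in>S. \<exists>n. \<forall>w\<in>carrier (Zp2 p). (fst w n, snd w n) = (fst z n, snd z n) \<longrightarrow> w \<in> S)"
  have cyl: "openin (Zp_top p) {y \<in> carrier (Zp p). y n = x n}" for x n
    unfolding openin_Zp by (auto intro!: exI[of _ n])
  show "openin (Zp2_top p) S"
    unfolding Zp2_top_def openin_prod_topology_alt
  proof (intro allI impI)
    fix x y assume xy: "(x, y) \<in> S"
    then obtain n where "\<forall>w\<in>carrier (Zp2 p). (fst w n, snd w n) = (x n, y n) \<longrightarrow> w \<in> S" using R by fastforce
    then show "\<exists>U V. openin (Zp_top p) U \<and> openin (Zp_top p) V \<and> x \<in> U \<and> y \<in> V \<and> U \<times> V \<subseteq> S"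
      using R xy by (intro exI[of _ "{z \<in> carrier (Zp p). z n = x n}"] exI[of _ "{z \<in> carrier (Zp p). z n = y n}"])
        (auto simp: cyl carrier_Zp2)
  qed
qed

lemma
  shows pro_p_Zp2: "abelian_pro_p_group (Zp2 p) (Zp2_top p) p"
    and open_subgroups_Zp2: "\<And>H. H \<in> open_subgroups (Zp2 p) (Zp2_top p) \<longleftrightarrow>
      subgroup H (Zp2 p) \<and> (\<exists>n. Zp_filt n \<times> Zp_filt n \<subseteq> H)"
proof -
  let ?r = "\<lambda>n z. (fst z n, snd z n) :: int \<times> int"
  have diff: "?r n z = ?r n w \<longleftrightarrow> ?r n (z \<otimes>\<^bsub>Zp2 p\<^esub> inv\<^bsub>Zp2 p\<^esub> w) = ?r n \<one>\<^bsub>Zp2 p\<^esub>"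
    if zw: "z \<in> carrier (Zp2 p)" "w \<in> carrier (Zp2 p)" for n z w
  proof -
    obtain x y x' y' where xy: "z = (x, y)" "w = (x', y')" "x \<in> carrier (Zp p)" "y \<in> carrier (Zp p)"
      "x' \<in> carrier (Zp p)" "y' \<in> carrier (Zp p)" using zw by (auto simp: carrier_Zp2)
    show ?thesis
      using Zp_diff_eq_iff[of x x' n] Zp_diff_eq_iff[of y y' n] xy by (simp add: Zp2_inv Zp2_mult Zp2_one Zp_one)
  qed
  have "?r n ` carrier (Zp2 p) = {0..<int p ^ n} \<times> {0..<int p ^ n}" for n
    unfolding carrier_Zp2 image_residue[of n, symmetric] by force
  then have card: "card (?r n ` carrier (Zp2 p)) = p ^ (2 * n)" for n
    by (simp add: card_cartesian_product nat_power_eq mult_2 power_add)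
  have "{z \<in> carrier (Zp2 p). ?r n z = ?r n \<one>\<^bsub>Zp2 p\<^esub>} = Zp_filt n \<times> Zp_filt n" for n
    by (auto simp: carrier_Zp2 Zp2_one Zp_one Zp_filt_def)
  note filt = this
  note residues = abelian_pro_p_group_residues[of "Zp2 p" p "Zp2_top p" ?r "\<lambda>n. 2 * n",
    OF comm_group_Zp2 p openin_Zp2 _ card]
  show "abelian_pro_p_group (Zp2 p) (Zp2_top p) p" by (rule residues(1)) (rule diff)
  fix H
  have "H \<in> open_subgroups (Zp2 p) (Zp2_top p) \<longleftrightarrow>
      subgroup H (Zp2 p) \<and> (\<exists>n. {z \<in> carrier (Zp2 p). ?r n z = ?r n \<one>\<^bsub>Zp2 p\<^esub>} \<subseteq> H)"
    by (rule residues(2)) (rule diff)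
  then show "H \<in> open_subgroups (Zp2 p) (Zp2_top p) \<longleftrightarrow>
      subgroup H (Zp2 p) \<and> (\<exists>n. Zp_filt n \<times> Zp_filt n \<subseteq> H)"
    unfolding filt .
qed

sublocale Z2: abelian_pro_p_group "Zp2 p" "Zp2_top p" p by (rule pro_p_Zp2)

text \<open>
  The points of the plane that satisfy \<open>a x + b y = 0\<close> modulo \<open>p ^ n\<close>. For fixed
  \<open>n\<close> only the residues of \<open>a\<close> and \<open>b\<close> matter, so integers reach all lines with p-adic coefficients.
\<close>

definition line :: "int \<Rightarrow> int \<Rightarrow> nat \<Rightarrow> (padic \<times> padic) set" where
  "line a b n = {(x, y). x \<in> carrier (Zp p) \<and> y \<in> carrier (Zp p) \<and> int p ^ n dvd a * x n + b * y n}"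

definition primitive :: "int \<Rightarrow> int \<Rightarrow> bool" where
  "primitive a b \<longleftrightarrow> \<not> (int p dvd a \<and> int p dvd b)"

lemma linear_mod: "(a * (u mod m) + b * (v mod m)) mod m = (a * u + b * v) mod (m :: int)"
  by (metis mod_add_eq mod_mult_right_eq)

lemma line_eq_iff:
  assumes "x \<in> carrier (Zp p)" "y \<in> carrier (Zp p)" "x' \<in> carrier (Zp p)" "y' \<in> carrier (Zp p)"
  shows "(x, y) \<otimes>\<^bsub>Zp2 p\<^esub> inv\<^bsub>Zp2 p\<^esub> (x', y') \<in> line a b n
    \<longleftrightarrow> (a * x n + b * y n) mod int p ^ n = (a * x' n + b * y' n) mod int p ^ n"
proof -
  have "(x, y) \<otimes>\<^bsub>Zp2 p\<^esub> inv\<^bsub>Zp2 p\<^esub> (x', y') \<in> line a b n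
      \<longleftrightarrow> (a * ((x n - x' n) mod int p ^ n) + b * ((y n - y' n) mod int p ^ n)) mod int p ^ n = 0"
    using assms by (simp add: line_def Zp2_inv Zp2_mult Zp_mult Zp_inv mod_simps mod_eq_0_iff_dvd)
  also have "(a * ((x n - x' n) mod int p ^ n) + b * ((y n - y' n) mod int p ^ n)) mod int p ^ n
      = (a * (x n - x' n) + b * (y n - y' n)) mod int p ^ n"
    by (rule linear_mod)
  also have "a * (x n - x' n) + b * (y n - y' n) = (a * x n + b * y n) - (a * x' n + b * y' n)"
    by (simp add: algebra_simps)
  finally show ?thesis by (simp add: mod_eq_dvd_iff mod_eq_0_iff_dvd)
qed

lemma subgroup_line: "subgroup (line a b n) (Zp2 p)"
proof (rule Z2.subgroupI)
  have one: "\<one>\<^bsub>Zp2 p\<^esub> \<in> line a b n" by (simp add: line_def Zp2_one Zp_one)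
  then show "line a b n \<noteq> {}" by blast
  show sub: "line a b n \<subseteq> carrier (Zp2 p)" by (auto simp: line_def carrier_Zp2)
  have mem: "z \<otimes>\<^bsub>Zp2 p\<^esub> inv\<^bsub>Zp2 p\<^esub> w \<in> line a b n" if "z \<in> line a b n" "w \<in> line a b n" for z w
  proof -
    obtain x y x' y' where "z = (x, y)" "w = (x', y')" by (cases z; cases w)
    moreover from this have "(a * x n + b * y n) mod int p ^ n = (a * x' n + b * y' n) mod int p ^ n"
      using that by (simp add: line_def mod_eq_0_iff_dvd[symmetric])
    ultimately show ?thesis using that line_eq_iff[of x y x' y' a b n] by (simp add: line_def)
  qed
  show inv: "inv\<^bsub>Zp2 p\<^esub> z \<in> line a b n" if "z \<in> line a b n" for z
    using mem[OF one that] sub that by auto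
  show "z \<otimes>\<^bsub>Zp2 p\<^esub> w \<in> line a b n" if "z \<in> line a b n" "w \<in> line a b n" for z w
    using mem[OF that(1) inv[OF that(2)]] sub that by auto
qed

lemma open_line: "line a b n \<in> Z2.opens"
proof -
  have "Zp_filt n \<times> Zp_filt n \<subseteq> line a b n" by (auto simp: line_def Zp_filt_def)
  then show ?thesis using subgroup_line by (auto simp: open_subgroups_Zp2)
qed

lemma line_Suc: "line a b (Suc n) \<subseteq> line a b n"
proof (clarsimp simp: line_def)
  fix x y assume xy: "x \<in> carrier (Zp p)" "y \<in> carrier (Zp p)"
    and "int p * int p ^ n dvd a * x (Suc n) + b * y (Suc n)"
  then have "int p ^ n dvd a * x (Suc n) + b * y (Suc n)" by (metis dvd_mult_right)
  then have "(a * (x (Suc n) mod int p ^ n) + b * (y (Suc n) mod int p ^ n)) mod int p ^ n = 0"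
    unfolding linear_mod by (simp add: mod_eq_0_iff_dvd)
  then show "int p ^ n dvd a * x n + b * y n" using xy by (simp add: Zp_Suc_mod mod_eq_0_iff_dvd)
qed

text \<open>
  A Bezout relation for \<open>a\<close>, \<open>b\<close> and \<open>p ^ n\<close> provides a point at which the linear form \<open>a x + b y\<close> takes the value
  \<open>1\<close>; its multiples then realise all values.
\<close>

lemma primitive_generator:
  assumes "primitive a b"
  obtains g where "g \<in> carrier (Zp2 p)"
    "\<And>i. \<exists>x y. g [^]\<^bsub>Zp2 p\<^esub> (i::int) = (x, y) \<and> x \<in> carrier (Zp p) \<and> y \<in> carrier (Zp p) \<and>
      (a * x n + b * y n) mod int p ^ n = i mod int p ^ n"
proof -
  have "\<not> int p dvd gcd a b" using assms by (simp add: primitive_def)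
  moreover have "prime (int p)" using p by simp
  ultimately have "coprime (gcd a b) (int p ^ n)"
    by (metis coprime_commute coprime_power_right_iff prime_imp_coprime)
  then obtain t where t: "[gcd a b * t = 1] (mod int p ^ n)" using cong_solve_coprime_int by blast
  obtain u v where uv: "u * a + v * b = gcd a b" using bezout_int by blast
  define g where "g = (of_int_Zp (u * t), of_int_Zp (v * t))"
  show thesis
  proof
    show "g \<in> carrier (Zp2 p)" by (simp add: g_def carrier_Zp2)
    fix i :: int
    have "(a * (i * (u * t)) + b * (i * (v * t))) mod int p ^ n = (i * (gcd a b * t)) mod int p ^ n"
      unfolding uv[symmetric] by (simp add: algebra_simps)
    also have "\<dots> = (i * 1) mod int p ^ n" using cong_scalar_left[OF t, of i] by (simp add: cong_def)
    finally have "(a * ((of_int_Zp (u * t) [^]\<^bsub>Zp p\<^esub> i) n) + b * ((of_int_Zp (v * t) [^]\<^bsub>Zp p\<^esub> i) n)) mod int p ^ n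
        = i mod int p ^ n"
      by (simp add: of_int_Zp_pow linear_mod)
    then show "\<exists>x y. g [^]\<^bsub>Zp2 p\<^esub> i = (x, y) \<and> x \<in> carrier (Zp p) \<and> y \<in> carrier (Zp p) \<and>
        (a * x n + b * y n) mod int p ^ n = i mod int p ^ n"
      by (simp add: g_def Zp2_int_pow)
  qed
qed

lemma index_line:
  assumes "primitive a b"
  shows "Z2.index (line a b n) = p ^ n"
proof -
  let ?f = "\<lambda>(x, y). (a * x n + b * y n) mod int p ^ n"
  obtain g where g: "\<And>i. \<exists>x y. g [^]\<^bsub>Zp2 p\<^esub> (i::int) = (x, y) \<and> x \<in> carrier (Zp p) \<and> y \<in> carrier (Zp p) \<and>
      (a * x n + b * y n) mod int p ^ n = i mod int p ^ n"
    using primitive_generator[OF assms] by metis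
  have "?f ` carrier (Zp2 p) = {0..<int p ^ n}"
  proof
    show "?f ` carrier (Zp2 p) \<subseteq> {0..<int p ^ n}" by auto
    show "{0..<int p ^ n} \<subseteq> ?f ` carrier (Zp2 p)"
    proof
      fix t assume "t \<in> {0..<int p ^ n}"
      moreover obtain x y where "x \<in> carrier (Zp p)" "y \<in> carrier (Zp p)"
        "(a * x n + b * y n) mod int p ^ n = t mod int p ^ n" using g[of t] by blast
      ultimately show "t \<in> ?f ` carrier (Zp2 p)"
        by (intro image_eqI[of _ _ "(x, y)"]) (auto simp: carrier_Zp2)
    qed
  qed
  moreover have "card (rcosets\<^bsub>Zp2 p\<^esub> line a b n) = card (?f ` carrier (Zp2 p))"
    by (rule Z2.card_rcosets_eq_card_image[OF subgroup_line]) (auto simp: carrier_Zp2 line_eq_iff)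
  ultimately show ?thesis by (simp add: Z2.index_def nat_power_eq)
qed

lemma cyclic_line:
  assumes "primitive a b"
  shows "\<exists>g. Z2.cyclic_mod g (line a b n)"
proof -
  obtain g where gG: "g \<in> carrier (Zp2 p)"
    and g: "\<And>i. \<exists>x y. g [^]\<^bsub>Zp2 p\<^esub> (i::int) = (x, y) \<and> x \<in> carrier (Zp p) \<and> y \<in> carrier (Zp p) \<and>
      (a * x n + b * y n) mod int p ^ n = i mod int p ^ n"
    using primitive_generator[OF assms] by metis
  have "\<exists>i::int. line a b n #>\<^bsub>Zp2 p\<^esub> z = line a b n #>\<^bsub>Zp2 p\<^esub> (g [^]\<^bsub>Zp2 p\<^esub> i)" if z: "z \<in> carrier (Zp2 p)" for z
  proof -
    obtain x y where xy: "z = (x, y)" "x \<in> carrier (Zp p)" "y \<in> carrier (Zp p)" using z by (auto simp: carrier_Zp2)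
    let ?i = "a * x n + b * y n"
    obtain x' y' where g': "g [^]\<^bsub>Zp2 p\<^esub> ?i = (x', y')" "x' \<in> carrier (Zp p)" "y' \<in> carrier (Zp p)"
      "(a * x' n + b * y' n) mod int p ^ n = ?i mod int p ^ n" using g[of ?i] by blast
    then have "line a b n #>\<^bsub>Zp2 p\<^esub> z = line a b n #>\<^bsub>Zp2 p\<^esub> (g [^]\<^bsub>Zp2 p\<^esub> ?i)"
      using xy by (subst Z2.rcoset_eq_iff[OF subgroup_line]) (auto simp: carrier_Zp2 line_eq_iff)
    then show ?thesis by blast
  qed
  then show ?thesis unfolding Z2.cyclic_mod_def using gG by blast
qed

text \<open>
  Let \<open>g\<close> generate the quotient. Writing the images of the two basis vectors as the powers \<open>g^a\<close> and \<open>g^b\<close>,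
  the image of \<open>(x, y)\<close> becomes \<open>g\<close> to the power \<open>a x + b y\<close>; here \<open>x\<close> and \<open>y\<close> may be replaced by their
  residues, as a group of order \<open>p ^ n\<close> kills \<open>p ^ n\<close>-th powers. The form is primitive because it takes the
  value \<open>1\<close> at \<open>g\<close>.
\<close>

lemma ex_line_eq:
  assumes H: "H \<in> Z2.opens" and cyc: "Z2.cyclic_mod g H" and n: "Z2.index H = p ^ n"
  shows "\<exists>a b. primitive a b \<and> H = line a b n"
proof (cases "n = 0")
  case True
  have "primitive 1 0" using p_gt_1 by (simp add: primitive_def)
  moreover have "carrier (Zp2 p) = H"
    using H n True Z2.index_carrier subgroup.subset[OF Z2.opensD[OF H]]
    by (metis Z2.index_eq_imp_eq Z2.open_carrier power_0)
  then have "H = line 1 0 n" using True by (auto simp: line_def carrier_Zp2)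
  ultimately show ?thesis by blast
next
  case False
  interpret N: normal H "Zp2 p" using H by (simp add: Z2.normal_iff_subgroup Z2.opensD)
  interpret Q: comm_group "Zp2 p Mod H" using Z2.opensD[OF H] by (rule Z2.group_Mod)
  let ?q = "\<lambda>z. H #>\<^bsub>Zp2 p\<^esub> z"
  have gG: "g \<in> carrier (Zp2 p)" using cyc by (simp add: Z2.cyclic_mod_def)
  have q: "?q z \<in> carrier (Zp2 p Mod H)" if "z \<in> carrier (Zp2 p)" for z using that by (auto simp: carrier_FactGroup)
  have q_mult: "?q (z \<otimes>\<^bsub>Zp2 p\<^esub> w) = ?q z \<otimes>\<^bsub>Zp2 p Mod H\<^esub> ?q w" if "z \<in> carrier (Zp2 p)" "w \<in> carrier (Zp2 p)" for z w
    using that by (simp add: N.rcos_sum)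
  have q_pow: "?q (z [^]\<^bsub>Zp2 p\<^esub> i) = ?q z [^]\<^bsub>Zp2 p Mod H\<^esub> i" if "z \<in> carrier (Zp2 p)" for z and i :: int
    using that by (simp add: N.FactGroup_int_pow)
  \<comment> \<open>the standard basis; the group law is addition, so \<open>\<one>\<close> is the number \<open>0\<close>\<close>
  let ?e1 = "(of_int_Zp 1, \<one>\<^bsub>Zp p\<^esub>)" and ?e2 = "(\<one>\<^bsub>Zp p\<^esub>, of_int_Zp 1)"
  have e: "?e1 \<in> carrier (Zp2 p)" "?e2 \<in> carrier (Zp2 p)" by (auto simp: carrier_Zp2)
  obtain a b :: int where a: "?q ?e1 = ?q (g [^]\<^bsub>Zp2 p\<^esub> a)" and b: "?q ?e2 = ?q (g [^]\<^bsub>Zp2 p\<^esub> b)"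
    using cyc e unfolding Z2.cyclic_mod_def by meson
  have filt: "?q z = H" if zn: "z \<in> Zp_filt n \<times> Zp_filt n" for z
  proof -
    obtain x y where xy: "x \<in> carrier (Zp p)" "y \<in> carrier (Zp p)" "z = (x, y) [^]\<^bsub>Zp2 p\<^esub> (p ^ n)"
    proof -
      obtain x' y' where z: "z = (x', y')" "x' \<in> Zp_filt n" "y' \<in> Zp_filt n" using zn by blast
      then obtain x y where "x \<in> carrier (Zp p)" "y \<in> carrier (Zp p)"
        "x' = x [^]\<^bsub>Zp p\<^esub> (p ^ n)" "y' = y [^]\<^bsub>Zp p\<^esub> (p ^ n)"
        unfolding Zp_filt_eq_powers by blast
      then show thesis using z(1) by (intro that[of x y]) (simp_all add: Zp2_nat_pow)
    qed
    then have "?q z = ?q (x, y) [^]\<^bsub>Zp2 p Mod H\<^esub> (p ^ n)"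
      by (simp add: N.FactGroup_pow carrier_Zp2)
    also have "p ^ n = order (Zp2 p Mod H)" using n by (simp add: Z2.index_def order_def FactGroup_def)
    also have "?q (x, y) [^]\<^bsub>Zp2 p Mod H\<^esub> \<dots> = \<one>\<^bsub>Zp2 p Mod H\<^esub>"
      using xy by (intro Q.pow_order_eq_1 q) (simp add: carrier_Zp2)
    finally show ?thesis by simp
  qed
  have decomp: "?q (x, y) = ?q (g [^]\<^bsub>Zp2 p\<^esub> (a * x n + b * y n))"
    if xy: "x \<in> carrier (Zp p)" "y \<in> carrier (Zp p)" for x y
  proof -
    \<comment> \<open>the vector with the integer coordinates \<open>x n\<close> and \<open>y n\<close>\<close>
    let ?w = "?e1 [^]\<^bsub>Zp2 p\<^esub> x n \<otimes>\<^bsub>Zp2 p\<^esub> ?e2 [^]\<^bsub>Zp2 p\<^esub> y n"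
    have w: "?w = (of_int_Zp 1 [^]\<^bsub>Zp p\<^esub> x n, of_int_Zp 1 [^]\<^bsub>Zp p\<^esub> y n)"
      by (simp add: Zp2_int_pow Zp2_mult)
    have wG: "?w \<in> carrier (Zp2 p)" using e by blast
    have "(x, y) \<otimes>\<^bsub>Zp2 p\<^esub> inv\<^bsub>Zp2 p\<^esub> ?w \<in> Zp_filt n \<times> Zp_filt n"
      unfolding w using xy
        Zp_diff_eq_iff[of x "of_int_Zp 1 [^]\<^bsub>Zp p\<^esub> x n" n] Zp_diff_eq_iff[of y "of_int_Zp 1 [^]\<^bsub>Zp p\<^esub> y n" n]
      by (simp add: Zp2_inv Zp2_mult Zp_filt_def of_int_Zp_pow)
    then have "(x, y) \<otimes>\<^bsub>Zp2 p\<^esub> inv\<^bsub>Zp2 p\<^esub> ?w \<in> H"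
      using filt wG xy Z2.opensD[OF H]
      by (metis (no_types, lifting) N.subset Z2.coset_join1 Z2.inv_closed Z2.m_closed carrier_Zp2 mem_Sigma_iff)
    then have "?q (x, y) = ?q ?w" using xy wG by (subst Z2.rcoset_eq_iff[OF Z2.opensD[OF H]]) (auto simp: carrier_Zp2)
    also have "\<dots> = ?q ?e1 [^]\<^bsub>Zp2 p Mod H\<^esub> x n \<otimes>\<^bsub>Zp2 p Mod H\<^esub> ?q ?e2 [^]\<^bsub>Zp2 p Mod H\<^esub> y n"
      using e by (simp only: q_mult q_pow Z2.int_pow_closed)
    also have "\<dots> = ?q ((g [^]\<^bsub>Zp2 p\<^esub> a) [^]\<^bsub>Zp2 p\<^esub> x n) \<otimes>\<^bsub>Zp2 p Mod H\<^esub> ?q ((g [^]\<^bsub>Zp2 p\<^esub> b) [^]\<^bsub>Zp2 p\<^esub> y n)"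
      unfolding a b using gG by (simp only: q_pow Z2.int_pow_closed)
    also have "\<dots> = ?q (g [^]\<^bsub>Zp2 p\<^esub> (a * x n) \<otimes>\<^bsub>Zp2 p\<^esub> g [^]\<^bsub>Zp2 p\<^esub> (b * y n))"
      using gG by (simp add: Z2.int_pow_pow q_mult)
    also have "\<dots> = ?q (g [^]\<^bsub>Zp2 p\<^esub> (a * x n + b * y n))"
      using gG by (simp add: Z2.int_pow_mult)
    finally show ?thesis .
  qed
  have mem: "(x, y) \<in> H \<longleftrightarrow> int p ^ n dvd a * x n + b * y n"
    if xy: "x \<in> carrier (Zp p)" "y \<in> carrier (Zp p)" for x y
  proof -
    have "(x, y) \<in> H \<longleftrightarrow> g [^]\<^bsub>Zp2 p\<^esub> (a * x n + b * y n) \<in> H"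
      using decomp[OF xy] gG xy Z2.opensD[OF H] N.subset
      by (metis Z2.coset_join1 Z2.coset_join2 Z2.int_pow_closed carrier_Zp2 mem_Sigma_iff)
    then show ?thesis using Z2.cyclic_mod_pow_mem_iff[OF cyc H] n by simp
  qed
  have "H = line a b n" using mem N.subset by (auto simp: line_def carrier_Zp2)
  moreover have "primitive a b"
  proof (rule ccontr)
    assume "\<not> primitive a b"
    then have ab: "int p dvd a" "int p dvd b" by (auto simp: primitive_def)
    obtain x y where xy: "g = (x, y)" "x \<in> carrier (Zp p)" "y \<in> carrier (Zp p)"
      using gG by (auto simp: carrier_Zp2)
    let ?i = "a * x n + b * y n"
    have "?q g = ?q (g [^]\<^bsub>Zp2 p\<^esub> ?i)" using decomp xy by simp
    then have "g \<otimes>\<^bsub>Zp2 p\<^esub> inv\<^bsub>Zp2 p\<^esub> (g [^]\<^bsub>Zp2 p\<^esub> ?i) \<in> H"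
      using gG by (simp add: Z2.rcoset_eq_iff[OF Z2.opensD[OF H]])
    moreover have "g \<otimes>\<^bsub>Zp2 p\<^esub> inv\<^bsub>Zp2 p\<^esub> (g [^]\<^bsub>Zp2 p\<^esub> ?i) = g [^]\<^bsub>Zp2 p\<^esub> (1 - ?i)"
      using gG by (simp add: Z2.int_pow_diff)
    ultimately have "int p ^ n dvd 1 - ?i" using Z2.cyclic_mod_pow_mem_iff[OF cyc H] n by simp
    moreover have "int p dvd int p ^ n" using False by simp
    ultimately have "int p dvd 1 - ?i" by (rule dvd_trans[rotated])
    moreover have "int p dvd ?i" using ab by simp
    ultimately have "int p dvd 1" by (metis diff_add_cancel dvd_add)
    then show False using p_gt_1 by simp
  qed
  ultimately show ?thesis by blast
qed

section \<open>Paths in the tree\<close>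


lemma cyc_tree_iff:
  "T \<in> cyc_tree p \<longleftrightarrow> (\<exists>H g. H \<in> Z2.opens \<and> T = {H} \<and> Z2.cyclic_mod g H)"
proof -
  have "T \<in> cyc_tree p \<longleftrightarrow> (\<exists>H\<in>Z2.opens. T = {H} \<and> cyclic_group (Zp2 p Mod H))"
    by (auto simp: cyc_tree_def Z2.gset_classes_eq)
  then show ?thesis using Z2.cyclic_group_Mod_iff by blast
qed

lemma cyc_tree_cases:
  assumes "T \<in> cyc_tree p"
  obtains a b n where "primitive a b" "T = {line a b n}"
proof -
  obtain H g where H: "H \<in> Z2.opens" "T = {H}" "Z2.cyclic_mod g H" using assms by (auto simp: cyc_tree_iff)
  then obtain n where "Z2.index H = p ^ n" using Z2.index_power by blast
  then show thesis using ex_line_eq[OF H(1,3)] H(2) that by blast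
qed

lemma line_in_cyc_tree: "primitive a b \<Longrightarrow> {line a b n} \<in> cyc_tree p"
  using cyclic_line open_line by (auto simp: cyc_tree_iff)

lemma gset_size_line: "primitive a b \<Longrightarrow> gset_size (Zp2 p) {line a b n} = p ^ n"
  by (simp add: Z2.gset_size_eq open_line index_line)

definition child :: "vertex \<Rightarrow> vertex \<Rightarrow> bool" where
  "child U T \<longleftrightarrow> U \<in> cyc_tree p \<and> T \<in> cyc_tree p \<and> gset_le (Zp2 p) U T \<and>
    gset_size (Zp2 p) T = p * gset_size (Zp2 p) U"

lemma tree_edge_iff: "{U, T} \<in> tree_edges p \<longleftrightarrow> child U T \<or> child T U"
  by (auto simp: tree_edges_def child_def doubleton_eq_iff)

text \<open>
  The subgroup of a parent lies above a subgroup with cyclic quotient and is determined by its index.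
\<close>

lemma parent_unique:
  assumes "child U T" "child U' T"
  shows "U = U'"
proof -
  obtain H g where H: "H \<in> Z2.opens" "T = {H}" "Z2.cyclic_mod g H"
    using assms(1) by (auto simp: child_def cyc_tree_iff)
  obtain K K' where K: "K \<in> Z2.opens" "U = {K}" and K': "K' \<in> Z2.opens" "U' = {K'}"
    using assms by (auto simp: child_def cyc_tree_iff)
  have "K = K'"
    using assms H K K' p_pos
    by (intro Z2.cyclic_mod_unique[OF H(3,1)]) (auto simp: child_def Z2.gset_le_iff Z2.gset_size_eq)
  then show ?thesis using K K' by simp
qed

lemma child_line: "primitive a b \<Longrightarrow> child {line a b n} {line a b (Suc n)}"
  by (simp add: child_def line_in_cyc_tree gset_size_line Z2.gset_le_iff open_line line_Suc)

lemma tree_root_eq: "tree_root p = {carrier (Zp2 p)}"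
  by (simp add: tree_root_def Z2.gset_class_eq Z2.open_carrier)

lemma line_in_P1:
  assumes "primitive a b"
  shows "(\<lambda>n. {line a b n}) \<in> P1 p"
proof -
  have "line a b 0 = carrier (Zp2 p)" by (auto simp: line_def carrier_Zp2)
  moreover have "line a b (Suc (Suc n)) \<noteq> line a b n" for n
  proof
    assume "line a b (Suc (Suc n)) = line a b n"
    then have "p ^ Suc (Suc n) = p ^ n" using index_line[OF assms] by metis
    then have "Suc (Suc n) = n" using p_gt_1 power_inject_exp by blast
    then show False by simp
  qed
  ultimately show ?thesis
    using assms by (simp add: P1_def tree_root_eq tree_edge_iff child_line)
qed

lemma ex_path_through:
  assumes "T \<in> cyc_tree p"
  shows "\<exists>x\<in>P1 p. \<exists>n. x n = T"
proof -
  obtain a b n where "primitive a b" "T = {line a b n}" using assms by (rule cyc_tree_cases)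
  then show ?thesis by (intro bexI[of _ "\<lambda>n. {line a b n}"] exI[of _ n] line_in_P1) simp_all
qed

lemma P1_nonempty: "P1 p \<noteq> {}"
  using line_in_P1[of 1 0] p_gt_1 by (auto simp: primitive_def)

text \<open>
  A path starts by going up, and since parents are unique it could only go down by backtracking. Hence it
  goes up at every step.
\<close>

lemma P1_child:
  assumes x: "x \<in> P1 p"
  shows "child (x n) (x (Suc n)) \<and> gset_size (Zp2 p) (x n) = p ^ n"
proof (induction n)
  have edge: "child (x n) (x (Suc n)) \<or> child (x (Suc n)) (x n)" for n
    using x by (simp add: P1_def flip: tree_edge_iff)
  {
    case 0
    have "gset_size (Zp2 p) (x 0) = 1"
      using x by (simp add: P1_def tree_root_eq Z2.gset_size_eq Z2.open_carrier Z2.index_carrier)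
    then show ?case using edge[of 0] p_gt_1 by (auto simp: child_def)
  next
    case (Suc n)
    have "\<not> child (x (Suc (Suc n))) (x (Suc n))"
    proof
      assume "child (x (Suc (Suc n))) (x (Suc n))"
      then have "x (Suc (Suc n)) = x n" using Suc parent_unique by blast
      then show False using x by (simp add: P1_def)
    qed
    then have "child (x (Suc n)) (x (Suc (Suc n)))" using edge[of "Suc n"] by blast
    moreover have "gset_size (Zp2 p) (x (Suc n)) = p ^ Suc n" using Suc by (simp add: child_def)
    ultimately show ?case by blast
  }
qed

lemma P1_size: "x \<in> P1 p \<Longrightarrow> gset_size (Zp2 p) (x n) = p ^ n"
  using P1_child by blast

lemma P1_cyc_tree: "x \<in> P1 p \<Longrightarrow> x n \<in> cyc_tree p"
  using P1_child[of x n] by (simp add: child_def)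

lemma P1_level_unique:
  assumes "x \<in> P1 p" "y \<in> P1 p" "x i = y j"
  shows "i = j"
proof -
  have "p ^ i = p ^ j" using assms P1_size by metis
  then show ?thesis using p_gt_1 by simp
qed

lemma P1_agree_below:
  assumes "x \<in> P1 p" "y \<in> P1 p" "x n = y n" "i \<le> n"
  shows "x i = y i"
  using assms(4,3)
proof (induction rule: inc_induct)
  case (step m)
  then have "x (Suc m) = y (Suc m)" by simp
  then show ?case using P1_child[OF assms(1), of m] P1_child[OF assms(2), of m] parent_unique by metis
qed

lemma P1_edge_eq_iff:
  assumes "x \<in> P1 p" "y \<in> P1 p"
  shows "{x i, x (Suc i)} = {y j, y (Suc j)} \<longleftrightarrow> i = j \<and> x (Suc i) = y (Suc i)"
proof
  assume "{x i, x (Suc i)} = {y j, y (Suc j)}"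
  then consider "x i = y j" "x (Suc i) = y (Suc j)" | "x i = y (Suc j)" "x (Suc i) = y j"
    by (auto simp: doubleton_eq_iff)
  then show "i = j \<and> x (Suc i) = y (Suc i)"
  proof cases
    case 1
    then show ?thesis using P1_level_unique[OF assms, of i j] by simp
  next
    case 2
    then show ?thesis using P1_level_unique[OF assms, of i "Suc j"] P1_level_unique[OF assms, of "Suc i" j] by simp
  qed
next
  assume "i = j \<and> x (Suc i) = y (Suc i)"
  then have ij: "i = j" and eq: "x (Suc i) = y (Suc i)" by (rule conjunct1, rule conjunct2)
  have "x i = y i" using P1_agree_below[OF assms eq, of i] by simp
  then show "{x i, x (Suc i)} = {y j, y (Suc j)}" using eq unfolding ij[symmetric] by simp
qed

text \<open>
  Parents are unique, so two distinct paths share an initial segment and no vertex after it. Sharing \<open>n\<close> edges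
  means sharing the vertices of the levels \<open>0, \<dots>, n\<close>.
\<close>

lemma P1_dist_eq:
  assumes x: "x \<in> P1 p" and y: "y \<in> P1 p" and "x \<noteq> y"
  obtains n where "P1_dist p x y = 1 / real p ^ n" "\<And>i. x i = y i \<longleftrightarrow> i \<le> n"
proof -
  obtain k where k: "x k \<noteq> y k" using assms(3) by blast
  define m where "m = (LEAST k. x k \<noteq> y k)"
  have m: "x m \<noteq> y m" unfolding m_def using k by (rule LeastI)
  have below: "x i = y i" if "i < m" for i using not_less_Least[of i "\<lambda>k. x k \<noteq> y k"] that by (auto simp: m_def)
  have "x 0 = y 0" using x y by (simp add: P1_def)
  then obtain n where n: "m = Suc n" using m by (cases m) auto
  have agree: "x i = y i \<longleftrightarrow> i \<le> n" for i
    using below[of i] m P1_agree_below[OF x y, of i m] n by (cases "i < m") auto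
  have "range (\<lambda>n. {x n, x (Suc n)}) \<inter> range (\<lambda>n. {y n, y (Suc n)}) = (\<lambda>i. {x i, x (Suc i)}) ` {..<n}"
  proof (intro equalityI subsetI)
    fix e assume "e \<in> range (\<lambda>n. {x n, x (Suc n)}) \<inter> range (\<lambda>n. {y n, y (Suc n)})"
    then obtain i j where e: "e = {x i, x (Suc i)}" "e = {y j, y (Suc j)}" by (elim IntE rangeE)
    then have "{x i, x (Suc i)} = {y j, y (Suc j)}" by simp
    then have "x (Suc i) = y (Suc i)" unfolding P1_edge_eq_iff[OF x y] by (rule conjunct2)
    then have "i < n" using agree[of "Suc i"] by simp
    then show "e \<in> (\<lambda>i. {x i, x (Suc i)}) ` {..<n}" using e(1) by blast
  next
    fix e assume "e \<in> (\<lambda>i. {x i, x (Suc i)}) ` {..<n}"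
    then obtain i where "e = {x i, x (Suc i)}" "i < n" by auto
    moreover from this have "e = {y i, y (Suc i)}" using agree[of i] agree[of "Suc i"] by simp
    ultimately show "e \<in> range (\<lambda>n. {x n, x (Suc n)}) \<inter> range (\<lambda>n. {y n, y (Suc n)})" by blast
  qed
  moreover have "inj_on (\<lambda>i. {x i, x (Suc i)}) {..<n}"
    by (rule inj_onI) (simp add: P1_edge_eq_iff[OF x x])
  ultimately have "P1_dist p x y = 1 / real p ^ n" using assms(3) by (simp add: P1_dist_def card_image)
  then show thesis using agree by (rule that)
qed


section \<open>Restriction of Witt vectors to a path\<close>

text \<open>
  The vertices on a path come from a descending chain of subgroups with cyclic quotients, so the chain
  contains all open subgroups above each of its members.
\<close>

lemma P1_chain:
  assumes x: "x \<in> P1 p"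
  obtains H where "\<And>n. x n = {H n}" "\<And>n. H n \<in> Z2.opens" "\<And>n. Z2.index (H n) = p ^ n"
    "\<And>n. {K \<in> Z2.opens. H n \<subseteq> K} = H ` {..n}"
proof -
  define H where "H n = the_elem (x n)" for n
  have H: "x n = {H n}" "H n \<in> Z2.opens" "\<exists>g. Z2.cyclic_mod g (H n)" for n
  proof -
    obtain K g where K: "K \<in> Z2.opens" "x n = {K}" "Z2.cyclic_mod g K"
      using P1_cyc_tree[OF x, of n] unfolding cyc_tree_iff by blast
    then have HK: "H n = K" by (simp add: H_def)
    show "x n = {H n}" unfolding HK by (rule K(2))
    show "H n \<in> Z2.opens" unfolding HK by (rule K(1))
    show "\<exists>g. Z2.cyclic_mod g (H n)" unfolding HK using K(3) by (rule exI)
  qed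
  have ind: "Z2.index (H n) = p ^ n" for n
    using P1_size[OF x, of n] H by (simp add: Z2.gset_size_eq)
  have desc: "H (Suc n) \<subseteq> H n" for n
    using P1_child[OF x, of n] H by (simp add: child_def Z2.gset_le_iff)
  have "{K \<in> Z2.opens. H n \<subseteq> K} = H ` {..n}" for n
  proof -
    obtain g where "Z2.cyclic_mod g (H n)" using H by blast
    then show ?thesis using Z2.open_supersets_of_cyclic_chain[of g H n] H(2) ind desc by simp
  qed
  then show thesis using H ind by (intro that) auto
qed

lemma witt_poly_path:
  assumes "x \<in> P1 p"
  shows "witt_poly (Zp2 p) (Zp2_top p) (x n) c = (\<Sum>i\<le>n. of_nat (p ^ i) * c (x i) ^ (p ^ n div p ^ i))"
proof -
  obtain H where H: "\<And>n. x n = {H n}" "\<And>n. H n \<in> Z2.opens" "\<And>n. Z2.index (H n) = p ^ n"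
    "\<And>n. {K \<in> Z2.opens. H n \<subseteq> K} = H ` {..n}" using P1_chain[OF assms] by blast
  show ?thesis
    using Z2.ghost_chain[of H n "\<lambda>K. c {K}"] H by (simp add: Z2.witt_poly_eq_ghost)
qed

lemma witt_poly_W_index:
  "witt_poly (Zp p) (Zp_top p) (W_index p n) c = (\<Sum>i\<le>n. of_nat (p ^ i) * c (W_index p i) ^ (p ^ n div p ^ i))"
  using Z.ghost_chain[of Zp_filt n "\<lambda>K. c {K}"] Zp_filt_supersets index_Zp_filt
  by (simp add: Z.witt_poly_eq_ghost open_Zp_filt W_index_eq)

abbreviation FZp :: "padic set set set" where "FZp \<equiv> gset_classes (Zp p) (Zp_top p)"

lemma W_vec_index [simp]: "W_vec p w (W_index p n) = w n"
  by (simp add: W_vec_def gset_classes_Zp)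

lemma W_vec_closed [simp]: "W_vec p w \<in> carrier (W_Zp p)"
  by (simp add: W_vec_def W_Zp_def Z.witt_ring_simps)

lemma W_eqI:
  assumes "v \<in> carrier (W_Zp p)" "w \<in> carrier (W_Zp p)" "\<And>n. v (W_index p n) = w (W_index p n)"
  shows "v = w"
  using assms by (intro PiE_ext[of v FZp _ w]) (auto simp: W_Zp_def Z.witt_ring_simps gset_classes_Zp)

lemma cring_W_Zp: "cring (W_Zp p :: (padic set set \<Rightarrow> 'a::comm_ring_1) ring)"
  unfolding W_Zp_def by (rule Z.cring_witt_ring)

lemma cring_W_Zp2: "cring (witt_ring (Zp2 p) (Zp2_top p) :: (vertex \<Rightarrow> 'a::comm_ring_1) ring)"
  by (rule Z2.cring_witt_ring)

lemma path_in_FZp2: "x \<in> P1 p \<Longrightarrow> x n \<in> FZp2 p"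
  using P1_cyc_tree[of x n] by (simp add: cyc_tree_def)

lemma
  fixes a b :: "vertex \<Rightarrow> 'a::comm_ring_1"
  assumes x: "x \<in> P1 p"
  shows W_vec_path_add: "W_vec p (\<lambda>n. (a \<oplus>\<^bsub>witt_ring (Zp2 p) (Zp2_top p)\<^esub> b) (x n))
      = W_vec p (\<lambda>n. a (x n)) \<oplus>\<^bsub>W_Zp p\<^esub> W_vec p (\<lambda>n. b (x n))" (is ?add)
    and W_vec_path_mult: "W_vec p (\<lambda>n. (a \<otimes>\<^bsub>witt_ring (Zp2 p) (Zp2_top p)\<^esub> b) (x n))
      = W_vec p (\<lambda>n. a (x n)) \<otimes>\<^bsub>W_Zp p\<^esub> W_vec p (\<lambda>n. b (x n))" (is ?mult)
    and W_vec_path_one: "W_vec p (\<lambda>n. \<one>\<^bsub>witt_ring (Zp2 p) (Zp2_top p)\<^esub> (x n))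
      = (\<one>\<^bsub>W_Zp p\<^esub> :: padic set set \<Rightarrow> 'a)" (is ?one)
proof -
  interpret W: cring "W_Zp p :: (padic set set \<Rightarrow> 'a) ring" by (rule cring_W_Zp)
  \<comment> \<open>the index \<open>n\<close> of a p-typical component goes to the vertex at level \<open>n\<close>\<close>
  let ?\<theta> = "\<lambda>V. x (inv_into UNIV (W_index p) V)"
  have \<theta>: "?\<theta> V \<in> FZp2 p" if "V \<in> FZp" for V
    using path_in_FZp2[OF x] by blast
  have wp: "witt_poly (Zp p) (Zp_top p) V (\<lambda>V. c (?\<theta> V)) = witt_poly (Zp2 p) (Zp2_top p) (?\<theta> V) c"
    if "V \<in> FZp" for V and c :: "vertex \<Rightarrow> 'a int_mpoly"
    using that by (auto simp: gset_classes_Zp witt_poly_W_index witt_poly_path[OF x])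
  note restrict = witt_ring_restrict[of "Zp2 p" "Zp2_top p" p "Zp p" "Zp_top p" p ?\<theta>,
      OF pro_p_Zp2 pro_p_Zp \<theta> wp]
  have idx: "W_index p n \<in> FZp" for n by (simp add: gset_classes_Zp)
  have vec: "f (?\<theta> U) = W_vec p (\<lambda>n. f (x n)) U" if "U \<in> FZp" for f :: "vertex \<Rightarrow> 'a" and U
    using that by (simp add: W_vec_def)
  show ?add
  proof (rule W_eqI)
    fix n
    have "witt_add (Zp2 p) (Zp2_top p) a b (?\<theta> (W_index p n))
        = witt_add (Zp p) (Zp_top p) (\<lambda>V. a (?\<theta> V)) (\<lambda>V. b (?\<theta> V)) (W_index p n)"
      by (rule restrict(1)) (auto simp: idx)
    also have "\<dots> = witt_add (Zp p) (Zp_top p) (W_vec p (\<lambda>n. a (x n))) (W_vec p (\<lambda>n. b (x n))) (W_index p n)"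
      by (rule Z.witt_add_cong[OF idx]) (rule vec, assumption)+
    finally show "W_vec p (\<lambda>n. (a \<oplus>\<^bsub>witt_ring (Zp2 p) (Zp2_top p)\<^esub> b) (x n)) (W_index p n)
        = (W_vec p (\<lambda>n. a (x n)) \<oplus>\<^bsub>W_Zp p\<^esub> W_vec p (\<lambda>n. b (x n))) (W_index p n)"
      by (simp add: Z2.witt_ring_simps Z.witt_ring_simps W_Zp_def path_in_FZp2[OF x] idx)
  qed (rule W_vec_closed W.add.m_closed)+
  show ?mult
  proof (rule W_eqI)
    fix n
    have "witt_mult (Zp2 p) (Zp2_top p) a b (?\<theta> (W_index p n))
        = witt_mult (Zp p) (Zp_top p) (\<lambda>V. a (?\<theta> V)) (\<lambda>V. b (?\<theta> V)) (W_index p n)"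
      by (rule restrict(2)) (auto simp: idx)
    also have "\<dots> = witt_mult (Zp p) (Zp_top p) (W_vec p (\<lambda>n. a (x n))) (W_vec p (\<lambda>n. b (x n))) (W_index p n)"
      by (rule Z.witt_mult_cong[OF idx]) (rule vec, assumption)+
    finally show "W_vec p (\<lambda>n. (a \<otimes>\<^bsub>witt_ring (Zp2 p) (Zp2_top p)\<^esub> b) (x n)) (W_index p n)
        = (W_vec p (\<lambda>n. a (x n)) \<otimes>\<^bsub>W_Zp p\<^esub> W_vec p (\<lambda>n. b (x n))) (W_index p n)"
      by (simp add: Z2.witt_ring_simps Z.witt_ring_simps W_Zp_def path_in_FZp2[OF x] idx)
  qed (rule W_vec_closed W.m_closed)+
  show ?one
  proof (rule W_eqI)
    fix n
    have "x n = {carrier (Zp2 p)} \<longleftrightarrow> n = 0"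
      using P1_level_unique[OF x x, of n 0] x by (auto simp: P1_def tree_root_eq)
    moreover have "carrier (Zp p) = Zp_filt 0" using Zp_bounds[of _ 0] by (fastforce simp: Zp_filt_def)
    then have "W_index p n = {carrier (Zp p)} \<longleftrightarrow> n = 0"
      using inj_eq[OF inj_W_index, of n 0] by (simp add: W_index_eq[of 0])
    ultimately show "W_vec p (\<lambda>n. \<one>\<^bsub>witt_ring (Zp2 p) (Zp2_top p)\<^esub> (x n)) (W_index p n)
        = (\<one>\<^bsub>W_Zp p\<^esub> :: padic set set \<Rightarrow> 'a) (W_index p n)"
      by (simp add: Z2.witt_ring_simps Z.witt_ring_simps W_Zp_def path_in_FZp2[OF x] idx
          Z.witt_one_def Z2.witt_one_def)
  qed (rule W_vec_closed W.one_closed)+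
qed


section \<open>The norm on Witt vectors\<close>

lemma W_zero_index [simp]: "\<zero>\<^bsub>W_Zp p\<^esub> (W_index p n) = 0"
  by (simp add: W_Zp_def Z.witt_ring_simps gset_classes_Zp)

lemma one_div_p_power_le_iff: "1 / real p ^ m \<le> 1 / real p ^ n \<longleftrightarrow> n \<le> m"
  using p_gt_1 by (simp add: field_simps)

lemma W_norm_le_iff:
  fixes v :: "padic set set \<Rightarrow> 'a::comm_ring_1"
  assumes v: "v \<in> carrier (W_Zp p)"
  shows "W_norm p v \<le> 1 / real p ^ m \<longleftrightarrow> (\<forall>i<m. v (W_index p i) = 0)"
proof (cases "v = \<zero>\<^bsub>W_Zp p\<^esub>")
  case True
  then show ?thesis by (simp add: W_norm_def)
next
  case False
  interpret W: cring "W_Zp p :: (padic set set \<Rightarrow> 'a) ring" by (rule cring_W_Zp)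
  have ex: "\<exists>n. v (W_index p n) \<noteq> 0" using False W_eqI[OF v W.zero_closed] by auto
  let ?L = "LEAST n. v (W_index p n) \<noteq> 0"
  have "W_norm p v \<le> 1 / real p ^ m \<longleftrightarrow> m \<le> ?L"
    using False by (simp add: W_norm_def one_div_p_power_le_iff)
  also have "\<dots> \<longleftrightarrow> (\<forall>i<m. v (W_index p i) = 0)"
    using LeastI_ex[OF ex] not_less_Least[of _ "\<lambda>n. v (W_index p n) \<noteq> 0"]
    by (meson le_less_linear less_le_trans not_le)
  finally show ?thesis .
qed

text \<open>
  The open subgroups above the multiples of \<open>p^i\<close> are the multiples of \<open>p^j\<close> with \<open>j \<le> i\<close>, so this is the
  locality of sums.
\<close>

lemma W_add_cong_below:
  fixes v w :: "padic set set \<Rightarrow> 'a::comm_ring_1"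
  assumes "\<And>j. j \<le> i \<Longrightarrow> v (W_index p j) = v' (W_index p j)" "\<And>j. j \<le> i \<Longrightarrow> w (W_index p j) = w' (W_index p j)"
  shows "(v \<oplus>\<^bsub>W_Zp p\<^esub> w) (W_index p i) = (v' \<oplus>\<^bsub>W_Zp p\<^esub> w') (W_index p i)"
proof -
  have "f {K} = g {K}" if K: "K \<in> Z.opens" "Zp_filt i \<subseteq> K" and fg: "\<And>j. j \<le> i \<Longrightarrow> f (W_index p j) = g (W_index p j)"
    for K and f g :: "padic set set \<Rightarrow> 'a"
  proof -
    obtain j where "j \<le> i" "K = Zp_filt j" using K Zp_filt_supersets[of i] by blast
    then show ?thesis using fg by (simp add: W_index_eq)
  qed
  then show ?thesis unfolding W_Zp_def W_index_eq[of i]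
    using assms by (intro Z.witt_ring_add_cong_local open_Zp_filt) auto
qed

text \<open>
  With \<open>d = v - w\<close>, locality applied to \<open>d + w\<close> compared with \<open>0 + w\<close> gives one direction, and applied to
  \<open>v - w\<close> compared with \<open>w - w\<close> the other.
\<close>

lemma W_norm_diff_le_iff:
  fixes v w :: "padic set set \<Rightarrow> 'a::comm_ring_1"
  assumes v: "v \<in> carrier (W_Zp p)" and w: "w \<in> carrier (W_Zp p)"
  shows "W_norm p (v \<ominus>\<^bsub>W_Zp p\<^esub> w) \<le> 1 / real p ^ m \<longleftrightarrow> (\<forall>i<m. v (W_index p i) = w (W_index p i))"
proof -
  interpret W: cring "W_Zp p :: (padic set set \<Rightarrow> 'a) ring" by (rule cring_W_Zp)
  let ?W = "W_Zp p :: (padic set set \<Rightarrow> 'a) ring"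
  let ?d = "v \<ominus>\<^bsub>?W\<^esub> w"
  have dw: "?d \<oplus>\<^bsub>?W\<^esub> w = v" using v w by (simp add: a_minus_def W.a_assoc W.l_neg)
  have "?d (W_index p i) = 0" if "\<And>j. j \<le> i \<Longrightarrow> v (W_index p j) = w (W_index p j)" for i
  proof -
    have "(v \<oplus>\<^bsub>?W\<^esub> \<ominus>\<^bsub>?W\<^esub> w) (W_index p i) = (w \<oplus>\<^bsub>?W\<^esub> \<ominus>\<^bsub>?W\<^esub> w) (W_index p i)"
      by (rule W_add_cong_below) (use that in auto)
    then show ?thesis using w by (simp add: a_minus_def W.r_neg)
  qed
  moreover have "v (W_index p i) = w (W_index p i)" if "\<And>j. j \<le> i \<Longrightarrow> ?d (W_index p j) = 0" for i
  proof -
    have "(?d \<oplus>\<^bsub>?W\<^esub> w) (W_index p i) = (\<zero>\<^bsub>?W\<^esub> \<oplus>\<^bsub>?W\<^esub> w) (W_index p i)"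
      by (rule W_add_cong_below) (use that in auto)
    then show ?thesis using w by (simp add: dw)
  qed
  ultimately show ?thesis
    using v w by (subst W_norm_le_iff) (auto intro: less_le_trans le_less_trans)
qed


section \<open>The isomorphism\<close>

text \<open>
  The map \<open>Phi\<close> before passing to the quotient.
\<close>

definition path_map :: "(vertex \<Rightarrow> 'k::field) \<Rightarrow> (nat \<Rightarrow> vertex) \<Rightarrow> padic set set \<Rightarrow> 'k" where
  "path_map a = (\<lambda>x\<in>P1 p. W_vec p (\<lambda>n. a (x n)))"

abbreviation W2 :: "(vertex \<Rightarrow> 'k::field) ring" where
  "W2 \<equiv> witt_ring (Zp2 p) (Zp2_top p)"

abbreviation LipR :: "((nat \<Rightarrow> vertex) \<Rightarrow> padic set set \<Rightarrow> 'k::field) ring" where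
  "LipR \<equiv> Lip p (1 / real p)"

text \<open>
  Paths at distance \<open>p^-n\<close> share the vertices of the levels \<open>0, \<dots>, n\<close>, and the bound \<open>p^-(n+1)\<close> asks for
  agreement of exactly the components \<open>0, \<dots>, n\<close>.
\<close>

lemma Lip_bound_iff:
  fixes v w :: "padic set set \<Rightarrow> 'k::field"
  assumes x: "x \<in> P1 p" and y: "y \<in> P1 p" and "v \<in> carrier (W_Zp p)" "w \<in> carrier (W_Zp p)"
    and eq: "x = y \<Longrightarrow> v = w"
  shows "W_norm p (v \<ominus>\<^bsub>W_Zp p\<^esub> w) \<le> 1 / real p * P1_dist p x y
    \<longleftrightarrow> (\<forall>i. x i = y i \<longrightarrow> v (W_index p i) = w (W_index p i))"
proof (cases "x = y")
  case True
  interpret W: cring "W_Zp p :: (padic set set \<Rightarrow> 'k) ring" by (rule cring_W_Zp)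
  have "v \<ominus>\<^bsub>W_Zp p\<^esub> w = \<zero>\<^bsub>W_Zp p\<^esub>" using eq[OF True] assms(4) by (simp add: a_minus_def W.r_neg)
  then show ?thesis using True eq by (simp add: W_norm_def P1_dist_def)
next
  case False
  obtain n where n: "P1_dist p x y = 1 / real p ^ n" "\<And>i. x i = y i \<longleftrightarrow> i \<le> n"
    using P1_dist_eq[OF x y False] by blast
  have "1 / real p * P1_dist p x y = 1 / real p ^ Suc n" using n by simp
  then show ?thesis using assms n W_norm_diff_le_iff[of v w "Suc n"] by (simp add: less_Suc_eq_le)
qed

text \<open>
  The values of a function in this ring have an \<open>i\<close>-th component that depends only on the vertex at level
  \<open>i\<close>. Such functions are families of components indexed by the vertices of the tree.
\<close>

lemma carrier_Lip:
  "f \<in> carrier (LipR :: ((nat \<Rightarrow> vertex) \<Rightarrow> padic set set \<Rightarrow> 'k::field) ring) \<longleftrightarrow>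
    f \<in> P1 p \<rightarrow>\<^sub>E carrier (W_Zp p) \<and>
    (\<forall>x\<in>P1 p. \<forall>y\<in>P1 p. \<forall>i. x i = y i \<longrightarrow> f x (W_index p i) = f y (W_index p i))"
proof (cases "f \<in> P1 p \<rightarrow>\<^sub>E carrier (W_Zp p)")
  case True
  have "(\<forall>x\<in>P1 p. \<forall>y\<in>P1 p. W_norm p (f x \<ominus>\<^bsub>W_Zp p\<^esub> f y) \<le> 1 / real p * P1_dist p x y)
      \<longleftrightarrow> (\<forall>x\<in>P1 p. \<forall>y\<in>P1 p. \<forall>i. x i = y i \<longrightarrow> f x (W_index p i) = f y (W_index p i))"
    by (intro ball_cong refl Lip_bound_iff PiE_mem[OF True]) simp_all
  then show ?thesis using True by (simp only: Lip_def partial_object.select_convs mem_Collect_eq)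
qed (simp add: Lip_def)

lemma path_map_ring_hom: "path_map \<in> ring_hom W2 (LipR :: ((nat \<Rightarrow> vertex) \<Rightarrow> padic set set \<Rightarrow> 'k::field) ring)"
proof (rule ring_hom_memI)
  fix a :: "vertex \<Rightarrow> 'k"
  show "path_map a \<in> carrier LipR" by (auto simp: carrier_Lip path_map_def)
  fix b :: "vertex \<Rightarrow> 'k"
  show "path_map (a \<otimes>\<^bsub>W2\<^esub> b) = path_map a \<otimes>\<^bsub>LipR\<^esub> path_map b"
    by (auto simp: path_map_def Lip_def W_vec_path_mult)
  show "path_map (a \<oplus>\<^bsub>W2\<^esub> b) = path_map a \<oplus>\<^bsub>LipR\<^esub> path_map b"
    by (auto simp: path_map_def Lip_def W_vec_path_add)
next
  show "path_map \<one>\<^bsub>W2\<^esub> = (\<one>\<^bsub>LipR\<^esub> :: (nat \<Rightarrow> vertex) \<Rightarrow> padic set set \<Rightarrow> 'k)"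
    by (auto simp: path_map_def Lip_def W_vec_path_one)
qed

text \<open>
  The component of a preimage of \<open>f\<close> at a vertex is read off from the value of \<open>f\<close> at any path through
  that vertex.
\<close>

lemma path_map_surj:
  "path_map ` carrier W2 = carrier (LipR :: ((nat \<Rightarrow> vertex) \<Rightarrow> padic set set \<Rightarrow> 'k::field) ring)"
proof
  show "path_map ` carrier W2 \<subseteq> carrier (LipR :: ((nat \<Rightarrow> vertex) \<Rightarrow> padic set set \<Rightarrow> 'k) ring)"
    using ring_hom_closed[OF path_map_ring_hom] by blast
  show "carrier LipR \<subseteq> path_map ` carrier (W2 :: (vertex \<Rightarrow> 'k) ring)"
  proof
    fix f :: "(nat \<Rightarrow> vertex) \<Rightarrow> padic set set \<Rightarrow> 'k"
    assume f: "f \<in> carrier LipR"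
    define path where "path T = (SOME x. x \<in> P1 p \<and> (\<exists>n. x n = T))" for T
    define level where "level T = (SOME n. path T n = T)" for T
    define a where "a = (\<lambda>T\<in>FZp2 p. f (path T) (W_index p (level T)))"
    have "path_map a = f"
    proof (rule PiE_ext[of _ "P1 p"])
      show "path_map a \<in> P1 p \<rightarrow>\<^sub>E carrier (W_Zp p)" by (simp add: path_map_def)
      show f_in: "f \<in> P1 p \<rightarrow>\<^sub>E carrier (W_Zp p)" using f by (simp add: carrier_Lip)
      fix x assume x: "x \<in> P1 p"
      have "a (x n) = f x (W_index p n)" for n
      proof -
        have path: "path (x n) \<in> P1 p \<and> (\<exists>m. path (x n) m = x n)"
          unfolding path_def by (rule someI[of _ x]) (use x in blast)
        have eq: "path (x n) (level (x n)) = x n"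
          unfolding level_def by (rule someI_ex[of "\<lambda>m. path (x n) m = x n"]) (rule conjunct2[OF path])
        then have level: "level (x n) = n"
          using P1_level_unique[of "path (x n)" x "level (x n)" n] path x by simp
        have "f (path (x n)) (W_index p n) = f x (W_index p n)"
          by (rule f[unfolded carrier_Lip, THEN conjunct2, rule_format]) (use path x eq level in simp_all)
        then show ?thesis using path_in_FZp2[OF x, of n] level by (simp add: a_def)
      qed
      then show "path_map a x = f x"
        using x f_in by (intro W_eqI) (auto simp: path_map_def)
    qed
    moreover have "a \<in> carrier W2" by (simp add: a_def Z2.witt_ring_simps)
    ultimately show "f \<in> path_map ` carrier W2" by blast
  qed
qed

lemma path_map_eq_zero_iff:
  "path_map a = (\<zero>\<^bsub>LipR\<^esub> :: (nat \<Rightarrow> vertex) \<Rightarrow> padic set set \<Rightarrow> 'k::field) \<longleftrightarrow> (\<forall>T\<in>cyc_tree p. a T = 0)"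
proof
  assume eq: "path_map a = (\<zero>\<^bsub>LipR\<^esub> :: (nat \<Rightarrow> vertex) \<Rightarrow> padic set set \<Rightarrow> 'k)"
  show "\<forall>T\<in>cyc_tree p. a T = 0"
  proof
    fix T assume "T \<in> cyc_tree p"
    then obtain x n where x: "x \<in> P1 p" "x n = T" using ex_path_through by blast
    then have "W_vec p (\<lambda>n. a (x n)) (W_index p n) = \<zero>\<^bsub>W_Zp p\<^esub> (W_index p n)"
      using fun_cong[OF eq, of x] by (simp add: path_map_def Lip_def)
    then show "a T = 0" using x by simp
  qed
next
  assume a: "\<forall>T\<in>cyc_tree p. a T = 0"
  interpret W: cring "W_Zp p :: (padic set set \<Rightarrow> 'k) ring" by (rule cring_W_Zp)
  have "W_vec p (\<lambda>n. a (x n)) = \<zero>\<^bsub>W_Zp p\<^esub>" if "x \<in> P1 p" for x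
    using a P1_cyc_tree[OF that] by (intro W_eqI) auto
  then show "path_map a = (\<zero>\<^bsub>LipR\<^esub> :: (nat \<Rightarrow> vertex) \<Rightarrow> padic set set \<Rightarrow> 'k)"
    by (auto simp: path_map_def Lip_def)
qed

text \<open>
  That the Lipschitz functions form a ring follows from their being the image of one.
\<close>

lemma path_map_ring_hom_ring:
  "ring_hom_ring W2 (LipR :: ((nat \<Rightarrow> vertex) \<Rightarrow> padic set set \<Rightarrow> 'k::field) ring) path_map"
proof -
  interpret W2: cring "W2 :: (vertex \<Rightarrow> 'k) ring" by (rule cring_W_Zp2)
  have zero: "path_map \<zero>\<^bsub>W2\<^esub> = (\<zero>\<^bsub>LipR\<^esub> :: (nat \<Rightarrow> vertex) \<Rightarrow> padic set set \<Rightarrow> 'k)"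
    by (auto simp: path_map_eq_zero_iff Z2.witt_ring_simps cyc_tree_def)
  have "ring ((LipR :: ((nat \<Rightarrow> vertex) \<Rightarrow> padic set set \<Rightarrow> 'k) ring)
      \<lparr>carrier := path_map ` carrier W2, zero := path_map \<zero>\<^bsub>W2\<^esub>\<rparr>)"
    by (rule W2.ring_hom_imp_img_ring[OF path_map_ring_hom])
  then have "ring (LipR :: ((nat \<Rightarrow> vertex) \<Rightarrow> padic set set \<Rightarrow> 'k) ring)"
    by (simp add: path_map_surj zero)
  then show ?thesis using W2.ring_axioms path_map_ring_hom by (intro ring_hom_ringI2)
qed

lemma J_ideal_eq_kernel:
  "J_ideal p = a_kernel W2 (LipR :: ((nat \<Rightarrow> vertex) \<Rightarrow> padic set set \<Rightarrow> 'k::field) ring) path_map"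
  by (simp add: J_ideal_def a_kernel_def' path_map_eq_zero_iff)

text \<open>
  An element \<open>j + a\<close> of a coset of the kernel has the same image under \<open>path_map\<close> as \<open>a\<close>, hence the same
  components at all vertices.
\<close>

lemma coset_properties:
  fixes C :: "(vertex \<Rightarrow> 'k::field) set"
  assumes C: "C \<in> carrier (R_ring p)"
  shows "\<exists>a\<in>C. (\<forall>c\<in>C. path_map c = path_map a) \<and> (\<forall>T\<in>cyc_tree p. coord C T = a T)
    \<and> (C = \<zero>\<^bsub>R_ring p\<^esub> \<longleftrightarrow> (\<forall>T\<in>cyc_tree p. a T = 0))"
proof -
  interpret h: ring_hom_ring W2 "LipR :: ((nat \<Rightarrow> vertex) \<Rightarrow> padic set set \<Rightarrow> 'k) ring" path_map
    by (rule path_map_ring_hom_ring)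
  interpret J: ideal "J_ideal p" "W2 :: (vertex \<Rightarrow> 'k) ring"
    unfolding J_ideal_eq_kernel by (rule h.kernel_is_ideal)
  obtain a where a: "a \<in> carrier W2" "C = J_ideal p +>\<^bsub>W2\<^esub> a"
    using C by (auto simp: R_ring_def FactRing_def A_RCOSETS_def')
  have aC: "a \<in> C" unfolding a(2) using a(1) by (rule J.a_rcos_self)
  have pm: "path_map c = path_map a" if c: "c \<in> C" for c
  proof -
    obtain j where j: "j \<in> J_ideal p" "c = j \<oplus>\<^bsub>W2\<^esub> a"
      using c unfolding a(2) by (auto simp: a_r_coset_def')
    have "j \<in> carrier W2" using j(1) by (rule J.a_Hcarr)
    moreover have "path_map j = \<zero>\<^bsub>LipR\<^esub>"
      using j(1) unfolding J_ideal_eq_kernel by (rule h.kernel_zero)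
    ultimately show ?thesis using j(2) a(1) by (simp only: h.hom_add h.S.l_zero h.hom_closed)
  qed
  have eq: "c T = a T" if "c \<in> C" "T \<in> cyc_tree p" for c T
  proof -
    obtain x n where x: "x \<in> P1 p" "x n = T" using ex_path_through \<open>T \<in> cyc_tree p\<close> by blast
    have "path_map c x (W_index p n) = path_map a x (W_index p n)" using pm[OF that(1)] by simp
    then show ?thesis using x by (simp add: path_map_def)
  qed
  have "coord C T = a T" if T: "T \<in> cyc_tree p" for T
  proof -
    have "(\<lambda>c. c T) ` C = (\<lambda>_. a T) ` C" by (rule image_cong[OF refl eq[OF _ T]])
    then have "(\<lambda>c. c T) ` C = {a T}" using aC by (simp add: image_constant)
    then show ?thesis by (simp add: coord_def)
  qed
  moreover have "C = \<zero>\<^bsub>R_ring p\<^esub> \<longleftrightarrow> (\<forall>T\<in>cyc_tree p. a T = 0)"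
  proof -
    have "C = J_ideal p \<longleftrightarrow> a \<in> J_ideal p"
      using aC h.R.a_coset_join2[OF a(1) J.a_subgroup] unfolding a(2) by blast
    moreover have "a \<in> J_ideal p \<longleftrightarrow> (\<forall>T\<in>cyc_tree p. a T = 0)"
      using a(1) unfolding J_ideal_def by blast
    moreover have "\<zero>\<^bsub>R_ring p\<^esub> = (J_ideal p :: (vertex \<Rightarrow> 'k) set)"
      unfolding R_ring_def FactRing_def by simp
    ultimately show ?thesis by simp
  qed
  ultimately show ?thesis using aC pm by (intro bexI[of _ a] conjI ballI)
qed

lemma Phi_eq_path_map:
  assumes "\<forall>T\<in>cyc_tree p. coord C T = a T"
  shows "Phi p C = path_map a"
  unfolding Phi_def path_map_def
  by (intro restrict_ext arg_cong[of _ _ "W_vec p"] ext) (simp add: assms P1_cyc_tree)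

theorem Phi_ring_iso:
  "Phi p \<in> ring_iso (R_ring p) (LipR :: ((nat \<Rightarrow> vertex) \<Rightarrow> padic set set \<Rightarrow> 'k::field) ring)"
proof -
  interpret h: ring_hom_ring W2 "LipR :: ((nat \<Rightarrow> vertex) \<Rightarrow> padic set set \<Rightarrow> 'k) ring" path_map
    by (rule path_map_ring_hom_ring)
  have R: "R_ring p = W2 Quot a_kernel W2 (LipR :: ((nat \<Rightarrow> vertex) \<Rightarrow> padic set set \<Rightarrow> 'k) ring) path_map"
    by (simp add: R_ring_def J_ideal_eq_kernel)
  interpret R: ring "R_ring p :: (vertex \<Rightarrow> 'k) set ring"
    unfolding R by (rule ideal.quotient_is_ring[OF h.kernel_is_ideal])
  have "(\<lambda>C. the_elem (path_map ` C)) \<in> ring_iso (R_ring p) (LipR :: ((nat \<Rightarrow> vertex) \<Rightarrow> padic set set \<Rightarrow> 'k) ring)"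
    unfolding R by (rule h.FactRing_iso_set[OF path_map_surj])
  then show ?thesis
  proof (rule R.ring_iso_restrict)
    fix C :: "(vertex \<Rightarrow> 'k) set" assume "C \<in> carrier (R_ring p)"
    from coset_properties[OF this] obtain a where a: "a \<in> C" "\<forall>c\<in>C. path_map c = path_map a"
      "\<forall>T\<in>cyc_tree p. coord C T = a T" by (elim bexE conjE)
    have "path_map ` C = (\<lambda>_. path_map a) ` C" by (rule image_cong[OF refl bspec[OF a(2)]])
    then have "path_map ` C = {path_map a}" using a(1) by (simp add: image_constant)
    then show "the_elem (path_map ` C) = Phi p C" using Phi_eq_path_map[OF a(3)] by simp
  qed
qed

text \<open>
  If \<open>p ^ L\<close> is the least size of a vertex with a nonzero component, the components along any path vanish
  below level \<open>L\<close>, and a path through such a vertex attains the norm \<open>p^-L\<close>.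
\<close>

theorem sup_norm_Phi:
  fixes C :: "(vertex \<Rightarrow> 'k::field) set"
  assumes C: "C \<in> carrier (R_ring p)"
  shows "sup_norm p (Phi p C) = IV_norm p C"
proof -
  from coset_properties[OF C] obtain a where a: "\<forall>T\<in>cyc_tree p. coord C T = a T"
      "C = \<zero>\<^bsub>R_ring p\<^esub> \<longleftrightarrow> (\<forall>T\<in>cyc_tree p. a T = 0)"
    by (elim bexE conjE)
  let ?w = "\<lambda>x. W_vec p (\<lambda>n. a (x n))"
  have "Phi p C = path_map a" using a(1) by (rule Phi_eq_path_map)
  then have sup: "sup_norm p (Phi p C) = (SUP x\<in>P1 p. W_norm p (?w x))"
    unfolding sup_norm_def by (intro SUP_cong) (auto simp: path_map_def)
  show ?thesis
  proof (cases "C = \<zero>\<^bsub>R_ring p\<^esub>")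
    case True
    then have zero: "path_map a = (\<zero>\<^bsub>LipR\<^esub> :: (nat \<Rightarrow> vertex) \<Rightarrow> padic set set \<Rightarrow> 'k)"
      using a(2) by (simp add: path_map_eq_zero_iff)
    have "?w x = \<zero>\<^bsub>W_Zp p\<^esub>" if "x \<in> P1 p" for x
      using that fun_cong[OF zero, of x] by (simp add: path_map_def Lip_def)
    then have "(SUP x\<in>P1 p. W_norm p (?w x)) = (SUP x\<in>P1 p. 0)"
      by (intro SUP_cong) (auto simp: W_norm_def)
    also have "\<dots> = 0" using P1_nonempty by simp
    finally show ?thesis unfolding sup using True by (simp add: IV_norm_def)
  next
    case False
    let ?Q = "\<lambda>n. \<exists>T\<in>cyc_tree p. gset_size (Zp2 p) T = p ^ n \<and> coord C T \<noteq> 0"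
    define L where "L = (LEAST n. ?Q n)"
    obtain T where T: "T \<in> cyc_tree p" "a T \<noteq> 0" using False a(2) by blast
    then obtain y m where "y \<in> P1 p" "y m = T" using ex_path_through by blast
    then have "?Q m" using T P1_size a(1) by auto
    then have "?Q L" unfolding L_def by (rule LeastI)
    then obtain U where U: "U \<in> cyc_tree p" "gset_size (Zp2 p) U = p ^ L" "a U \<noteq> 0" using a(1) by auto
    then obtain z l where z: "z \<in> P1 p" "z l = U" using ex_path_through by blast
    then have "p ^ l = p ^ L" using P1_size U by metis
    then have "z L = U" using z p_gt_1 by simp
    have zero: "a (x i) = 0" if "x \<in> P1 p" "i < L" for x i
      using not_less_Least[of i ?Q] that P1_cyc_tree P1_size a(1) unfolding L_def by metis
    have le: "W_norm p (?w x) \<le> 1 / real p ^ L" if "x \<in> P1 p" for x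
      using zero[OF that] by (subst W_norm_le_iff) auto
    have ge: "\<not> W_norm p (?w z) \<le> 1 / real p ^ Suc L"
      using \<open>z L = U\<close> U(3) by (subst W_norm_le_iff) auto
    have "W_norm p (?w z) = 1 / real p ^ L"
    proof -
      have nz: "?w z \<noteq> \<zero>\<^bsub>W_Zp p\<^esub>" using ge by (auto simp: W_norm_def)
      have "(LEAST n. a (z n) \<noteq> 0) = L"
        using zero[OF z(1)] \<open>z L = U\<close> U(3) by (intro Least_equality) (auto intro: leI)
      then show ?thesis using nz by (simp add: W_norm_def)
    qed
    then have "(SUP x\<in>P1 p. W_norm p (?w x)) = 1 / real p ^ L"
      using z(1) le by (intro cSup_eq_maximum) (auto simp: image_iff intro: bexI[of _ z])
    then show ?thesis using False by (simp add: sup IV_norm_def L_def)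
  qed
qed

end

theorem theorem5p11:
  fixes p :: nat
    and \<Phi> :: "(vertex \<Rightarrow> 'k::field) set \<Rightarrow> (nat \<Rightarrow> vertex) \<Rightarrow> padic set set \<Rightarrow> 'k"
  assumes "prime p" and "CHAR('k) = p"
  defines "\<Phi> \<equiv> Phi p"
  shows "\<Phi> \<in> ring_iso (R_ring p) (Lip p (1 / real p)) \<and>
    (\<forall>a\<in>carrier (R_ring p). sup_norm p (\<Phi> a) = IV_norm p a) \<and>
    (\<forall>a\<in>carrier (R_ring p). \<forall>b\<in>carrier (R_ring p).
       sup_norm p (\<Phi> a \<ominus>\<^bsub>Lip p (1 / real p)\<^esub> \<Phi> b) = IV_norm p (a \<ominus>\<^bsub>R_ring p\<^esub> b))"
proof -
  interpret padic_group p by standard (rule assms(1))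
  interpret h: ring_hom_ring W2 "LipR :: ((nat \<Rightarrow> vertex) \<Rightarrow> padic set set \<Rightarrow> 'k) ring" path_map
    by (rule path_map_ring_hom_ring)
  have iso: "Phi p \<in> ring_iso (R_ring p) (LipR :: ((nat \<Rightarrow> vertex) \<Rightarrow> padic set set \<Rightarrow> 'k) ring)"
    by (rule Phi_ring_iso)
  interpret R: ring "R_ring p :: (vertex \<Rightarrow> 'k) set ring"
    unfolding R_ring_def J_ideal_eq_kernel by (rule ideal.quotient_is_ring[OF h.kernel_is_ideal])
  interpret Phi: ring_hom_ring "R_ring p" "LipR :: ((nat \<Rightarrow> vertex) \<Rightarrow> padic set set \<Rightarrow> 'k) ring" "Phi p"
    using iso by (intro ring_hom_ringI2 R.ring_axioms h.S.ring_axioms) (simp add: ring_iso_def)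
  have diff: "Phi p a \<ominus>\<^bsub>LipR\<^esub> Phi p b = Phi p (a \<ominus>\<^bsub>R_ring p\<^esub> b)"
    if "a \<in> carrier (R_ring p)" "b \<in> carrier (R_ring p)" for a b :: "(vertex \<Rightarrow> 'k) set"
    using that by (simp add: a_minus_def)
  show ?thesis
    unfolding \<Phi>_def using iso diff by (simp add: sup_norm_Phi)
qed

end
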